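(* There exist numerical constants $C, C' > 0$ such that the following holds. Let $f$, $\boldsymbol{a}$, $\boldsymbol{x}_0$, $\{(\boldsymbol{a}_i,y_i)\}_{i=1}^m$ and $K$ be as in the noisy $1$-bit Gaussian measurement model and signal model described in the context, assume that $K \subset B_2^n = \{\boldsymbol{x}\in\mathbb{R}^n : \|\boldsymbol{x}\|_2 \le 1\}$, and let $g \sim \mathcal{N}(0,1)$ be independent of $f$. Assume that (C1) $\lambda := \mathbb{E}[f(g)g] > 0$, and (C2) $\mathbb{E}[f(g)\,\mathrm{sign}(g) \mid |g|] \ge 0$ almost surely. Let $\mu \in [0,1]$ be a minimizer of $\min_{s\in[0,1]} \mathbb{E}[\max\{0, 1 - s f(g) g\}]$. For every $t \in (0,\mu)$ and $\eta \in (0,\tfrac12)$, the following holds true with probability at least $1-\eta$: If the number of samples obeys $$m \ge C\cdot \lambda^{-2}\cdot t^{-2}\cdot \max\{ d_t(K - \mu\boldsymbol{x}_0), \log(\eta^{-1})\},$$ then any minimizer $\hat{\boldsymbol{x}}$ of the convex program $$\min_{\boldsymbol{x}\in\mathbb{R}^n} \tfrac1m\sum_{i=1}^m \max\{0, 1 - y_i\langle \boldsymbol{a}_i,\boldsymbol{x}\rangle\} \quad\text{subject to}\quad \boldsymbol{x}\in K$$ satisfies $$\Big\| \boldsymbol{x}_0 - \frac{\hat{\boldsymbol{x}}}{\|\hat{\boldsymbol{x}}\|_2}\Big\|_2 \le \frac{t}{\mu} \le C'\cdot t\cdot\sqrt{\log(\lambda^{-1})}.$$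
   Context: Measurement model: $f:\mathbb{R}\to\{-1,+1\}$ is a (possibly random) quantization function, i.e. $f(v) = \tilde f(v,\tau)$ for some $\tilde f:\mathbb{R}\times\mathbb{R}\to\{-1,+1\}$ and a random variable $\tau$; $\boldsymbol{a}\sim\mathcal{N}(\boldsymbol{0},\boldsymbol{I}_n)$ is a standard Gaussian random vector in $\mathbb{R}^n$ independent of $f$ (i.e. of $\tau$). For $\boldsymbol{x}_0\in\mathbb{R}^n$ put $y := f(\langle\boldsymbol{a},\boldsymbol{x}_0\rangle)\in\{-1,+1\}$. The samples $(\boldsymbol{a}_i,y_i)$, $i=1,\dots,m$, are independent copies of $(\boldsymbol{a},y)$; thus $y_i = f_i(\langle\boldsymbol{a}_i,\boldsymbol{x}_0\rangle)$ with $f_i = \tilde f(\cdot,\tau_i)$ an independent copy of $f$. Signal model: $\|\boldsymbol{x}_0\|_2 = 1$, $\boldsymbol{x}_0\in K$, and $K\subset\mathbb{R}^n$ is convex, bounded, and contains $\boldsymbol{0}$. Convention: $\mathrm{sign}(v)=+1$ for $v\ge 0$ and $\mathrm{sign}(v)=-1$ for $v<0$. Complexity: for bounded $L\subset\mathbb{R}^n$ the Gaussian width is $w(L) := \mathbb{E}[\sup_{\boldsymbol{x}\in L}\langle\boldsymbol{g},\boldsymbol{x}\rangle]$ with $\boldsymbol{g}\sim\mathcal{N}(\boldsymbol{0},\boldsymbol{I}_n)$. For $t>0$ and $\boldsymbol{z}\in\mathbb{R}^n$, the local effective dimension of $K$ in $\boldsymbol{z}$ at scale $t$ is $d_t(K-\boldsymbol{z})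 := w\big((K-\boldsymbol{z})\cap tB_2^n\big)^2/t^2$. A numerical constant is one that does not depend on any other parameter involved (in particular not on $n,m,K,\boldsymbol{x}_0,f,t,\eta$). *)

theory Defs
  imports "HOL-Probability.Probability"
begin

text \<open>
  The constants of the theorem must not depend on the dimension, so \<open>n\<close> is a natural number
  quantified inside the formula and not a finite index type. A vector of $R^n$ is a function
  \<^typ>\<open>nat \<Rightarrow> real\<close> in \<open>{..<n} \<rightarrow>\<^sub>E UNIV\<close>, i.e. it takes the value \<^term>\<open>undefined\<close> outside
  \<open>{..<n}\<close>; this is the underlying set of the product measure \<open>PiM {..<n}\<close> used for the Gaussian
  vectors. The Euclidean norm of \<open>x\<close> is \<^term>\<open>L2_set x {..<n}\<close>.
\<close>

definition vec_space :: "nat \<Rightarrow> (nat \<Rightarrow> real) set" where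
  "vec_space n = {..<n} \<rightarrow>\<^sub>E UNIV"

definition vec_zero :: "nat \<Rightarrow> nat \<Rightarrow> real" where
  "vec_zero n = (\<lambda>i\<in>{..<n}. 0)"

definition vec_add :: "nat \<Rightarrow> (nat \<Rightarrow> real) \<Rightarrow> (nat \<Rightarrow> real) \<Rightarrow> nat \<Rightarrow> real" where
  "vec_add n x y = (\<lambda>i\<in>{..<n}. x i + y i)"

definition vec_diff :: "nat \<Rightarrow> (nat \<Rightarrow> real) \<Rightarrow> (nat \<Rightarrow> real) \<Rightarrow> nat \<Rightarrow> real" where
  "vec_diff n x y = (\<lambda>i\<in>{..<n}. x i - y i)"

definition vec_scale :: "nat \<Rightarrow> real \<Rightarrow> (nat \<Rightarrow> real) \<Rightarrow> nat \<Rightarrow> real" where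
  "vec_scale n c x = (\<lambda>i\<in>{..<n}. c * x i)"

definition vec_inner :: "nat \<Rightarrow> (nat \<Rightarrow> real) \<Rightarrow> (nat \<Rightarrow> real) \<Rightarrow> real" where
  "vec_inner n x y = (\<Sum>i<n. x i * y i)"

abbreviation vec_norm :: "nat \<Rightarrow> (nat \<Rightarrow> real) \<Rightarrow> real" where
  "vec_norm n x \<equiv> L2_set x {..<n}"

definition vec_ball :: "nat \<Rightarrow> real \<Rightarrow> (nat \<Rightarrow> real) set" where
  "vec_ball n r = {x \<in> vec_space n. vec_norm n x \<le> r}"

definition vec_convex :: "nat \<Rightarrow> (nat \<Rightarrow> real) set \<Rightarrow> bool" where
  "vec_convex n K \<longleftrightarrow>
     (\<forall>x\<in>K. \<forall>y\<in>K. \<forall>u\<ge>0. \<forall>v\<ge>0. u + v = 1 \<longrightarrow>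
        vec_add n (vec_scale n u x) (vec_scale n v y) \<in> K)"

definition std_gauss :: "nat \<Rightarrow> (nat \<Rightarrow> real) measure" where
  "std_gauss n = PiM {..<n} (\<lambda>_. std_normal_distribution)"

definition gaussian_width :: "nat \<Rightarrow> (nat \<Rightarrow> real) set \<Rightarrow> real" where
  "gaussian_width n L = (\<integral>g. (SUP x\<in>L. vec_inner n g x) \<partial>std_gauss n)"

text \<open>\<open>eff_dim n t (K - z)\<close> is the local effective dimension of \<open>K\<close> in \<open>z\<close> at scale \<open>t\<close>.\<close>

definition eff_dim :: "nat \<Rightarrow> real \<Rightarrow> (nat \<Rightarrow> real) set \<Rightarrow> real" where
  "eff_dim n t L = (gaussian_width n (L \<inter> vec_ball n t))\<^sup>2 / t\<^sup>2"

text \<open>Unlike the library's \<^const>\<open>sgn\<close>, this sign is \<open>1\<close> at \<open>0\<close>.\<close>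

definition sign1 :: "real \<Rightarrow> real" where
  "sign1 v = (if v \<ge> 0 then 1 else - 1)"

text \<open>
  A random quantizer \<open>f v = F v \<tau>\<close> is given by a jointly measurable function \<open>F\<close> with values in
  \<open>{-1, 1}\<close> and the law \<open>T\<close> of the real random variable \<open>\<tau>\<close>. A deterministic quantizer is one
  where \<open>F v\<close> is constant.
\<close>

definition quantizer :: "(real \<Rightarrow> real \<Rightarrow> real) \<Rightarrow> real measure \<Rightarrow> bool" where
  "quantizer F T \<longleftrightarrow>
     prob_space T \<and> sets T = sets borel \<and>
     case_prod F \<in> borel_measurable (borel \<Otimes>\<^sub>M borel) \<and>
     (\<forall>v s. F v s \<in> {-1, 1})"

text \<open>
  The joint law of \<open>(g, \<tau>)\<close> with \<open>g\<close> standard normal and independent of \<open>\<tau>\<close>. On this space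
  \<open>g = fst\<close> and \<open>f(g) = case_prod F\<close>.
\<close>

definition gauss_noise :: "real measure \<Rightarrow> (real \<times> real) measure" where
  "gauss_noise T = std_normal_distribution \<Otimes>\<^sub>M T"

definition correlation :: "(real \<Rightarrow> real \<Rightarrow> real) \<Rightarrow> real measure \<Rightarrow> real" where
  "correlation F T = (\<integral>(g, s). F g s * g \<partial>gauss_noise T)"

definition hinge :: "real \<Rightarrow> real" where
  "hinge v = max 0 (1 - v)"

definition hinge_risk :: "(real \<Rightarrow> real \<Rightarrow> real) \<Rightarrow> real measure \<Rightarrow> real \<Rightarrow> real" where
  "hinge_risk F T s = (\<integral>(g, \<tau>). hinge (s * F g \<tau> * g) \<partial>gauss_noise T)"

text \<open>The conditioning is on the sigma-algebra generated by \<open>\<bar>g\<bar>\<close>.\<close>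

definition cond_sign_nonneg :: "(real \<Rightarrow> real \<Rightarrow> real) \<Rightarrow> real measure \<Rightarrow> bool" where
  "cond_sign_nonneg F T \<longleftrightarrow>
     (AE p in gauss_noise T.
        real_cond_exp (gauss_noise T)
          (vimage_algebra (space (gauss_noise T)) (\<lambda>(g, s). \<bar>g\<bar>) borel)
          (\<lambda>(g, s). F g s * sign1 g) p \<ge> 0)"

text \<open>
  The joint law of \<open>(a\<^sub>i, \<tau>\<^sub>i)\<close> for \<open>i < m\<close>: these pairs are independent copies of \<open>(a, \<tau>)\<close>, with
  \<open>a\<close> a standard Gaussian vector independent of \<open>\<tau>\<close>. At an outcome \<open>\<omega>\<close> one has
  \<open>a\<^sub>i = fst (\<omega> i)\<close> and \<open>\<tau>\<^sub>i = snd (\<omega> i)\<close>. The samples are modelled on this space, since an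
  arbitrary sample space would bring in a type that the constants might depend on.
\<close>

definition samples :: "nat \<Rightarrow> nat \<Rightarrow> real measure \<Rightarrow> (nat \<Rightarrow> (nat \<Rightarrow> real) \<times> real) measure" where
  "samples n m T = PiM {..<m} (\<lambda>_. std_gauss n \<Otimes>\<^sub>M T)"

definition response ::
  "nat \<Rightarrow> (real \<Rightarrow> real \<Rightarrow> real) \<Rightarrow> (nat \<Rightarrow> real) \<Rightarrow> (nat \<Rightarrow> (nat \<Rightarrow> real) \<times> real) \<Rightarrow> nat \<Rightarrow> real" where
  "response n F x0 \<omega> i = F (vec_inner n (fst (\<omega> i)) x0) (snd (\<omega> i))"

definition empirical_hinge ::
  "nat \<Rightarrow> nat \<Rightarrow> (nat \<Rightarrow> nat \<Rightarrow> real) \<Rightarrow> (nat \<Rightarrow> real) \<Rightarrow> (nat \<Rightarrow> real) \<Rightarrow> real" where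
  "empirical_hinge n m a y x = 1 / real m * (\<Sum>i<m. hinge (y i * vec_inner n (a i) x))"

end

theory Submission
  imports Defs
begin

text \<open>
  Write \<open>h = x - \<mu> x\<^sub>0\<close>. The empirical risk is convex, so if a minimizer had distance more than
  \<open>r = t/2\<close> from \<open>\<mu> x\<^sub>0\<close>, then some point of \<open>K\<close> at distance exactly \<open>r\<close> would have empirical risk
  at most that of \<open>\<mu> x\<^sub>0\<close> (\<open>minimizer_in_ball\<close>). Hence it suffices that, with probability
  \<open>1 - \<eta>\<close>, the empirical excess risk is positive on the whole sphere \<open>\<parallel>h\<parallel> = r\<close> inside \<open>K\<close>. Normalizing
  a vector within \<open>t/2\<close> of \<open>\<mu> x\<^sub>0\<close> and dividing by \<open>\<mu>\<close> loses a factor two, which gives \<open>t/\<mu>\<close>.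

  The expected excess risk is at least \<open>c \<lambda> r\<^sup>2\<close> on the sphere (\<open>excess_risk_ge\<close>). Split
  \<open>x = s x\<^sub>0 + v\<close> with \<open>v\<close> orthogonal to \<open>x\<^sub>0\<close>; then \<open>\<langle>a,v\<rangle>\<close> is a centred Gaussian
  independent of \<open>g = \<langle>a,x\<^sub>0\<rangle>\<close> and of the noise. The hinge loss exceeds its tangent, and the expected
  tangent term is nonnegative by the first-order optimality of \<open>\<mu>\<close>. What remains is a gain of
  \<open>r/2\<close> whenever the margin \<open>f(g) g\<close> lies in a window of length \<open>r/2\<close> next to the kink \<open>1/\<mu>\<close> and
  \<open>\<langle>a,v\<rangle>\<close> has the right sign and at least its standard deviation in modulus. By (C2) the
  margin lies in that window with at least half the probability that \<open>g\<close> does, which is of order \<open>r \<phi>(1/\<mu>)\<close> with \<open>\<phi>\<close> the normal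
  density, and optimality of \<open>\<mu>\<close> gives \<open>\<lambda> \<le> 2 \<phi>(1/\<mu>)\<close> if \<open>\<mu> < 1\<close>; for
  \<open>\<mu> = 1\<close> the probability is of order \<open>r\<close> and \<open>\<lambda>\<close> is bounded. The bound on \<open>\<lambda>\<close> also
  yields \<open>1/\<mu> \<le> C' sqrt (ln (1/\<lambda>))\<close> (\<open>inverse_\<mu>_le\<close>).

  The deviation of the empirical excess risk from its mean is controlled through exponential
  moments. For one sample, symmetrization and the contraction principle replace the centred loss
  increment at \<open>h\<close> by twice \<open>\<langle>a,h\<rangle>\<close> inside any functional of the form
  \<open>exp (Max\<^sub>h (A h + \<dots>))\<close> (\<open>one_sample_comparison\<close>). As the offsets \<open>A\<close> are arbitrary, the samples
  can be exchanged one at a time, and sums of independent Gaussian vectors are Gaussian, so the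
  process is dominated by \<open>2 sqrt m \<langle>g,h\<rangle>\<close> with one Gaussian vector \<open>g\<close>
  (\<open>samples_comparison\<close>). The maximum of \<open>\<langle>g,h\<rangle>\<close> over \<open>h\<close> has mean at most the Gaussian width, and
  its fluctuations are subgaussian with variance proxy of order \<open>r\<^sup>2\<close>: this is Gaussian concentration,
  derived here from Maurey's property (tau), which tensorizes by Fubini and is in dimension one a
  case of the Prekopa-Leindler inequality. Everything is done for finite index sets; a countable
  dense subset of the sphere and continuity give the uniform bound.
\<close>

section \<open>Vectors and the standard Gaussian measure\<close>

lemma vec_inner_add_left: "vec_inner n (vec_add n x y) z = vec_inner n x z + vec_inner n y z"
  by (simp add: vec_inner_def vec_add_def sum.distrib algebra_simps)

lemma vec_inner_scale_left: "vec_inner n (vec_scale n c x) z = c * vec_inner n x z"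
  by (simp add: vec_inner_def vec_scale_def sum_distrib_left algebra_simps)

lemma vec_inner_commute: "vec_inner n x y = vec_inner n y x"
  by (simp add: vec_inner_def mult.commute)

lemma vec_inner_add_right: "vec_inner n z (vec_add n x y) = vec_inner n z x + vec_inner n z y"
  by (metis vec_inner_add_left vec_inner_commute)

lemma vec_inner_scale_right: "vec_inner n z (vec_scale n c x) = c * vec_inner n z x"
  by (metis vec_inner_scale_left vec_inner_commute)

lemma vec_inner_diff_right: "vec_inner n z (vec_diff n x y) = vec_inner n z x - vec_inner n z y"
  by (simp add: vec_inner_def vec_diff_def sum_subtractf algebra_simps)

lemmas vec_inner_linear =
  vec_inner_add_left vec_inner_scale_left vec_inner_add_right vec_inner_scale_right
  vec_inner_diff_right

lemma vec_inner_self: "vec_inner n x x = (vec_norm n x)\<^sup>2"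
  by (simp add: vec_inner_def L2_set_def sum_nonneg power2_eq_square)

lemma abs_vec_inner_le: "\<bar>vec_inner n x y\<bar> \<le> vec_norm n x * vec_norm n y"
  using L2_set_mult_ineq[of "x" "y" "{..<n}"]
  by (simp add: vec_inner_def abs_mult order.trans[OF sum_abs])

lemma space_std_gauss: "space (std_gauss n) = vec_space n"
  by (simp add: std_gauss_def vec_space_def space_PiM)

lemma sets_std_gauss [measurable_cong]: "sets (std_gauss n) = sets (PiM {..<n} (\<lambda>_. borel))"
  unfolding std_gauss_def by (intro sets_PiM_cong) auto

lemma vec_diff_in_space [simp]: "vec_diff n x y \<in> vec_space n"
  by (auto simp: vec_diff_def vec_space_def)

lemma prob_space_std_normal: "prob_space std_normal_distribution"
  by (rule prob_space_normal_density) simp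

lemma product_sigma_finite_std_normal:
  "product_sigma_finite (\<lambda>_::nat. std_normal_distribution)"
  unfolding product_sigma_finite_def
  using prob_space_std_normal by (simp add: prob_space_imp_sigma_finite)

lemma prob_space_std_gauss: "prob_space (std_gauss n)"
  unfolding std_gauss_def by (rule prob_space_PiM) (rule prob_space_std_normal)

lemma measurable_coord_std_gauss:
  "i < n \<Longrightarrow> (\<lambda>x. x i) \<in> borel_measurable (std_gauss n)"
  by measurable

lemma measurable_coord_restrict:
  "i < n \<Longrightarrow> f \<in> measurable M (std_gauss n) \<Longrightarrow> (\<lambda>x. f x i) \<in> borel_measurable M"
  using measurable_compose[OF _ measurable_coord_std_gauss] by blast

lemma measurable_vec_inner [measurable (raw)]:
  assumes f: "f \<in> measurable M (std_gauss n)"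
  shows "(\<lambda>x. vec_inner n (f x) y) \<in> borel_measurable M"
  unfolding vec_inner_def using measurable_coord_restrict[OF _ f]
  by (intro borel_measurable_sum borel_measurable_times) auto

lemma measurable_into_std_gauss:
  assumes "\<And>i. i < n \<Longrightarrow> (\<lambda>x. f x i) \<in> borel_measurable M" "\<And>x. x \<in> space M \<Longrightarrow> f x \<in> vec_space n"
  shows "f \<in> measurable M (std_gauss n)"
proof -
  have "f \<in> measurable M (PiM {..<n} (\<lambda>_. borel))"
    using assms by (intro measurable_PiM_single') (auto simp: vec_space_def)
  then show ?thesis by (simp add: measurable_cong_sets[OF refl sets_std_gauss])
qed

lemma measurable_vec_add [measurable (raw)]:
  assumes "f \<in> measurable M (std_gauss n)" "g \<in> measurable M (std_gauss n)"
  shows "(\<lambda>x. vec_add n (f x) (g x)) \<in> measurable M (std_gauss n)"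
  using assms[THEN measurable_coord_restrict[rotated]]
  by (intro measurable_into_std_gauss) (auto simp: vec_add_def vec_space_def)

lemma measurable_vec_scale [measurable (raw)]:
  assumes "f \<in> measurable M (std_gauss n)"
  shows "(\<lambda>x. vec_scale n c (f x)) \<in> measurable M (std_gauss n)"
  using assms measurable_coord_restrict[OF _ assms(1)]
  by (intro measurable_into_std_gauss) (auto simp: vec_scale_def vec_space_def)

text \<open>
  Scaling a constant vector by a random scalar, as opposed to scaling a random vector by a constant:
  the two shapes are kept apart because in the first the vector may lie outside the space of the
  measure.
\<close>

lemma measurable_vec_scale_const [measurable (raw)]:
  assumes "g \<in> borel_measurable M"
  shows "(\<lambda>x. vec_scale n (g x) y) \<in> measurable M (std_gauss n)"
  using assms
  by (intro measurable_into_std_gauss) (auto simp: vec_scale_def vec_space_def)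

lemma nn_integral_std_normal:
  assumes [measurable]: "f \<in> borel_measurable borel"
  shows "(\<integral>\<^sup>+x. f x \<partial>std_normal_distribution) = (\<integral>\<^sup>+x. ennreal (std_normal_density x) * f x \<partial>lborel)"
  by (subst nn_integral_density) auto

lemma nn_integral_std_normal_shift:
  fixes c :: real
  assumes [measurable]: "f \<in> borel_measurable borel"
  shows "(\<integral>\<^sup>+x. f (x + c) \<partial>std_normal_distribution) =
         (\<integral>\<^sup>+x. f x * ennreal (exp (x * c - c * c / 2)) \<partial>std_normal_distribution)"
proof -
  have "(\<integral>\<^sup>+x. f x * ennreal (exp (x * c - c * c / 2)) \<partial>std_normal_distribution) =
        (\<integral>\<^sup>+x. ennreal (std_normal_density x) * (f x * ennreal (exp (x * c - c * c / 2))) \<partial>lborel)"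
    by (subst nn_integral_std_normal) auto
  also have "\<dots> = (\<integral>\<^sup>+x. ennreal (std_normal_density (c + x)) * (f (c + x) * ennreal (exp ((c + x) * c - c * c / 2))) \<partial>lborel)"
    by (subst nn_integral_real_affine[where c=1 and t=c]) auto
  also have "\<dots> = (\<integral>\<^sup>+x. ennreal (std_normal_density x) * f (x + c) \<partial>lborel)"
  proof (intro nn_integral_cong)
    fix x :: real
    have "std_normal_density (c + x) * exp ((c + x) * c - c * c / 2) = std_normal_density x"
      by (simp add: std_normal_density_def exp_add[symmetric] field_simps power2_eq_square)
    then have *: "ennreal (std_normal_density (c + x)) * ennreal (exp ((c + x) * c - c * c / 2))
       = ennreal (std_normal_density x)"
      by (simp add: ennreal_mult'[symmetric])
    show "ennreal (std_normal_density (c + x)) * (f (c + x) * ennreal (exp ((c + x) * c - c * c / 2))) =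
      ennreal (std_normal_density x) * f (x + c)"
      unfolding *[symmetric] by (simp add: ac_simps)
  qed
  also have "\<dots> = (\<integral>\<^sup>+x. f (x + c) \<partial>std_normal_distribution)"
    by (subst nn_integral_std_normal) auto
  finally show ?thesis by simp
qed

lemma indicator_PiE_prod:
  fixes n :: nat
  assumes "x \<in> extensional {..<n}"
  shows "(indicator (Pi\<^sub>E {..<n} A) x :: ennreal) = (\<Prod>i<n. indicator (A i) (x i))"
proof -
  have "(\<Prod>i<n. indicator (A i) (x i) :: ennreal) = 0" if "i < n" "x i \<notin> A i" for i
    using that by (intro prod_zero) (auto intro: bexI[of _ i])
  then show ?thesis using assms by (auto simp: indicator_def PiE_iff)
qed

lemma vec_space_extensional: "x \<in> vec_space n \<Longrightarrow> x \<in> extensional {..<n}"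
  by (simp add: vec_space_def PiE_def)

text \<open>
  Both measures agree with the product of the \<open>N i\<close> on boxes. In the proof the \<open>N i\<close> are redefined
  outside \<open>{..<n}\<close>, where they need not be sigma-finite.
\<close>

lemma product_measure_eqI:
  assumes N: "\<And>i. i < n \<Longrightarrow> sigma_finite_measure (N i)" "\<And>i. i < n \<Longrightarrow> sets (N i) = sets borel"
    and P: "sets P = sets (std_gauss n)" "sets Q = sets (std_gauss n)"
    and eq: "\<And>A. (\<And>i. A i \<in> sets (borel :: real measure)) \<Longrightarrow> emeasure P (Pi\<^sub>E {..<n} A) = (\<Prod>i<n. emeasure (N i) (A i))"
     "\<And>A. (\<And>i. A i \<in> sets (borel :: real measure)) \<Longrightarrow> emeasure Q (Pi\<^sub>E {..<n} A) = (\<Prod>i<n. emeasure (N i) (A i))"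
  shows "P = Q"
proof -
  define N' where "N' i = (if i < n then N i else lborel)" for i
  have s: "sets (N' i) = sets borel" for i by (simp add: N'_def N)
  interpret product_sigma_finite N'
    unfolding product_sigma_finite_def N'_def
    using N(1) by (simp add: lborel.sigma_finite_measure_axioms)
  have sP: "sets (PiM {..<n} N') = sets (std_gauss n)"
    unfolding sets_std_gauss by (intro sets_PiM_cong) (auto simp: s)
  have "R = PiM {..<n} N'" if R: "sets R = sets (std_gauss n)" and
    eqR: "\<And>A. (\<And>i. A i \<in> sets (borel :: real measure)) \<Longrightarrow> emeasure R (Pi\<^sub>E {..<n} A) = (\<Prod>i<n. emeasure (N i) (A i))" for R
  proof (rule PiM_eqI)
    fix A assume A: "\<And>i. i \<in> {..<n} \<Longrightarrow> A i \<in> sets (N' i)"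
    define A' where "A' i = (if i < n then A i else {})" for i
    have "Pi\<^sub>E {..<n} A = Pi\<^sub>E {..<n} A'" by (intro PiE_cong) (auto simp: A'_def)
    moreover have "A' i \<in> sets borel" for i using A[of i] by (auto simp: A'_def s)
    ultimately show "emeasure R (Pi\<^sub>E {..<n} A) = (\<Prod>i<n. emeasure (N' i) (A i))"
      using eqR[of A'] by (auto simp: A'_def N'_def intro!: prod.cong)
  qed (simp_all add: R sP)
  from this[OF P(1) eq(1)] this[OF P(2) eq(2)] show ?thesis by simp
qed

lemma PiE_in_sets_std_gauss: "(\<And>i. A i \<in> sets (borel :: real measure)) \<Longrightarrow> Pi\<^sub>E {..<n} A \<in> sets (std_gauss n)"
  by (auto intro!: sets_PiM_I_finite simp: sets_std_gauss)

lemma vec_add_extensional [simp]: "vec_add n x y \<in> extensional {..<n}"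
  by (simp add: vec_add_def)

section \<open>Translation, resampling and rotation of Gaussian vectors\<close>

text \<open>
  The Cameron-Martin formula. Both sides are product measures, so it suffices to compare
  the factors, where it is a change of variables.
\<close>

lemma nn_integral_std_gauss_shift:
  assumes [measurable]: "H \<in> borel_measurable (std_gauss n)"
  shows "(\<integral>\<^sup>+a. H (vec_add n a c) \<partial>std_gauss n) =
         (\<integral>\<^sup>+a. H a * ennreal (exp (vec_inner n a c - vec_inner n c c / 2)) \<partial>std_gauss n)"
proof -
  interpret product_sigma_finite "\<lambda>_::nat. std_normal_distribution"
    by (rule product_sigma_finite_std_normal)
  let ?N = "\<lambda>i. density std_normal_distribution (\<lambda>x. ennreal (exp (x * c i - c i * c i / 2)))"
  let ?P = "distr (std_gauss n) (std_gauss n) (\<lambda>a. vec_add n a c)"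
  let ?e = "\<lambda>a. ennreal (exp (vec_inner n a c - vec_inner n c c / 2))"
  let ?Q = "density (std_gauss n) ?e"
  have shift[measurable]: "(\<lambda>a. vec_add n a c) \<in> measurable (std_gauss n) (std_gauss n)"
    by (intro measurable_into_std_gauss) (auto simp: vec_add_def vec_space_def)
  have e: "?e a = (\<Prod>i<n. ennreal (exp (a i * c i - c i * c i / 2)))" for a
    by (simp add: prod_ennreal exp_sum[symmetric] vec_inner_def sum_subtractf sum_divide_distrib)
  have "?P = ?Q"
  proof (rule product_measure_eqI[where N = ?N])
    fix i
    have "prob_space (distr std_normal_distribution borel (\<lambda>x. x + c i))"
      by (intro prob_space.prob_space_distr prob_space_std_normal) simp
    moreover have "distr std_normal_distribution borel (\<lambda>x. x + c i) = ?N i"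
    proof (rule measure_eqI)
      fix A assume "A \<in> sets (distr std_normal_distribution borel (\<lambda>x. x + c i))"
      then have [measurable]: "A \<in> sets borel" by simp
      show "emeasure (distr std_normal_distribution borel (\<lambda>x. x + c i)) A = emeasure (?N i) A"
        using nn_integral_std_normal_shift[of "indicator A" "c i"]
        by (simp add: nn_integral_indicator[symmetric] nn_integral_distr nn_integral_density mult.commute
          del: nn_integral_indicator)
    qed simp
    ultimately show "sigma_finite_measure (?N i)" by (simp add: prob_space_imp_sigma_finite)
  next
    fix A assume [measurable]: "\<And>i::nat. A i \<in> sets (borel :: real measure)"
    note PiE_in_sets_std_gauss[of A n, measurable]
    have N: "emeasure (?N i) (A i) = (\<integral>\<^sup>+x. ennreal (exp (x * c i - c i * c i / 2)) * indicator (A i) x \<partial>std_normal_distribution)" for i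
      by (simp add: emeasure_density)
    have "emeasure ?Q (Pi\<^sub>E {..<n} A) = (\<integral>\<^sup>+a. ?e a * indicator (Pi\<^sub>E {..<n} A) a \<partial>std_gauss n)"
      by (simp add: emeasure_density)
    also have "\<dots> = (\<integral>\<^sup>+a. (\<Prod>i<n. ennreal (exp (a i * c i - c i * c i / 2)) * indicator (A i) (a i)) \<partial>std_gauss n)"
      by (intro nn_integral_cong)
        (auto simp: space_std_gauss vec_space_extensional indicator_PiE_prod e prod.distrib)
    also have "\<dots> = (\<Prod>i<n. emeasure (?N i) (A i))"
      unfolding std_gauss_def by (subst product_nn_integral_prod) (auto simp: N)
    finally show "emeasure ?Q (Pi\<^sub>E {..<n} A) = (\<Prod>i<n. emeasure (?N i) (A i))" .
    have "emeasure ?P (Pi\<^sub>E {..<n} A) = (\<integral>\<^sup>+a. indicator (Pi\<^sub>E {..<n} A) (vec_add n a c) \<partial>std_gauss n)"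
      by (simp add: nn_integral_distr nn_integral_indicator[symmetric] del: nn_integral_indicator)
    also have "\<dots> = (\<integral>\<^sup>+a. (\<Prod>i<n. indicator (A i) (a i + c i)) \<partial>std_gauss n)"
      by (intro nn_integral_cong) (auto simp: indicator_PiE_prod vec_add_def)
    also have "\<dots> = (\<Prod>i<n. \<integral>\<^sup>+x. indicator (A i) (x + c i) \<partial>std_normal_distribution)"
      unfolding std_gauss_def by (subst product_nn_integral_prod) auto
    also have "\<dots> = (\<Prod>i<n. emeasure (?N i) (A i))"
      by (intro prod.cong refl, subst nn_integral_std_normal_shift) (auto simp: N mult.commute)
    finally show "emeasure ?P (Pi\<^sub>E {..<n} A) = (\<Prod>i<n. emeasure (?N i) (A i))" .
  qed simp_all
  then have "integral\<^sup>N ?P H = integral\<^sup>N ?Q H" by simp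
  then show ?thesis
    by (simp add: nn_integral_distr nn_integral_density mult.commute)
qed

text \<open>
  Replacing the component of a Gaussian vector along a unit vector \<open>u\<close> by an independent standard
  normal variable does not change its law; this contains the independence of orthogonal projections.
  Substituting \<open>g = \<langle>a,u\<rangle> + k\<close> turns the left side
  into an integral over \<open>k\<close> of translates of \<open>a\<close> by \<open>k u\<close>; by Cameron-Martin the weight of \<open>k\<close>
  becomes the normal density with mean \<open>\<langle>a,u\<rangle>\<close>, whose integral is one.
\<close>

lemma nn_integral_std_gauss_resample:
  assumes [measurable]: "H \<in> borel_measurable (std_gauss n)" and u: "vec_norm n u = 1"
  shows "(\<integral>\<^sup>+a. \<integral>\<^sup>+g. H (vec_add n a (vec_scale n (g - vec_inner n a u) u)) \<partial>std_normal_distribution \<partial>std_gauss n)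
       = (\<integral>\<^sup>+a. H a \<partial>std_gauss n)"
proof -
  interpret G: prob_space "std_gauss n" by (rule prob_space_std_gauss)
  interpret pair_sigma_finite "std_gauss n" lborel ..
  have uu: "vec_inner n u u = 1" using u by (simp add: vec_inner_self)
  have "(\<integral>\<^sup>+g. H (vec_add n a (vec_scale n (g - vec_inner n a u) u)) \<partial>std_normal_distribution)
      = (\<integral>\<^sup>+k. ennreal (std_normal_density (vec_inner n (vec_add n a (vec_scale n k u)) u)) * H (vec_add n a (vec_scale n k u)) \<partial>lborel)"
    if [simp]: "a \<in> space (std_gauss n)" for a
  proof -
    have [measurable]: "(\<lambda>x::real. a) \<in> measurable borel (std_gauss n)" by simp
    show ?thesis
    apply (subst nn_integral_std_normal)
     apply measurable
    apply (subst nn_integral_real_affine[where c=1 and t="vec_inner n a u"])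
      apply (auto simp: vec_inner_linear uu add.commute)
    done
  qed
  then have "(\<integral>\<^sup>+a. \<integral>\<^sup>+g. H (vec_add n a (vec_scale n (g - vec_inner n a u) u)) \<partial>std_normal_distribution \<partial>std_gauss n)
     = (\<integral>\<^sup>+a. \<integral>\<^sup>+k. ennreal (std_normal_density (vec_inner n (vec_add n a (vec_scale n k u)) u)) * H (vec_add n a (vec_scale n k u)) \<partial>lborel \<partial>std_gauss n)"
    by (intro nn_integral_cong) auto
  also have "\<dots> = (\<integral>\<^sup>+k. \<integral>\<^sup>+a. ennreal (std_normal_density (vec_inner n (vec_add n a (vec_scale n k u)) u)) * H (vec_add n a (vec_scale n k u)) \<partial>std_gauss n \<partial>lborel)"
    by (subst Fubini') auto
  also have "\<dots> = (\<integral>\<^sup>+k. \<integral>\<^sup>+a. ennreal (std_normal_density (vec_inner n a u)) * H a * ennreal (exp (vec_inner n a (vec_scale n k u) - vec_inner n (vec_scale n k u) (vec_scale n k u) / 2)) \<partial>std_gauss n \<partial>lborel)"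
    by (intro nn_integral_cong
        nn_integral_std_gauss_shift[where H = "\<lambda>a. ennreal (std_normal_density (vec_inner n a u)) * H a"]) simp
  also have "\<dots> = (\<integral>\<^sup>+k. \<integral>\<^sup>+a. H a * ennreal (normal_density (vec_inner n a u) 1 k) \<partial>std_gauss n \<partial>lborel)"
  proof (intro nn_integral_cong)
    fix k a
    have "std_normal_density (vec_inner n a u) * exp (vec_inner n a (vec_scale n k u) - vec_inner n (vec_scale n k u) (vec_scale n k u) / 2)
       = normal_density (vec_inner n a u) 1 k"
      by (simp add: normal_density_def vec_inner_linear uu exp_add[symmetric] power2_eq_square field_simps)
    then have *: "ennreal (normal_density (vec_inner n a u) 1 k) = ennreal (std_normal_density (vec_inner n a u)) * ennreal (exp (vec_inner n a (vec_scale n k u) - vec_inner n (vec_scale n k u) (vec_scale n k u) / 2))"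
      by (simp add: ennreal_mult'[symmetric])
    show "ennreal (std_normal_density (vec_inner n a u)) * H a * ennreal (exp (vec_inner n a (vec_scale n k u) - vec_inner n (vec_scale n k u) (vec_scale n k u) / 2)) = H a * ennreal (normal_density (vec_inner n a u) 1 k)"
      unfolding * by (simp add: ac_simps)
  qed
  also have "\<dots> = (\<integral>\<^sup>+a. \<integral>\<^sup>+k. H a * ennreal (normal_density (vec_inner n a u) 1 k) \<partial>lborel \<partial>std_gauss n)"
    by (subst Fubini') (auto simp: normal_density_def)
  also have "\<dots> = (\<integral>\<^sup>+a. H a \<partial>std_gauss n)"
    by (intro nn_integral_cong, subst nn_integral_cmult) (auto simp: nn_integral_eq_integral)
  finally show ?thesis .
qed

lemma nn_integral_std_gauss_inner:
  assumes [measurable]: "k \<in> borel_measurable borel" and u: "vec_norm n u = 1"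
  shows "(\<integral>\<^sup>+a. k (vec_inner n a u) \<partial>std_gauss n) = (\<integral>\<^sup>+g. k g \<partial>std_normal_distribution)"
proof -
  interpret G: prob_space "std_gauss n" by (rule prob_space_std_gauss)
  show ?thesis
  using nn_integral_std_gauss_resample[of "\<lambda>a. k (vec_inner n a u)" n u] u
  by (simp add: vec_inner_linear vec_inner_self G.emeasure_space_1)
qed

text \<open>
  Resampling along \<open>u\<close> leaves \<open>\<langle>a,v\<rangle>\<close> alone and makes the first argument an independent variable;
  resampling along the direction of \<open>v\<close> then identifies the law of \<open>\<langle>a,v\<rangle>\<close>.
\<close>

lemma nn_integral_std_gauss_orthogonal_pair:
  assumes [measurable]: "case_prod k \<in> borel_measurable (borel \<Otimes>\<^sub>M borel)"
    and u: "vec_norm n u = 1" and uv: "vec_inner n u v = 0"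
  shows "(\<integral>\<^sup>+a. k (vec_inner n a u) (vec_inner n a v) \<partial>std_gauss n) =
         (\<integral>\<^sup>+g. \<integral>\<^sup>+g'. k g (vec_norm n v * g') \<partial>std_normal_distribution \<partial>std_normal_distribution)"
proof -
  interpret G: prob_space "std_gauss n" by (rule prob_space_std_gauss)
  interpret N: prob_space std_normal_distribution by (rule prob_space_std_normal)
  interpret pair_sigma_finite "std_gauss n" std_normal_distribution ..
  have "(\<integral>\<^sup>+a. k (vec_inner n a u) (vec_inner n a v) \<partial>std_gauss n)
      = (\<integral>\<^sup>+a. \<integral>\<^sup>+g. k g (vec_inner n a v) \<partial>std_normal_distribution \<partial>std_gauss n)"
    using nn_integral_std_gauss_resample[of "\<lambda>a. k (vec_inner n a u) (vec_inner n a v)" n u] u uv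
    by (simp add: vec_inner_linear vec_inner_self)
  also have "\<dots> = (\<integral>\<^sup>+g. \<integral>\<^sup>+a. k g (vec_inner n a v) \<partial>std_gauss n \<partial>std_normal_distribution)"
    by (subst Fubini') auto
  also have "(\<lambda>g. \<integral>\<^sup>+a. k g (vec_inner n a v) \<partial>std_gauss n) = (\<lambda>g. \<integral>\<^sup>+g'. k g (vec_norm n v * g') \<partial>std_normal_distribution)"
  proof
    fix g show "(\<integral>\<^sup>+a. k g (vec_inner n a v) \<partial>std_gauss n) = (\<integral>\<^sup>+g'. k g (vec_norm n v * g') \<partial>std_normal_distribution)"
  proof (cases "vec_norm n v = 0")
    case True
    have "vec_inner n a v = 0" for a using abs_vec_inner_le[of n a v] True by simp
    then show ?thesis using True by (simp add: G.emeasure_space_1 N.emeasure_space_1[simplified])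
  next
    case False
    define v' where "v' = vec_scale n (1 / vec_norm n v) v"
    have "vec_inner n v' v' = 1"
      using False unfolding v'_def vec_inner_linear vec_inner_self[of n v] by (simp add: power2_eq_square)
    then have "(vec_norm n v')\<^sup>2 = 1\<^sup>2" by (simp add: vec_inner_self)
    then have v': "vec_norm n v' = 1" by (rule power2_eq_imp_eq) (simp_all add: L2_set_nonneg)
    have "vec_inner n a v = vec_norm n v * vec_inner n a v'" for a
      using False by (simp add: v'_def vec_inner_linear)
    then show ?thesis
      using nn_integral_std_gauss_inner[OF _ v', of "\<lambda>x. k g (vec_norm n v * x)"] by simp
  qed
  qed
  finally show ?thesis .
qed

text \<open>
  A standard normal plane vector has a standard normal component in the direction \<open>(\<alpha>, \<beta>)\<close>.
\<close>

lemma nn_integral_std_normal_rotate: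
  assumes [measurable]: "k \<in> borel_measurable borel" and ab: "\<alpha>\<^sup>2 + \<beta>\<^sup>2 = 1"
  shows "(\<integral>\<^sup>+x. \<integral>\<^sup>+y. k (\<alpha> * x + \<beta> * y) \<partial>std_normal_distribution \<partial>std_normal_distribution)
     = (\<integral>\<^sup>+x. k x \<partial>std_normal_distribution)"
proof -
  interpret product_sigma_finite "\<lambda>_::nat. std_normal_distribution"
    by (rule product_sigma_finite_std_normal)
  define u :: "nat \<Rightarrow> real" where "u = (\<lambda>i. if i = 0 then \<alpha> else \<beta>)"
  have u: "vec_norm 2 u = 1" using ab by (simp add: L2_set_def u_def numeral_2_eq_2)
  have l2: "{..<2::nat} = {0,1}" by auto
  have "(\<integral>\<^sup>+x. k x \<partial>std_normal_distribution) = (\<integral>\<^sup>+a. k (\<alpha> * a 0 + \<beta> * a 1) \<partial>std_gauss 2)"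
    using nn_integral_std_gauss_inner[OF assms(1) u]
    by (simp add: vec_inner_def u_def numeral_2_eq_2 mult.commute)
  also have "\<dots> = (\<integral>\<^sup>+z. k (\<alpha> * fst z + \<beta> * snd z) \<partial>(std_normal_distribution \<Otimes>\<^sub>M std_normal_distribution))"
    unfolding std_gauss_def l2 by (subst product_nn_integral_pair[where f="\<lambda>x y. k (\<alpha> * x + \<beta> * y)"]) auto
  also have "\<dots> = (\<integral>\<^sup>+x. \<integral>\<^sup>+y. k (\<alpha> * x + \<beta> * y) \<partial>std_normal_distribution \<partial>std_normal_distribution)"
    by (subst sigma_finite_measure.nn_integral_fst[symmetric]) (auto intro!: prob_space_imp_sigma_finite prob_space_std_normal)
  finally show ?thesis by simp
qed

lemma nn_integral_std_gauss_rotate: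
  assumes [measurable]: "H \<in> borel_measurable (std_gauss n)" and ab: "\<alpha>\<^sup>2 + \<beta>\<^sup>2 = 1"
  shows "(\<integral>\<^sup>+x. \<integral>\<^sup>+y. H (vec_add n (vec_scale n \<alpha> x) (vec_scale n \<beta> y)) \<partial>std_gauss n \<partial>std_gauss n)
     = (\<integral>\<^sup>+x. H x \<partial>std_gauss n)"
proof -
  interpret product_sigma_finite "\<lambda>_::nat. std_normal_distribution"
    by (rule product_sigma_finite_std_normal)
  interpret G: prob_space "std_gauss n" by (rule prob_space_std_gauss)
  interpret N: prob_space std_normal_distribution by (rule prob_space_std_normal)
  let ?f = "\<lambda>(x, y). vec_add n (vec_scale n \<alpha> x) (vec_scale n \<beta> y)"
  have [measurable]: "?f \<in> measurable (std_gauss n \<Otimes>\<^sub>M std_gauss n) (std_gauss n)"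
    by measurable
  let ?P = "distr (std_gauss n \<Otimes>\<^sub>M std_gauss n) (std_gauss n) ?f"
  have "?P = std_gauss n"
  proof (rule product_measure_eqI[where N = "\<lambda>_. std_normal_distribution"])
    fix A assume [measurable]: "\<And>i::nat. A i \<in> sets (borel :: real measure)"
    note PiE_in_sets_std_gauss[of A n, measurable]
    show "emeasure (std_gauss n) (Pi\<^sub>E {..<n} A) = (\<Prod>i<n. emeasure std_normal_distribution (A i))"
      unfolding std_gauss_def by (rule emeasure_PiM) auto
    have "emeasure ?P (Pi\<^sub>E {..<n} A) = (\<integral>\<^sup>+z. indicator (Pi\<^sub>E {..<n} A) (?f z) \<partial>(std_gauss n \<Otimes>\<^sub>M std_gauss n))"
      by (simp add: nn_integral_distr nn_integral_indicator[symmetric] del: nn_integral_indicator)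
    also have "\<dots> = (\<integral>\<^sup>+x. \<integral>\<^sup>+y. (indicator (Pi\<^sub>E {..<n} A) (?f (x, y))) \<partial>std_gauss n \<partial>std_gauss n)"
      by (subst G.nn_integral_fst[symmetric]) auto
    also have "\<dots> = (\<integral>\<^sup>+x. \<integral>\<^sup>+y. (\<Prod>i<n. indicator (A i) (\<alpha> * x i + \<beta> * y i)) \<partial>std_gauss n \<partial>std_gauss n)"
      by (intro nn_integral_cong) (auto simp: indicator_PiE_prod vec_add_def vec_scale_def)
    also have "\<dots> = (\<integral>\<^sup>+x. (\<Prod>i<n. \<integral>\<^sup>+y. indicator (A i) (\<alpha> * x i + \<beta> * y) \<partial>std_normal_distribution) \<partial>std_gauss n)"
      unfolding std_gauss_def by (subst product_nn_integral_prod) auto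
    also have "\<dots> = (\<Prod>i<n. \<integral>\<^sup>+x. \<integral>\<^sup>+y. indicator (A i) (\<alpha> * x + \<beta> * y) \<partial>std_normal_distribution \<partial>std_normal_distribution)"
      unfolding std_gauss_def by (subst product_nn_integral_prod[where f="\<lambda>i x. \<integral>\<^sup>+y. indicator (A i) (\<alpha> * x + \<beta> * y) \<partial>std_normal_distribution"]) auto
    also have "\<dots> = (\<Prod>i<n. emeasure std_normal_distribution (A i))"
      by (intro prod.cong refl, subst nn_integral_std_normal_rotate) (auto simp: ab)
    finally show "emeasure ?P (Pi\<^sub>E {..<n} A) = (\<Prod>i<n. emeasure std_normal_distribution (A i))" .
  qed (auto intro: prob_space_imp_sigma_finite prob_space_std_normal)
  then have "integral\<^sup>N ?P H = integral\<^sup>N (std_gauss n) H" by simp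
  then show ?thesis
    by (subst (asm) nn_integral_distr) (auto simp: G.nn_integral_fst[symmetric])
qed

section \<open>Property (tau) and Gaussian concentration\<close>

lemma nn_integral_layer_cake:
  fixes f :: "real \<Rightarrow> real"
  assumes [measurable]: "f \<in> borel_measurable borel" and nonneg: "\<And>x. 0 \<le> f x"
  shows "(\<integral>\<^sup>+x. f x \<partial>lborel) = (\<integral>\<^sup>+s. indicator {0<..} s * emeasure lborel {x. s < f x} \<partial>lborel)"
proof -
  have "(\<integral>\<^sup>+x. f x \<partial>lborel) = (\<integral>\<^sup>+x. \<integral>\<^sup>+s. indicator {0<..} s * indicator {p. snd p < f (fst p)} (x, s) \<partial>lborel \<partial>lborel)"
  proof (intro nn_integral_cong)
    fix x
    have "(\<integral>\<^sup>+s. indicator {0<..} s * indicator {p. snd p < f (fst p)} (x, s) \<partial>lborel)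
      = (\<integral>\<^sup>+s. indicator {0<..<f x} s \<partial>lborel)"
      by (intro nn_integral_cong) (auto split: split_indicator)
    then show "ennreal (f x) = (\<integral>\<^sup>+s. indicator {0<..} s * indicator {p. snd p < f (fst p)} (x, s) \<partial>lborel)"
      using nonneg[of x] by simp
  qed
  also have "\<dots> = (\<integral>\<^sup>+s. \<integral>\<^sup>+x. indicator {0<..} s * indicator {p. snd p < f (fst p)} (x, s) \<partial>lborel \<partial>lborel)"
    by (subst lborel_pair.Fubini') auto
  also have "\<dots> = (\<integral>\<^sup>+s. indicator {0<..} s * emeasure lborel {x. s < f x} \<partial>lborel)"
  proof (intro nn_integral_cong)
    fix s :: real
    have "(\<integral>\<^sup>+x. indicator {0<..} s * indicator {p. snd p < f (fst p)} (x, s) \<partial>lborel)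
      = (\<integral>\<^sup>+x. indicator {0<..} s * indicator {x. s < f x} x \<partial>lborel)"
      by (intro nn_integral_cong) (auto split: split_indicator)
    then show "(\<integral>\<^sup>+x. indicator {0<..} s * indicator {p. snd p < f (fst p)} (x, s) \<partial>lborel)
      = indicator {0<..} s * emeasure lborel {x. s < f x}"
      by (simp add: nn_integral_cmult)
  qed
  finally show ?thesis .
qed

text \<open>
  The lengths of \<open>A\<close> and \<open>B\<close> are at most their diameters, and the diameters add up to that of the
  set of sums. This crude form of the one-dimensional Brunn-Minkowski inequality suffices, because the
  level sets of the normal density are centred intervals.
\<close>

lemma emeasure_add_le_if_sums_bounded:
  fixes A B :: "real set"
  assumes ne: "A \<noteq> {}" "B \<noteq> {}"
    and AB: "\<And>x y. x \<in> A \<Longrightarrow> y \<in> B \<Longrightarrow> \<bar>x + y\<bar> \<le> 2 * \<rho>"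
  shows "emeasure lborel A + emeasure lborel B \<le> ennreal (4 * \<rho>)"
proof -
  obtain a b where ab: "a \<in> A" "b \<in> B" using ne by auto
  have A: "x \<le> 2 * \<rho> - b" "- 2 * \<rho> - b \<le> x" if "x \<in> A" for x using AB[OF that ab(2)] by linarith+
  have B: "y \<le> 2 * \<rho> - a" "- 2 * \<rho> - a \<le> y" if "y \<in> B" for y using AB[OF ab(1) that] by linarith+
  have bdd: "bdd_above A" "bdd_below A" "bdd_above B" "bdd_below B"
    using A B by (meson bdd_above.I bdd_below.I)+
  have le: "Inf A \<le> Sup A" "Inf B \<le> Sup B"
    using ne bdd by (auto intro!: cInf_le_cSup)
  have "emeasure lborel A \<le> emeasure lborel {Inf A..Sup A}"
    using bdd by (intro emeasure_mono) (auto intro: cInf_lower cSup_upper)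
  then have A: "emeasure lborel A \<le> ennreal (Sup A - Inf A)" using le by simp
  have "emeasure lborel B \<le> emeasure lborel {Inf B..Sup B}"
    using bdd by (intro emeasure_mono) (auto intro: cInf_lower cSup_upper)
  then have B: "emeasure lborel B \<le> ennreal (Sup B - Inf B)" using le by simp
  have "Sup A \<le> 2 * \<rho> - y" if "y \<in> B" for y
    using ne AB[OF _ that] by (intro cSup_least) (auto simp: abs_le_iff, smt (verit))
  then have "Sup B \<le> 2 * \<rho> - Sup A"
    using ne by (intro cSup_least) (auto, smt (verit))
  moreover have "- 2 * \<rho> - y \<le> Inf A" if "y \<in> B" for y
    using ne AB[OF _ that] by (intro cInf_greatest) (auto simp: abs_le_iff, smt (verit))
  then have "- 2 * \<rho> - Inf A \<le> Inf B"
    using ne by (intro cInf_greatest) (auto, smt (verit))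
  ultimately have "(Sup A - Inf A) + (Sup B - Inf B) \<le> 4 * \<rho>" by linarith
  then have "ennreal (Sup A - Inf A) + ennreal (Sup B - Inf B) \<le> ennreal (4 * \<rho>)"
    using le by (simp add: ennreal_plus[symmetric] del: ennreal_plus)
  then show ?thesis using A B by (meson add_mono order.trans)
qed

lemma std_normal_density_level_set:
  assumes "0 < c"
  shows "c < std_normal_density z \<longleftrightarrow> z\<^sup>2 < - 2 * ln (c * sqrt (2 * pi))"
proof -
  have "c < std_normal_density z \<longleftrightarrow> c * sqrt (2 * pi) < exp (- z\<^sup>2 / 2)"
    by (simp add: std_normal_density_def field_simps)
  also have "\<dots> \<longleftrightarrow> ln (c * sqrt (2 * pi)) < - z\<^sup>2 / 2"
    using assms by (metis exp_gt_zero exp_ln ln_less_cancel_iff ln_exp mult_pos_pos pi_gt_zero real_sqrt_gt_zero zero_less_mult_iff zero_less_numeral)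
  finally show ?thesis by linarith
qed

text \<open>
  For each level \<open>s < 1\<close> the midpoints of \<open>{f > s}\<close> and \<open>{g > s}\<close> lie in \<open>{\<phi> / \<kappa> > s}\<close>, where
  \<open>\<phi>\<close> is the normal density. Comparing lengths level by level and integrating over \<open>s\<close> gives the
  claim. The suprema of \<open>f\<close> and \<open>g\<close> are normalized to one so that the level sets of both functions are
  nonempty for the same \<open>s\<close>.
\<close>

lemma normalized_prekopa_leindler:
  fixes f g :: "real \<Rightarrow> real"
  assumes [measurable]: "f \<in> borel_measurable borel" "g \<in> borel_measurable borel"
    and f: "\<And>x. 0 \<le> f x" "\<And>x. f x \<le> 1" "\<And>s. s < 1 \<Longrightarrow> \<exists>x. s < f x"
    and g: "\<And>x. 0 \<le> g x" "\<And>x. g x \<le> 1" "\<And>s. s < 1 \<Longrightarrow> \<exists>x. s < g x"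
    and \<kappa>: "0 < \<kappa>"
    and le: "\<And>x y. \<kappa>\<^sup>2 * (f x * g y) \<le> (std_normal_density ((x + y) / 2))\<^sup>2"
  shows "ennreal \<kappa> * ((\<integral>\<^sup>+x. f x \<partial>lborel) + (\<integral>\<^sup>+x. g x \<partial>lborel)) \<le> 2"
proof -
  let ?m = "\<lambda>h s. indicator {0<..} s * emeasure lborel {x. s < h x}"
  let ?\<phi> = "\<lambda>x. std_normal_density x / \<kappa>"
  have meas: "(\<lambda>s. ?m h s) \<in> borel_measurable lborel" if [measurable]: "h \<in> borel_measurable borel" for h :: "real \<Rightarrow> real"
  proof -
    have "{p \<in> space (lborel \<Otimes>\<^sub>M lborel). fst p < h (snd p)} \<in> sets (lborel \<Otimes>\<^sub>M (lborel :: real measure))"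
      by measurable
    then have "{p. fst p < h (snd p)} \<in> sets (lborel \<Otimes>\<^sub>M (lborel :: real measure))"
      by (simp add: space_pair_measure)
    then have "(\<lambda>s. emeasure lborel (Pair s -` {p. fst p < h (snd p)})) \<in> borel_measurable lborel"
      by (rule lborel.measurable_emeasure_Pair)
    then show ?thesis by simp
  qed
  have level: "?m f s + ?m g s \<le> 2 * ?m ?\<phi> s" for s
  proof (cases "0 < s \<and> s < 1")
    case True
    \<comment> \<open>The level set of \<open>\<phi> / \<kappa>\<close> is the interval of radius \<open>sqrt w\<close>.\<close>
    define w where "w = - 2 * ln (\<kappa> * s * sqrt (2 * pi))"
    have S: "s < ?\<phi> z \<longleftrightarrow> z\<^sup>2 < w" for z
      using std_normal_density_level_set[of "\<kappa> * s" z] \<kappa> True by (simp add: w_def field_simps)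
    have AB: "((x + y) / 2)\<^sup>2 < w" if "s < f x" "s < g y" for x y
    proof -
      have "s * s < f x * g y" using that True by (intro mult_strict_mono) auto
      then have "(\<kappa> * s)\<^sup>2 < \<kappa>\<^sup>2 * (f x * g y)" using \<kappa> by (simp add: power_mult_distrib power2_eq_square[of s])
      also have "\<dots> \<le> (std_normal_density ((x + y) / 2))\<^sup>2" by (rule le)
      finally have "\<kappa> * s < std_normal_density ((x + y) / 2)"
        by (rule power2_less_imp_less) simp
      then show ?thesis using S[of "(x + y) / 2"] \<kappa> by (simp add: field_simps)
    qed
    obtain x0 y0 where "s < f x0" "s < g y0" using f(3) g(3) True by blast
    from AB[OF this] have w: "0 < w" by (meson le_less_trans zero_le_power2)
    have abs_less: "\<bar>z\<bar> < sqrt w" if "z\<^sup>2 < w" for z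
      using that real_sqrt_less_iff[of "z\<^sup>2" w] by simp
    have "emeasure lborel {x. s < f x} + emeasure lborel {x. s < g x} \<le> ennreal (4 * sqrt w)"
    proof (rule emeasure_add_le_if_sums_bounded)
      show "{x. s < f x} \<noteq> {}" "{x. s < g x} \<noteq> {}" using f(3) g(3) True by auto
      show "\<bar>x + y\<bar> \<le> 2 * sqrt w" if "x \<in> {x. s < f x}" "y \<in> {x. s < g x}" for x y
        using abs_less[OF AB, of x y] that by simp
    qed
    also have "ennreal (4 * sqrt w) = 2 * ennreal (2 * sqrt w)"
      using w by (simp add: ennreal_mult'[symmetric] del: ennreal_numeral flip: ennreal_numeral)
    also have "ennreal (2 * sqrt w) = emeasure lborel {- sqrt w<..<sqrt w}"
      using w by simp
    also have "{- sqrt w<..<sqrt w} = {z. s < ?\<phi> z}"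
      unfolding S using abs_less by (auto simp: abs_less_iff) (smt (verit) real_less_rsqrt real_sqrt_abs real_sqrt_less_iff)+
    finally show ?thesis using True by simp
  next
    case False
    have "?m f s = 0" "?m g s = 0"
      using False f(2) g(2) by (auto split: split_indicator) (smt (verit) Collect_empty_eq emeasure_empty)+
    then have "?m f s + ?m g s = 0" by (simp only: add_0)
    then show ?thesis by (simp only: zero_le)
  qed
  have "(\<integral>\<^sup>+x. f x \<partial>lborel) + (\<integral>\<^sup>+x. g x \<partial>lborel) = (\<integral>\<^sup>+s. ?m f s + ?m g s \<partial>lborel)"
    using f(1) g(1) meas by (subst nn_integral_add) (simp_all add: nn_integral_layer_cake)
  also have "\<dots> \<le> (\<integral>\<^sup>+s. 2 * ?m ?\<phi> s \<partial>lborel)"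
    by (intro nn_integral_mono level)
  also have "\<dots> = 2 * (\<integral>\<^sup>+x. ?\<phi> x \<partial>lborel)"
    using \<kappa> meas[of ?\<phi>] by (subst nn_integral_cmult) (simp_all add: nn_integral_layer_cake)
  also have "(\<integral>\<^sup>+x. ?\<phi> x \<partial>lborel) = ennreal (1 / \<kappa>)"
    using \<kappa> by (subst nn_integral_eq_integral) auto
  finally have "ennreal \<kappa> * ((\<integral>\<^sup>+x. f x \<partial>lborel) + (\<integral>\<^sup>+x. g x \<partial>lborel)) \<le> ennreal \<kappa> * (2 * ennreal (1 / \<kappa>))"
    by (intro mult_left_mono) auto
  also have "\<dots> = 2 * (ennreal \<kappa> * ennreal (1 / \<kappa>))" by (simp add: ac_simps)
  also have "\<dots> = 2" using \<kappa> by (simp add: ennreal_mult'[symmetric])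
  finally show ?thesis .
qed

text \<open>
  Dividing \<open>U\<close> and \<open>V\<close> by their suprema, which the product bound forces to be finite, reduces the
  claim to the normalized case; the arithmetic-geometric mean inequality turns its sum
  into a product.
\<close>

lemma gaussian_prekopa_leindler:
  fixes U V :: "real \<Rightarrow> real"
  assumes [measurable]: "U \<in> borel_measurable borel" "V \<in> borel_measurable borel"
    and nonneg: "\<And>x. 0 \<le> U x" "\<And>x. 0 \<le> V x"
    and le: "\<And>x y. U x * V y \<le> (std_normal_density ((x + y) / 2))\<^sup>2"
  shows "(\<integral>\<^sup>+x. U x \<partial>lborel) * (\<integral>\<^sup>+x. V x \<partial>lborel) \<le> 1"
proof (cases "(\<forall>x. U x = 0) \<or> (\<forall>x. V x = 0)")
  case True
  then show ?thesis by auto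
next
  case False
  then obtain x0 y0 where pos: "0 < U x0" "0 < V y0" using nonneg by (metis order_less_le)
  have dens: "(std_normal_density z)\<^sup>2 \<le> 1" for z
  proof -
    have "1 \<le> sqrt (2 * pi)" using pi_gt3 by simp
    then have "1 / sqrt (2 * pi) * exp (- z\<^sup>2 / 2) \<le> 1 * 1" by (intro mult_mono) auto
    then have "std_normal_density z \<le> 1" by (simp add: std_normal_density_def)
    then show ?thesis by (simp add: power_le_one)
  qed
  have UV1: "U x * V y \<le> 1" for x y using le[of x y] dens[of "(x + y) / 2"] by linarith
  have bdd: "bdd_above (range U)" "bdd_above (range V)"
  proof -
    have "U x \<le> 1 / V y0" "V x \<le> 1 / U x0" for x
      using UV1[of x y0] UV1[of x0 x] pos by (simp_all add: field_simps)
    then show "bdd_above (range U)" "bdd_above (range V)" by (auto intro!: bdd_aboveI)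
  qed
  define M where "M = (SUP x. U x)"
  define N where "N = (SUP x. V x)"
  have M: "0 < M" "\<And>x. U x \<le> M" and N: "0 < N" "\<And>x. V x \<le> N"
    using pos bdd unfolding M_def N_def by (auto intro: cSUP_upper less_le_trans)
  define \<kappa> where "\<kappa> = sqrt (M * N)"
  have \<kappa>: "0 < \<kappa>" "\<kappa>\<^sup>2 = M * N" using M(1) N(1) by (auto simp: \<kappa>_def)
  let ?f = "\<lambda>x. U x / M" and ?g = "\<lambda>x. V x / N"
  let ?F = "\<integral>\<^sup>+x. ?f x \<partial>lborel" and ?G = "\<integral>\<^sup>+x. ?g x \<partial>lborel"
  have exU: "\<exists>x. s < ?f x" if "s < 1" for s
  proof -
    have "s * M < (SUP x. U x)" using that M(1) by (simp add: M_def[symmetric])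
    then obtain x where "s * M < U x" using less_cSUP_iff[OF _ bdd(1)] by auto
    then show ?thesis using M(1) by (auto simp: field_simps)
  qed
  have exV: "\<exists>x. s < ?g x" if "s < 1" for s
  proof -
    have "s * N < (SUP x. V x)" using that N(1) by (simp add: N_def[symmetric])
    then obtain x where "s * N < V x" using less_cSUP_iff[OF _ bdd(2)] by auto
    then show ?thesis using N(1) by (auto simp: field_simps)
  qed
  have main: "ennreal \<kappa> * (?F + ?G) \<le> 2"
  proof (rule normalized_prekopa_leindler)
    show "\<kappa>\<^sup>2 * (?f x * ?g y) \<le> (std_normal_density ((x + y) / 2))\<^sup>2" for x y
      using le[of x y] M(1) N(1) by (simp add: \<kappa>(2))
  qed (use nonneg M N \<kappa>(1) exU exV in auto)
  have fin: "?F \<noteq> \<top>" "?G \<noteq> \<top>"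
    using main \<kappa>(1) by (auto simp: ennreal_mult_eq_top_iff top_unique)
  obtain F where F: "?F = ennreal F" "0 \<le> F" using fin(1) by (cases ?F) auto
  obtain G where G: "?G = ennreal G" "0 \<le> G" using fin(2) by (cases ?G) auto
  have "ennreal (\<kappa> * (F + G)) \<le> ennreal 2"
    using main F G \<kappa>(1) by (simp add: ennreal_mult' ennreal_plus)
  then have kFG: "\<kappa> * (F + G) \<le> 2" by (subst (asm) ennreal_le_iff) simp_all
  have "4 * (M * N * (F * G)) \<le> (\<kappa> * (F + G))\<^sup>2"
  proof -
    have "4 * (F * G) \<le> (F + G)\<^sup>2"
      using zero_le_power2[of "F - G"] by (simp add: power2_eq_square algebra_simps)
    then have "M * N * (4 * (F * G)) \<le> M * N * (F + G)\<^sup>2" using M(1) N(1) by (intro mult_left_mono) auto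
    then show ?thesis by (simp add: \<kappa>(2)[symmetric] power_mult_distrib)
  qed
  also have "\<dots> \<le> 2\<^sup>2" using kFG \<kappa>(1) F(2) G(2) by (intro power_mono) auto
  finally have fin: "(M * F) * (N * G) \<le> 1" by (simp add: ac_simps)
  have "(\<integral>\<^sup>+x. U x \<partial>lborel) = ennreal M * ?F"
    using M(1) nonneg by (subst nn_integral_cmult[symmetric]) (auto simp: ennreal_mult'[symmetric])
  moreover have "(\<integral>\<^sup>+x. V x \<partial>lborel) = ennreal N * ?G"
    using N(1) nonneg by (subst nn_integral_cmult[symmetric]) (auto simp: ennreal_mult'[symmetric])
  ultimately have "(\<integral>\<^sup>+x. U x \<partial>lborel) * (\<integral>\<^sup>+x. V x \<partial>lborel) = ennreal ((M * F) * (N * G))"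
    using M(1) N(1) F G by (simp add: ennreal_mult ac_simps)
  then show ?thesis using fin by (simp add: ennreal_le_1)
qed

text \<open>
  Maurey's property (tau) in dimension one: completing the square,
  \<open>\<phi>(x) \<phi>(y) exp ((x-y)\<^sup>2/4) = \<phi>((x+y)/2)\<^sup>2\<close>.
\<close>

lemma std_normal_property_tau:
  fixes u v :: "real \<Rightarrow> ennreal"
  assumes [measurable]: "u \<in> borel_measurable borel" "v \<in> borel_measurable borel"
    and le: "\<And>x y. u x * v y \<le> ennreal (exp ((x - y)\<^sup>2 / 4))"
  shows "(\<integral>\<^sup>+x. u x \<partial>std_normal_distribution) * (\<integral>\<^sup>+x. v x \<partial>std_normal_distribution) \<le> 1"
proof (cases "(\<forall>x. u x = 0) \<or> (\<forall>x. v x = 0)")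
  case True
  then show ?thesis by auto
next
  case False
  then obtain x0 y0 where pos: "u x0 \<noteq> 0" "v y0 \<noteq> 0" by blast
  have ufin: "u x \<noteq> \<top>" for x
    using le[of x y0] pos(2) by (auto simp: ennreal_top_mult top_unique)
  have vfin: "v y \<noteq> \<top>" for y
    using le[of x0 y] pos(1) by (auto simp: ennreal_mult_top top_unique)
  define U where "U x = std_normal_density x * enn2real (u x)" for x
  define V where "V x = std_normal_density x * enn2real (v x)" for x
  have [measurable]: "U \<in> borel_measurable borel" "V \<in> borel_measurable borel"
    unfolding U_def V_def by measurable
  have U: "ennreal (U x) = ennreal (std_normal_density x) * u x" for x
    using ufin[of x] by (simp add: U_def ennreal_mult' less_top)
  have V: "ennreal (V x) = ennreal (std_normal_density x) * v x" for x
    using vfin[of x] by (simp add: V_def ennreal_mult' less_top)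
  have "(\<integral>\<^sup>+x. U x \<partial>lborel) * (\<integral>\<^sup>+x. V x \<partial>lborel) \<le> 1"
  proof (rule gaussian_prekopa_leindler)
    show "U x * V y \<le> (std_normal_density ((x + y) / 2))\<^sup>2" for x y
    proof -
      have "ennreal (enn2real (u x) * enn2real (v y)) \<le> ennreal (exp ((x - y)\<^sup>2 / 4))"
        using le[of x y] ufin vfin by (simp add: ennreal_mult' less_top)
      then have "enn2real (u x) * enn2real (v y) \<le> exp ((x - y)\<^sup>2 / 4)" by simp
      then have "U x * V y \<le> std_normal_density x * std_normal_density y * exp ((x - y)\<^sup>2 / 4)"
        unfolding U_def V_def
        using mult_left_mono[of "enn2real (u x) * enn2real (v y)" "exp ((x - y)\<^sup>2 / 4)" "std_normal_density x * std_normal_density y"]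
        by (simp add: ac_simps)
      also have "\<dots> = (std_normal_density ((x + y) / 2))\<^sup>2"
        by (simp add: std_normal_density_def power2_eq_square exp_add[symmetric] field_simps)
      finally show ?thesis .
    qed
  qed (auto simp: U_def V_def)
  then show ?thesis by (simp add: nn_integral_std_normal U V)
qed

text \<open>
  The property tensorizes: for fixed first coordinates, the one-dimensional case bounds the product of
  the partial integrals by the exponential of the remaining squared distance, so that the partial
  integrals satisfy the hypothesis in one dimension less.
\<close>

lemma std_gauss_property_tau:
  fixes u v :: "(nat \<Rightarrow> real) \<Rightarrow> ennreal"
  assumes "u \<in> borel_measurable (std_gauss n)" "v \<in> borel_measurable (std_gauss n)"
    and "\<And>x y. x \<in> vec_space n \<Longrightarrow> y \<in> vec_space n \<Longrightarrow> u x * v y \<le> ennreal (exp ((\<Sum>i<n. (x i - y i)\<^sup>2) / 4))"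
  shows "(\<integral>\<^sup>+x. u x \<partial>std_gauss n) * (\<integral>\<^sup>+x. v x \<partial>std_gauss n) \<le> 1"
  using assms
proof (induction n arbitrary: u v)
  case 0
  interpret product_sigma_finite "\<lambda>_::nat. std_normal_distribution"
    by (rule product_sigma_finite_std_normal)
  have "(\<lambda>_. undefined) \<in> vec_space 0" by (simp add: vec_space_def)
  from 0(3)[OF this this] show ?case by (simp add: std_gauss_def nn_integral_empty)
next
  case (Suc n)
  interpret product_sigma_finite "\<lambda>_::nat. std_normal_distribution"
    by (rule product_sigma_finite_std_normal)
  interpret N: prob_space std_normal_distribution by (rule prob_space_std_normal)
  have split: "(\<integral>\<^sup>+x. w x \<partial>std_gauss (Suc n)) = (\<integral>\<^sup>+x. \<integral>\<^sup>+y. w (x(n := y)) \<partial>std_normal_distribution \<partial>std_gauss n)"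
    and meas: "(\<lambda>x. \<integral>\<^sup>+y. w (x(n := y)) \<partial>std_normal_distribution) \<in> borel_measurable (std_gauss n)"
    and meas1: "\<And>x. x \<in> vec_space n \<Longrightarrow> (\<lambda>y. w (x(n := y))) \<in> borel_measurable borel"
    if w: "w \<in> borel_measurable (std_gauss (Suc n))" for w :: "(nat \<Rightarrow> real) \<Rightarrow> ennreal"
  proof -
    have w'[measurable]: "w \<in> borel_measurable (PiM (insert n {..<n}) (\<lambda>_. std_normal_distribution))"
      using w by (simp add: std_gauss_def lessThan_Suc)
    show "(\<integral>\<^sup>+x. w x \<partial>std_gauss (Suc n)) = (\<integral>\<^sup>+x. \<integral>\<^sup>+y. w (x(n := y)) \<partial>std_normal_distribution \<partial>std_gauss n)"
      unfolding std_gauss_def lessThan_Suc by (rule product_nn_integral_insert) (use w' in auto)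
    have "(\<lambda>(x, y). w (x(n := y))) \<in> borel_measurable (PiM {..<n} (\<lambda>_. std_normal_distribution) \<Otimes>\<^sub>M std_normal_distribution)"
      by measurable
    then show "(\<lambda>x. \<integral>\<^sup>+y. w (x(n := y)) \<partial>std_normal_distribution) \<in> borel_measurable (std_gauss n)"
      unfolding std_gauss_def
      by (rule sigma_finite_measure.borel_measurable_nn_integral[OF prob_space_imp_sigma_finite[OF prob_space_std_normal]])
    show "(\<lambda>y. w (x(n := y))) \<in> borel_measurable borel" if "x \<in> vec_space n" for x
    proof -
      have "x \<in> space (PiM {..<n} (\<lambda>_. std_normal_distribution))" using that by (simp add: vec_space_def space_PiM)
      from measurable_comp[OF measurable_component_update[OF this] w']
      show ?thesis by (simp add: comp_def)
    qed
  qed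
  show ?case unfolding split[OF Suc.prems(1)] split[OF Suc.prems(2)]
  proof (rule Suc.IH)
    fix x x' assume x: "x \<in> vec_space n" "x' \<in> vec_space n"
    define S where "S = (\<Sum>i<n. (x i - x' i)\<^sup>2) / 4"
    note [measurable] = meas1[OF Suc.prems(1) x(1)] meas1[OF Suc.prems(2) x(2)]
    have "(\<integral>\<^sup>+y. ennreal (exp (- S)) * u (x(n := y)) \<partial>std_normal_distribution) * (\<integral>\<^sup>+y. v (x'(n := y)) \<partial>std_normal_distribution) \<le> 1"
    proof (rule std_normal_property_tau)
      fix y y'
      have "x(n := y) \<in> vec_space (Suc n)" "x'(n := y') \<in> vec_space (Suc n)"
        using x by (auto simp: vec_space_def lessThan_Suc PiE_def extensional_def)
      from Suc.prems(3)[OF this]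
      have "u (x(n := y)) * v (x'(n := y')) \<le> ennreal (exp (S + (y - y')\<^sup>2 / 4))"
        by (simp add: S_def add_divide_distrib fun_upd_def)
      then have "ennreal (exp (- S)) * (u (x(n := y)) * v (x'(n := y'))) \<le> ennreal (exp (- S)) * ennreal (exp (S + (y - y')\<^sup>2 / 4))"
        by (intro mult_left_mono) auto
      also have "\<dots> = ennreal (exp ((y - y')\<^sup>2 / 4))"
        by (simp add: ennreal_mult'[symmetric] exp_add[symmetric])
      finally show "ennreal (exp (- S)) * u (x(n := y)) * v (x'(n := y')) \<le> ennreal (exp ((y - y')\<^sup>2 / 4))"
        by (simp add: ac_simps)
    qed measurable
    then have "ennreal (exp (- S)) * ((\<integral>\<^sup>+y. u (x(n := y)) \<partial>std_normal_distribution) * (\<integral>\<^sup>+y. v (x'(n := y)) \<partial>std_normal_distribution)) \<le> 1"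
      by (subst (asm) nn_integral_cmult) (simp_all add: ac_simps)
    then have "ennreal (exp S) * (ennreal (exp (- S)) * ((\<integral>\<^sup>+y. u (x(n := y)) \<partial>std_normal_distribution) * (\<integral>\<^sup>+y. v (x'(n := y)) \<partial>std_normal_distribution))) \<le> ennreal (exp S) * 1"
      by (intro mult_left_mono) auto
    moreover have "ennreal (exp S) * ennreal (exp (- S)) = 1"
      by (simp add: ennreal_mult'[symmetric] exp_add[symmetric])
    ultimately show "(\<integral>\<^sup>+y. u (x(n := y)) \<partial>std_normal_distribution) * (\<integral>\<^sup>+y. v (x'(n := y)) \<partial>std_normal_distribution) \<le> ennreal (exp ((\<Sum>i<n. (x i - x' i)\<^sup>2) / 4))"
      by (simp add: S_def mult.assoc[symmetric])
  qed (intro meas Suc.prems)+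
qed

text \<open>
  Jensen's inequality for the exponential, in a form where the right side may be infinite.
\<close>

lemma (in prob_space) exp_expectation_le_nn_integral:
  fixes X :: "'a \<Rightarrow> real"
  assumes X: "integrable M X"
  shows "ennreal (exp (expectation X)) \<le> (\<integral>\<^sup>+x. ennreal (exp (X x)) \<partial>M)"
proof (cases "(\<integral>\<^sup>+x. ennreal (exp (X x)) \<partial>M) = \<infinity>")
  case False
  have [measurable]: "X \<in> borel_measurable M" using X by simp
  have int: "integrable M (\<lambda>x. exp (X x))"
    using False by (intro integrableI_nonneg) (auto simp: less_top)
  let ?e = "expectation X"
  have "exp ?e * (1 + (t - ?e)) \<le> exp t" for t
  proof -
    have "exp ?e * (1 + (t - ?e)) \<le> exp ?e * exp (t - ?e)"
      by (intro mult_left_mono exp_ge_add_one_self) simp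
    then show ?thesis by (simp add: exp_add[symmetric])
  qed
  then have "expectation (\<lambda>x. exp ?e * (1 + (X x - ?e))) \<le> expectation (\<lambda>x. exp (X x))"
    using X int by (intro integral_mono) auto
  also have "expectation (\<lambda>x. exp ?e * (1 + (X x - ?e))) = exp ?e"
    using X by (simp add: prob_space)
  finally show ?thesis using int by (simp add: nn_integral_eq_integral)
qed simp

text \<open>
  Property (tau) applied to \<open>exp (s W)\<close> and \<open>exp (- s W - s\<^sup>2 r\<^sup>2)\<close>, which is admissible because
  \<open>s r d - s\<^sup>2 r\<^sup>2 \<le> d\<^sup>2/4\<close> for every distance \<open>d\<close>; Jensen's inequality bounds the second integral
  from below.
\<close>

lemma gaussian_concentration:
  fixes W :: "(nat \<Rightarrow> real) \<Rightarrow> real"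
  assumes W: "integrable (std_gauss n) W" and "0 \<le> s"
    and lip: "\<And>x y. x \<in> vec_space n \<Longrightarrow> y \<in> vec_space n \<Longrightarrow> W x - W y \<le> r * vec_norm n (\<lambda>i. x i - y i)"
  shows "(\<integral>\<^sup>+x. ennreal (exp (s * W x)) \<partial>std_gauss n) \<le> ennreal (exp (s * (\<integral>x. W x \<partial>std_gauss n) + s\<^sup>2 * r\<^sup>2))"
proof -
  interpret prob_space "std_gauss n" by (rule prob_space_std_gauss)
  have [measurable]: "W \<in> borel_measurable (std_gauss n)" using W by simp
  let ?u = "\<lambda>x. ennreal (exp (s * W x))" and ?v = "\<lambda>x. ennreal (exp (- s * W x - s\<^sup>2 * r\<^sup>2))"
  let ?b = "s * (\<integral>x. W x \<partial>std_gauss n) + s\<^sup>2 * r\<^sup>2"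
  have tau: "integral\<^sup>N (std_gauss n) ?u * integral\<^sup>N (std_gauss n) ?v \<le> 1"
  proof (rule std_gauss_property_tau)
    fix x y assume xy: "x \<in> vec_space n" "y \<in> vec_space n"
    let ?d = "vec_norm n (\<lambda>i. x i - y i)"
    have "s * (W x - W y) \<le> s * (r * ?d)" using lip[OF xy] \<open>0 \<le> s\<close> by (rule mult_left_mono)
    moreover have "0 \<le> (?d / 2 - s * r)\<^sup>2" by simp
    moreover have "?d\<^sup>2 = (\<Sum>i<n. (x i - y i)\<^sup>2)" by (simp add: L2_set_def sum_nonneg)
    ultimately have "s * W x + (- s * W y - s\<^sup>2 * r\<^sup>2) \<le> (\<Sum>i<n. (x i - y i)\<^sup>2) / 4"
      by (simp add: power2_eq_square algebra_simps)
    then show "?u x * ?v y \<le> ennreal (exp ((\<Sum>i<n. (x i - y i)\<^sup>2) / 4))"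
      by (simp add: ennreal_mult'[symmetric] exp_add[symmetric])
  qed simp_all
  have "ennreal (exp (- ?b)) \<le> integral\<^sup>N (std_gauss n) ?v"
    using exp_expectation_le_nn_integral[of "\<lambda>x. - s * W x - s\<^sup>2 * r\<^sup>2"] W by (simp add: prob_space)
  then have "ennreal (exp ?b) * (integral\<^sup>N (std_gauss n) ?u * ennreal (exp (- ?b))) \<le> ennreal (exp ?b) * 1"
    by (intro mult_left_mono order.trans[OF mult_left_mono tau]) auto
  moreover have "ennreal (exp ?b) * ennreal (exp (- ?b)) = 1"
    by (simp add: ennreal_mult'[symmetric] exp_add[symmetric])
  ultimately show ?thesis by (simp add: mult.left_commute)
qed

section \<open>Comparing the empirical process with a Gaussian process\<close>

lemma integrable_std_normal_iff:
  assumes [measurable]: "f \<in> borel_measurable borel"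
  shows "integrable std_normal_distribution f \<longleftrightarrow> integrable lborel (\<lambda>x. std_normal_density x * (f x :: real))"
  by (subst integrable_density) auto

lemma integrable_std_normal_id: "integrable std_normal_distribution (\<lambda>x. x)"
  using integrable_std_normal_moment[of 1] by (simp add: integrable_std_normal_iff)

lemma distr_std_gauss_coord:
  "i < n \<Longrightarrow> distr (std_gauss n) std_normal_distribution (\<lambda>x. x i) = std_normal_distribution"
  unfolding std_gauss_def
  by (subst distr_PiM_component[of "{..<n}" "\<lambda>_. std_normal_distribution" i])
    (auto simp: prob_space_std_normal)

lemma integrable_std_gauss_coord:
  assumes "i < n" shows "integrable (std_gauss n) (\<lambda>x. x i)"
proof -
  have [measurable]: "(\<lambda>x. x i) \<in> measurable (std_gauss n) std_normal_distribution"
    using measurable_coord_std_gauss[OF assms] by simp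
  show ?thesis
    by (rule integrable_distr[of _ _ std_normal_distribution "\<lambda>x. x"])
      (simp_all add: integrable_std_normal_id distr_std_gauss_coord[OF assms] measurable_coord_std_gauss[OF assms])
qed

lemma integrable_vec_inner [simp]: "integrable (std_gauss n) (\<lambda>x. vec_inner n x h)"
  unfolding vec_inner_def by (intro Bochner_Integration.integrable_sum integrable_mult_left integrable_std_gauss_coord) auto


lemma Max_image_attained:
  fixes f :: "'b \<Rightarrow> real"
  assumes "finite H" "H \<noteq> {}"
  obtains h where "h \<in> H" "Max (f ` H) = f h"
proof -
  have "Max (f ` H) \<in> f ` H" using assms by (intro Max_in) auto
  then show ?thesis using that by auto
qed

text \<open>
  A convex function has a larger sum at \<open>(P, Q)\<close> than at \<open>(p, q)\<close> when the former pair is more spread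
  out; monotonicity allows an inequality between the sums.
\<close>

lemma exp_add_le_if_majorized:
  fixes p q P Q :: real
  assumes "p + q \<le> P + Q" "max p q \<le> max P Q"
  shows "exp p + exp q \<le> exp P + exp Q"
proof -
  have *: "exp p + exp q \<le> exp P + exp Q" if "p + q \<le> P + Q" "q \<le> p" "p \<le> P" "Q \<le> P" for p q P Q :: real
  proof (cases "Q \<le> p")
    case True
    have "0 \<le> (exp P - exp p) * (1 - exp (Q - p))" using that True by (intro mult_nonneg_nonneg) auto
    also have "\<dots> = exp P + exp Q - exp p - exp (P + Q - p)"
      by (simp add: algebra_simps exp_add[symmetric])
    also have "\<dots> \<le> exp P + exp Q - exp p - exp q" using that by simp
    finally show ?thesis by simp
  next
    case False
    then show ?thesis using that by (intro add_mono) auto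
  qed
  have **: "exp p + exp q \<le> exp P + exp Q" if "p + q \<le> P + Q" "p \<le> P" "q \<le> P" "Q \<le> P" for p q P Q :: real
  proof (cases "q \<le> p")
    case True
    then show ?thesis using that by (intro *) auto
  next
    case False
    then have "exp q + exp p \<le> exp P + exp Q" using that by (intro *) auto
    then show ?thesis by simp
  qed
  show ?thesis
  proof (cases "Q \<le> P")
    case True
    then show ?thesis using assms by (intro **) auto
  next
    case False
    then have "exp p + exp q \<le> exp Q + exp P" using assms by (intro **) auto
    then show ?thesis by simp
  qed
qed

text \<open>
  The contraction principle for a single sign. If \<open>h\<close> and \<open>k\<close> attain the two maxima on the left, then
  \<open>p h - p k\<close> is at most \<open>t h - t k\<close> or \<open>t k - t h\<close>, and \<open>\<bar>p\<bar> \<le> \<bar>t\<bar>\<close> keeps each exponent on the left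
  below the larger one on the right; so the exponents are majorized, with \<open>h\<close> and \<open>k\<close> possibly
  exchanged.
\<close>

lemma exp_Max_contraction:
  fixes A p t :: "'b \<Rightarrow> real"
  assumes H: "finite H" "H \<noteq> {}"
    and lip: "\<And>h k. h \<in> H \<Longrightarrow> k \<in> H \<Longrightarrow> \<bar>p h - p k\<bar> \<le> \<bar>t h - t k\<bar>"
    and bound: "\<And>h. h \<in> H \<Longrightarrow> \<bar>p h\<bar> \<le> \<bar>t h\<bar>"
  shows "exp (Max ((\<lambda>h. A h + p h) ` H)) + exp (Max ((\<lambda>h. A h - p h) ` H))
     \<le> exp (Max ((\<lambda>h. A h + t h) ` H)) + exp (Max ((\<lambda>h. A h - t h) ` H))"
proof -
  let ?P = "Max ((\<lambda>h. A h + t h) ` H)" and ?Q = "Max ((\<lambda>h. A h - t h) ` H)"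
  have P: "A h + t h \<le> ?P" and Q: "A h - t h \<le> ?Q" if "h \<in> H" for h
    using H that by (auto intro!: Max_ge)
  obtain h where h: "h \<in> H" "Max ((\<lambda>h. A h + p h) ` H) = A h + p h" by (rule Max_image_attained[OF H])
  obtain k where k: "k \<in> H" "Max ((\<lambda>h. A h - p h) ` H) = A k - p k" by (rule Max_image_attained[OF H])
  show ?thesis unfolding h(2) k(2)
  proof (rule exp_add_le_if_majorized)
    show "A h + p h + (A k - p k) \<le> ?P + ?Q"
      using lip[OF h(1) k(1)] P[OF h(1)] P[OF k(1)] Q[OF h(1)] Q[OF k(1)] by linarith
    show "max (A h + p h) (A k - p k) \<le> max ?P ?Q"
      using bound[OF h(1)] bound[OF k(1)] P[OF h(1)] P[OF k(1)] Q[OF h(1)] Q[OF k(1)] by linarith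
  qed
qed

lemma nn_integral_std_gauss_minus:
  assumes [measurable]: "H \<in> borel_measurable (std_gauss n)"
  shows "(\<integral>\<^sup>+x. H (vec_scale n (- 1) x) \<partial>std_gauss n) = (\<integral>\<^sup>+x. H x \<partial>std_gauss n)"
proof -
  interpret prob_space "std_gauss n" by (rule prob_space_std_gauss)
  have "vec_add n (vec_scale n (- 1) x) (vec_scale n 0 y) = vec_scale n (- 1) x" for x y
    by (auto simp: vec_add_def vec_scale_def fun_eq_iff)
  then show ?thesis
    using nn_integral_std_gauss_rotate[OF assms, of "- 1" 0] by (simp add: emeasure_space_1)
qed

text \<open>
  The increments of the hinge loss enter the deviation estimate only through these two bounds: they
  are contractions of the linear process \<open>\<langle>a,h\<rangle>\<close>, after absorbing the sign of the
  response. The index set is finite, so that all suprema are maxima.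
\<close>

locale linear_dominated_process =
  fixes n :: nat and T :: "real measure"
    and \<xi> :: "(nat \<Rightarrow> real) \<Rightarrow> (nat \<Rightarrow> real) \<times> real \<Rightarrow> real"
    and H :: "(nat \<Rightarrow> real) set"
  assumes T: "prob_space T"
    and H: "finite H" "H \<noteq> {}"
    and meas [measurable]: "\<And>h. \<xi> h \<in> borel_measurable (std_gauss n \<Otimes>\<^sub>M T)"
    and lip: "\<And>h k \<omega>. \<bar>\<xi> h \<omega> - \<xi> k \<omega>\<bar> \<le> \<bar>vec_inner n (fst \<omega>) h - vec_inner n (fst \<omega>) k\<bar>"
    and bound: "\<And>h \<omega>. \<bar>\<xi> h \<omega>\<bar> \<le> \<bar>vec_inner n (fst \<omega>) h\<bar>"
begin

abbreviation sample where "sample \<equiv> std_gauss n \<Otimes>\<^sub>M T"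

definition mean where "mean h = (\<integral>\<omega>. \<xi> h \<omega> \<partial>sample)"

sublocale G: prob_space "std_gauss n" by (rule prob_space_std_gauss)
sublocale T: prob_space T by (rule T)
sublocale GT: pair_prob_space "std_gauss n" T ..

lemma nn_integral_sample_fst:
  assumes [measurable]: "f \<in> borel_measurable (std_gauss n)"
  shows "(\<integral>\<^sup>+\<omega>. f (fst \<omega>) \<partial>sample) = (\<integral>\<^sup>+a. f a \<partial>std_gauss n)"
  by (subst T.nn_integral_fst[symmetric]) (auto simp: T.emeasure_space_1)

lemma integrable_sample_fst:
  fixes f :: "(nat \<Rightarrow> real) \<Rightarrow> real"
  assumes "integrable (std_gauss n) f"
  shows "integrable sample (\<lambda>\<omega>. f (fst \<omega>))"
proof -
  have [measurable]: "f \<in> borel_measurable (std_gauss n)" using assms by simp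
  show ?thesis
    using assms nn_integral_sample_fst[of "\<lambda>a. ennreal (norm (f a))"] by (simp add: integrable_iff_bounded)
qed

lemma integrable_\<xi>: "integrable sample (\<xi> h)"
proof (rule Bochner_Integration.integrable_bound)
  show "integrable sample (\<lambda>\<omega>. vec_inner n (fst \<omega>) h)"
    by (rule integrable_sample_fst) simp
qed (use bound in auto)

abbreviation mx :: "((nat \<Rightarrow> real) \<Rightarrow> real) \<Rightarrow> real" where "mx f \<equiv> Max (f ` H)"

lemma mx_ge: "h \<in> H \<Longrightarrow> f h \<le> mx f"
  using H by (auto intro!: Max_ge)

lemma measurable_mx [measurable (raw)]:
  assumes "\<And>h. h \<in> H \<Longrightarrow> (\<lambda>x. f x h) \<in> borel_measurable M"
  shows "(\<lambda>x. mx (f x)) \<in> borel_measurable M"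
  using borel_measurable_Max[OF H(1), of "\<lambda>h x. f x h" M] assms by simp

text \<open>
  Centring is replaced by an independent copy \<open>\<omega>'\<close> (Jensen's inequality), the two copies are separated
  by \<open>exp ((p + q)/2) \<le> (exp p + exp q)/2\<close>, and the resulting pair of signs allows contraction to
  the linear process, whose law is symmetric. The arbitrary offset \<open>A\<close> is what makes the
  inequality iterable.
\<close>

lemma one_sample_comparison:
  assumes \<theta>: "0 \<le> \<theta>"
  shows "(\<integral>\<^sup>+\<omega>. ennreal (exp (mx (\<lambda>h. A h + \<theta> * (mean h - \<xi> h \<omega>)))) \<partial>sample)
    \<le> (\<integral>\<^sup>+a. ennreal (exp (mx (\<lambda>h. A h + 2 * \<theta> * vec_inner n a h))) \<partial>std_gauss n)"
proof -
  let ?E = "\<lambda>f. ennreal (exp (mx f))"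
  let ?up = "\<lambda>\<omega>. ?E (\<lambda>h. A h + 2 * \<theta> * \<xi> h \<omega>)" and ?dn = "\<lambda>\<omega>. ?E (\<lambda>h. A h - 2 * \<theta> * \<xi> h \<omega>)"
  let ?gup = "\<lambda>a. ?E (\<lambda>h. A h + 2 * \<theta> * vec_inner n a h)" and ?gdn = "\<lambda>a. ?E (\<lambda>h. A h - 2 * \<theta> * vec_inner n a h)"
  have sym: "?E (\<lambda>h. A h + \<theta> * (mean h - \<xi> h \<omega>)) \<le> (\<integral>\<^sup>+\<omega>'. ennreal (1/2) * (?up \<omega>' + ?dn \<omega>) \<partial>sample)" for \<omega>
  proof -
    obtain h where h: "h \<in> H" "mx (\<lambda>h. A h + \<theta> * (mean h - \<xi> h \<omega>)) = A h + \<theta> * (mean h - \<xi> h \<omega>)"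
      by (rule Max_image_attained[OF H])
    have "A h + \<theta> * (mean h - \<xi> h \<omega>) = (\<integral>\<omega>'. A h + \<theta> * (\<xi> h \<omega>' - \<xi> h \<omega>) \<partial>sample)"
      using integrable_\<xi>[of h] by (simp add: mean_def GT.prob_space)
    then have "?E (\<lambda>h. A h + \<theta> * (mean h - \<xi> h \<omega>)) \<le> (\<integral>\<^sup>+\<omega>'. ennreal (exp (A h + \<theta> * (\<xi> h \<omega>' - \<xi> h \<omega>))) \<partial>sample)"
      unfolding h(2) by (simp only:) (intro GT.exp_expectation_le_nn_integral, use integrable_\<xi>[of h] in simp)
    also have "\<dots> \<le> (\<integral>\<^sup>+\<omega>'. ennreal (1/2) * (?up \<omega>' + ?dn \<omega>) \<partial>sample)"
    proof (rule nn_integral_mono)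
      fix \<omega>'
      let ?p = "A h + 2 * \<theta> * \<xi> h \<omega>'" and ?q = "A h - 2 * \<theta> * \<xi> h \<omega>"
      have "exp (A h + \<theta> * (\<xi> h \<omega>' - \<xi> h \<omega>)) = exp (?p / 2) * exp (?q / 2)"
        by (simp add: exp_add[symmetric] field_simps)
      also have "\<dots> \<le> ((exp (?p / 2))\<^sup>2 + (exp (?q / 2))\<^sup>2) / 2"
        using sum_squares_bound[of "exp (?p / 2)" "exp (?q / 2)"] by simp
      also have "\<dots> = 1/2 * (exp ?p + exp ?q)"
        by (simp add: power2_eq_square exp_add[symmetric])
      also have "\<dots> \<le> 1/2 * (exp (mx (\<lambda>h. A h + 2 * \<theta> * \<xi> h \<omega>')) + exp (mx (\<lambda>h. A h - 2 * \<theta> * \<xi> h \<omega>)))"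
        using mx_ge[OF h(1), of "\<lambda>h. A h + 2 * \<theta> * \<xi> h \<omega>'"] mx_ge[OF h(1), of "\<lambda>h. A h - 2 * \<theta> * \<xi> h \<omega>"]
        by (intro mult_left_mono add_mono) auto
      finally have "ennreal (exp (A h + \<theta> * (\<xi> h \<omega>' - \<xi> h \<omega>))) \<le>
        ennreal (1/2 * (exp (mx (\<lambda>h. A h + 2 * \<theta> * \<xi> h \<omega>')) + exp (mx (\<lambda>h. A h - 2 * \<theta> * \<xi> h \<omega>))))"
        by (rule ennreal_leI)
      also have "\<dots> = ennreal (1/2) * (?up \<omega>' + ?dn \<omega>)"
        by (subst ennreal_mult') (simp_all add: ennreal_plus del: ennreal_half)
      finally show "ennreal (exp (A h + \<theta> * (\<xi> h \<omega>' - \<xi> h \<omega>))) \<le> ennreal (1/2) * (?up \<omega>' + ?dn \<omega>)" .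
    qed
    finally show ?thesis .
  qed
  have [measurable]: "?up \<in> borel_measurable sample" "?dn \<in> borel_measurable sample"
    "?gup \<in> borel_measurable (std_gauss n)" "?gdn \<in> borel_measurable (std_gauss n)"
    by measurable
  have "(\<integral>\<^sup>+\<omega>. ?E (\<lambda>h. A h + \<theta> * (mean h - \<xi> h \<omega>)) \<partial>sample)
     \<le> (\<integral>\<^sup>+\<omega>. \<integral>\<^sup>+\<omega>'. ennreal (1/2) * (?up \<omega>' + ?dn \<omega>) \<partial>sample \<partial>sample)"
    by (intro nn_integral_mono sym)
  also have "\<dots> = ennreal (1/2) * (\<integral>\<^sup>+\<omega>. ?up \<omega> + ?dn \<omega> \<partial>sample)"
    by (simp add: nn_integral_cmult nn_integral_add GT.emeasure_space_1 del: ennreal_half)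
  also have "\<dots> \<le> ennreal (1/2) * (\<integral>\<^sup>+\<omega>. ?gup (fst \<omega>) + ?gdn (fst \<omega>) \<partial>sample)"
  proof (intro mult_left_mono nn_integral_mono)
    fix \<omega>
    have "exp (mx (\<lambda>h. A h + 2 * \<theta> * \<xi> h \<omega>)) + exp (mx (\<lambda>h. A h - 2 * \<theta> * \<xi> h \<omega>))
      \<le> exp (mx (\<lambda>h. A h + 2 * \<theta> * vec_inner n (fst \<omega>) h)) + exp (mx (\<lambda>h. A h - 2 * \<theta> * vec_inner n (fst \<omega>) h))"
    proof (rule exp_Max_contraction[OF H])
      show "\<bar>2 * \<theta> * \<xi> h \<omega> - 2 * \<theta> * \<xi> k \<omega>\<bar> \<le> \<bar>2 * \<theta> * vec_inner n (fst \<omega>) h - 2 * \<theta> * vec_inner n (fst \<omega>) k\<bar>" for h k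
        using lip[of h \<omega> k] \<theta> by (simp add: abs_mult right_diff_distrib[symmetric] mult_left_mono)
      show "\<bar>2 * \<theta> * \<xi> h \<omega>\<bar> \<le> \<bar>2 * \<theta> * vec_inner n (fst \<omega>) h\<bar>" for h
        using bound[of h \<omega>] \<theta> by (simp add: abs_mult mult_left_mono)
    qed
    then show "?up \<omega> + ?dn \<omega> \<le> ?gup (fst \<omega>) + ?gdn (fst \<omega>)"
      by (simp add: ennreal_plus[symmetric] del: ennreal_plus)
  qed simp
  also have "\<dots> = ennreal (1/2) * ((\<integral>\<^sup>+a. ?gup a \<partial>std_gauss n) + (\<integral>\<^sup>+a. ?gdn a \<partial>std_gauss n))"
    using nn_integral_sample_fst[of ?gup] nn_integral_sample_fst[of ?gdn]
    by (subst nn_integral_add) simp_all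
  also have "(\<integral>\<^sup>+a. ?gdn a \<partial>std_gauss n) = (\<integral>\<^sup>+a. ?gup a \<partial>std_gauss n)"
    using nn_integral_std_gauss_minus[of ?gup n] by (simp add: vec_inner_linear)
  also have "ennreal (1/2) * ((\<integral>\<^sup>+a. ?gup a \<partial>std_gauss n) + (\<integral>\<^sup>+a. ?gup a \<partial>std_gauss n)) = (\<integral>\<^sup>+a. ?gup a \<partial>std_gauss n)"
  proof -
    have "ennreal (1/2) * (x + x) = x" for x
    proof -
      have "ennreal (1/2) * (x + x) = (ennreal (1/2) + ennreal (1/2)) * x"
        by (simp add: distrib_left distrib_right del: ennreal_half)
      also have "ennreal (1/2) + ennreal (1/2) = 1"
        by (simp add: ennreal_plus[symmetric] del: ennreal_plus ennreal_half)
      finally show ?thesis by simp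
    qed
    then show ?thesis .
  qed
  finally show ?thesis .
qed

lemma measurable_sample_component:
  "i < m \<Longrightarrow> (\<lambda>\<omega>. \<xi> h (\<omega> i)) \<in> borel_measurable (samples n m T)"
  unfolding samples_def by measurable

lemma prob_space_samples: "prob_space (samples n m T)"
  unfolding samples_def by (intro prob_space_PiM GT.prob_space_axioms)

text \<open>
  One more sample contributes an independent \<open>2 \<theta> \<langle>a,h\<rangle>\<close>; together with the Gaussian vector
  that already replaces the first \<open>m\<close> samples it has the law of one Gaussian vector scaled by
  \<open>sqrt (m + 1)\<close>.
\<close>

lemma samples_comparison:
  assumes \<theta>: "0 \<le> \<theta>"
  shows "(\<integral>\<^sup>+\<omega>. ennreal (exp (mx (\<lambda>h. A h + \<theta> * (\<Sum>i<m. mean h - \<xi> h (\<omega> i))))) \<partial>samples n m T)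
    \<le> (\<integral>\<^sup>+a. ennreal (exp (mx (\<lambda>h. A h + 2 * \<theta> * sqrt m * vec_inner n a h))) \<partial>std_gauss n)"
proof (induction m arbitrary: A)
  case 0
  interpret S0: prob_space "samples n 0 T" by (rule prob_space_samples)
  show ?case using S0.emeasure_space_1 by (simp add: G.emeasure_space_1)
next
  case (Suc m)
  interpret PS: product_sigma_finite "\<lambda>_::nat. sample"
    unfolding product_sigma_finite_def by (simp add: GT.sigma_finite_measure_axioms)
  interpret Sm: prob_space "samples n m T" by (rule prob_space_samples)
  interpret SG: pair_sigma_finite "samples n m T" "std_gauss n" ..
  let ?E = "\<lambda>f. ennreal (exp (mx f))"
  let ?S = "\<lambda>\<omega> h. \<Sum>i<m. mean h - \<xi> h (\<omega> i)"
  have [measurable]: "(\<lambda>\<omega>. ?S \<omega> h) \<in> borel_measurable (samples n m T)" for h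
    using measurable_sample_component by (intro borel_measurable_sum borel_measurable_diff) auto
  have "(\<lambda>\<omega>. ?E (\<lambda>h. A h + \<theta> * (\<Sum>i<Suc m. mean h - \<xi> h (\<omega> i)))) \<in> borel_measurable (samples n (Suc m) T)"
    using measurable_sample_component[of _ "Suc m"]
    by (intro measurable_compose[OF _ measurable_ennreal] borel_measurable_exp measurable_mx borel_measurable_add borel_measurable_times borel_measurable_sum borel_measurable_diff) auto
  then have "(\<integral>\<^sup>+\<omega>. ?E (\<lambda>h. A h + \<theta> * (\<Sum>i<Suc m. mean h - \<xi> h (\<omega> i))) \<partial>samples n (Suc m) T)
    = (\<integral>\<^sup>+\<omega>. \<integral>\<^sup>+z. ?E (\<lambda>h. A h + \<theta> * (\<Sum>i<Suc m. mean h - \<xi> h (fun_upd \<omega> m z i))) \<partial>sample \<partial>samples n m T)"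
    unfolding samples_def lessThan_Suc by (intro PS.product_nn_integral_insert) auto
  also have "\<dots> = (\<integral>\<^sup>+\<omega>. \<integral>\<^sup>+z. ?E (\<lambda>h. (A h + \<theta> * ?S \<omega> h) + \<theta> * (mean h - \<xi> h z)) \<partial>sample \<partial>samples n m T)"
    by (simp add: algebra_simps)
  also have "\<dots> \<le> (\<integral>\<^sup>+\<omega>. \<integral>\<^sup>+a. ?E (\<lambda>h. (A h + \<theta> * ?S \<omega> h) + 2 * \<theta> * vec_inner n a h) \<partial>std_gauss n \<partial>samples n m T)"
    by (intro nn_integral_mono one_sample_comparison \<theta>)
  also have "\<dots> = (\<integral>\<^sup>+a. \<integral>\<^sup>+\<omega>. ?E (\<lambda>h. (A h + \<theta> * ?S \<omega> h) + 2 * \<theta> * vec_inner n a h) \<partial>samples n m T \<partial>std_gauss n)"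
    by (subst SG.Fubini') auto
  also have "\<dots> = (\<integral>\<^sup>+a. \<integral>\<^sup>+\<omega>. ?E (\<lambda>h. (A h + 2 * \<theta> * vec_inner n a h) + \<theta> * ?S \<omega> h) \<partial>samples n m T \<partial>std_gauss n)"
    by (simp add: ac_simps)
  also have "\<dots> \<le> (\<integral>\<^sup>+a. \<integral>\<^sup>+b. ?E (\<lambda>h. (A h + 2 * \<theta> * vec_inner n a h) + 2 * \<theta> * sqrt m * vec_inner n b h) \<partial>std_gauss n \<partial>std_gauss n)"
    by (intro nn_integral_mono Suc.IH)
  also have "\<dots> = (\<integral>\<^sup>+a. \<integral>\<^sup>+b. ?E (\<lambda>h. A h + 2 * \<theta> * sqrt (Suc m) *
       vec_inner n (vec_add n (vec_scale n (1 / sqrt (Suc m)) a) (vec_scale n (sqrt m / sqrt (Suc m)) b)) h) \<partial>std_gauss n \<partial>std_gauss n)"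
  proof -
    have "(A h + 2 * \<theta> * vec_inner n a h) + 2 * \<theta> * sqrt m * vec_inner n b h = A h + 2 * \<theta> * sqrt (Suc m) *
       vec_inner n (vec_add n (vec_scale n (1 / sqrt (Suc m)) a) (vec_scale n (sqrt m / sqrt (Suc m)) b)) h" for a b h
      unfolding vec_inner_linear by (simp add: field_simps del: of_nat_Suc)
    then show ?thesis by (simp only:)
  qed
  also have "\<dots> = (\<integral>\<^sup>+a. ?E (\<lambda>h. A h + 2 * \<theta> * sqrt (Suc m) * vec_inner n a h) \<partial>std_gauss n)"
    by (rule nn_integral_std_gauss_rotate[where H="\<lambda>a. ?E (\<lambda>h. A h + 2 * \<theta> * sqrt (Suc m) * vec_inner n a h)"])
      (measurable, simp add: power_divide field_simps)
  finally show ?case .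
qed

text \<open>
  Chernoff's bound: the exponential moment of the process is at most that of
  \<open>2 sqrt m Max\<^sub>h \<langle>g,h\<rangle>\<close>, which Gaussian concentration controls. The assumption on
  the width says that the mean of the latter uses up at most half of the deviation \<open>m \<beta>\<close>.
\<close>

lemma process_tail_bound:
  assumes r: "0 < r" "\<And>h. h \<in> H \<Longrightarrow> vec_norm n h \<le> r" and \<beta>: "0 < \<beta>"
    and width: "4 * (\<integral>a. mx (vec_inner n a) \<partial>std_gauss n) \<le> sqrt m * \<beta>"
  shows "measure (samples n m T) {\<omega> \<in> space (samples n m T). \<exists>h\<in>H. m * \<beta> \<le> (\<Sum>i<m. mean h - \<xi> h (\<omega> i))}
    \<le> exp (- (m * \<beta>\<^sup>2 / (64 * r\<^sup>2)))"
proof -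
  interpret Sm: prob_space "samples n m T" by (rule prob_space_samples)
  \<comment> \<open>The minimizer of \<open>- \<theta> m \<beta> / 2 + 4 \<theta>\<^sup>2 m r\<^sup>2\<close>.\<close>
  define \<theta> where "\<theta> = \<beta> / (16 * r\<^sup>2)"
  have \<theta>: "0 < \<theta>" using r \<beta> by (simp add: \<theta>_def)
  let ?S = "\<lambda>\<omega> h. \<Sum>i<m. mean h - \<xi> h (\<omega> i)"
  let ?u = "\<lambda>\<omega>. ennreal (exp (mx (\<lambda>h. 0 + \<theta> * ?S \<omega> h)))"
  let ?W = "\<lambda>a. mx (vec_inner n a)"
  let ?w = "\<integral>a. ?W a \<partial>std_gauss n"
  have [measurable]: "(\<lambda>\<omega>. ?S \<omega> h) \<in> borel_measurable (samples n m T)" for h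
    using measurable_sample_component by (intro borel_measurable_sum borel_measurable_diff) auto
  have W_abs: "\<bar>?W a\<bar> \<le> (\<Sum>h\<in>H. \<bar>vec_inner n a h\<bar>)" for a
  proof -
    obtain h where h: "h \<in> H" "?W a = vec_inner n a h" by (rule Max_image_attained[OF H])
    show ?thesis unfolding h(2) using H h(1) by (intro member_le_sum) auto
  qed
  have intW: "integrable (std_gauss n) ?W"
    by (rule Bochner_Integration.integrable_bound[of _ "\<lambda>a. \<Sum>h\<in>H. \<bar>vec_inner n a h\<bar>"])
      (auto intro!: AE_I2 order.trans[OF W_abs] intro: abs_ge_self)
  have mx_scale: "mx (\<lambda>h. c * f h) = c * mx f" if "0 \<le> c" for c and f :: "(nat \<Rightarrow> real) \<Rightarrow> real"
  proof -
    have "mono ((*) c)" using that by (auto intro: monoI mult_left_mono)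
    from mono_Max_commute[OF this, of "f ` H"] H show ?thesis by (simp add: image_image)
  qed
  have "(\<integral>\<^sup>+\<omega>. ?u \<omega> \<partial>samples n m T) \<le> (\<integral>\<^sup>+a. ennreal (exp (mx (\<lambda>h. 0 + 2 * \<theta> * sqrt m * vec_inner n a h))) \<partial>std_gauss n)"
    using \<theta> by (intro samples_comparison) simp
  also have "\<dots> = (\<integral>\<^sup>+a. ennreal (exp ((2 * \<theta> * sqrt m) * ?W a)) \<partial>std_gauss n)"
    using \<theta> by (simp add: mx_scale)
  also have "\<dots> \<le> ennreal (exp ((2 * \<theta> * sqrt m) * ?w + (2 * \<theta> * sqrt m)\<^sup>2 * r\<^sup>2))"
  proof (rule gaussian_concentration[OF intW])
    fix x y
    obtain h where h: "h \<in> H" "?W x = vec_inner n x h" by (rule Max_image_attained[OF H])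
    have "?W x - ?W y \<le> vec_inner n x h - vec_inner n y h" using mx_ge[OF h(1), of "vec_inner n y"] h(2) by simp
    also have "\<dots> = vec_inner n (\<lambda>i. x i - y i) h" by (simp add: vec_inner_def sum_subtractf algebra_simps)
    also have "\<dots> \<le> vec_norm n (\<lambda>i. x i - y i) * vec_norm n h" using abs_vec_inner_le by (rule order.trans[OF abs_ge_self])
    also have "\<dots> \<le> r * vec_norm n (\<lambda>i. x i - y i)"
      using r(2)[OF h(1)] by (simp add: mult.commute mult_right_mono)
    finally show "?W x - ?W y \<le> r * vec_norm n (\<lambda>i. x i - y i)" .
  qed (use \<theta> in simp)
  finally have mgf: "(\<integral>\<^sup>+\<omega>. ?u \<omega> \<partial>samples n m T) \<le> ennreal (exp ((2 * \<theta> * sqrt m) * ?w + (2 * \<theta> * sqrt m)\<^sup>2 * r\<^sup>2))" .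
  let ?c = "exp (- \<theta> * m * \<beta>)"
  let ?B = "{\<omega> \<in> space (samples n m T). \<exists>h\<in>H. m * \<beta> \<le> ?S \<omega> h}"
  have "?B \<subseteq> {\<omega> \<in> space (samples n m T). 1 \<le> ennreal ?c * ?u \<omega>}"
  proof safe
    fix \<omega> h assume h: "h \<in> H" "m * \<beta> \<le> ?S \<omega> h"
    have "\<theta> * (m * \<beta>) \<le> \<theta> * ?S \<omega> h" using h(2) \<theta> by (intro mult_left_mono) auto
    also have "\<dots> \<le> mx (\<lambda>h. 0 + \<theta> * ?S \<omega> h)" using mx_ge[OF h(1), of "\<lambda>h. 0 + \<theta> * ?S \<omega> h"] by simp
    finally have "1 \<le> ?c * exp (mx (\<lambda>h. 0 + \<theta> * ?S \<omega> h))" by (simp add: exp_add[symmetric] mult.assoc)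
    then show "1 \<le> ennreal ?c * ?u \<omega>" by (simp add: ennreal_mult'[symmetric])
  qed
  then have "emeasure (samples n m T) ?B \<le> emeasure (samples n m T) ({\<omega> \<in> space (samples n m T). 1 \<le> ennreal ?c * ?u \<omega>})"
    by (intro emeasure_mono) auto
  also have "\<dots> \<le> ennreal ?c * (\<integral>\<^sup>+\<omega>. ?u \<omega> \<partial>samples n m T)"
    using nn_integral_Markov_inequality[of ?u "space (samples n m T)" "samples n m T" "ennreal ?c"]
    by (simp cong: nn_integral_cong_simp)
  also have "\<dots> \<le> ennreal ?c * ennreal (exp ((2 * \<theta> * sqrt m) * ?w + (2 * \<theta> * sqrt m)\<^sup>2 * r\<^sup>2))"
    using mgf by (intro mult_left_mono) auto
  also have "\<dots> = ennreal (exp (- \<theta> * m * \<beta> + 2 * \<theta> * sqrt m * ?w + 4 * \<theta>\<^sup>2 * m * r\<^sup>2))"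
    by (simp add: ennreal_mult'[symmetric] exp_add[symmetric] power_mult_distrib algebra_simps)
  also have "\<dots> \<le> ennreal (exp (- (m * \<beta>\<^sup>2 / (64 * r\<^sup>2))))"
  proof (intro ennreal_leI, subst exp_le_cancel_iff)
    have "\<theta> * sqrt m * (4 * ?w) \<le> \<theta> * sqrt m * (sqrt m * \<beta>)"
      using width \<theta> by (intro mult_left_mono) auto
    also have "\<dots> = \<theta> * (sqrt m * sqrt m) * \<beta>" by (simp only: ac_simps)
    finally have "2 * \<theta> * sqrt m * ?w \<le> \<theta> * m * \<beta> / 2" by simp
    moreover have "- \<theta> * m * \<beta> + \<theta> * m * \<beta> / 2 + 4 * \<theta>\<^sup>2 * m * r\<^sup>2 = - (m * \<beta>\<^sup>2 / (64 * r\<^sup>2))"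
      using r(1) by (simp add: \<theta>_def field_simps power2_eq_square)
    ultimately show "- \<theta> * m * \<beta> + 2 * \<theta> * sqrt m * ?w + 4 * \<theta>\<^sup>2 * m * r\<^sup>2 \<le> - (m * \<beta>\<^sup>2 / (64 * r\<^sup>2))" by linarith
  qed
  finally show ?thesis by (simp add: Sm.emeasure_eq_measure)
qed

end

section \<open>The excess risk of the hinge loss\<close>

lemma std_normal_abs_tail_expectation:
  assumes b: "0 \<le> b"
  shows "(\<integral>\<^sup>+x. ennreal (\<bar>x\<bar> * indicator {b..} \<bar>x\<bar>) \<partial>std_normal_distribution) = ennreal (2 * std_normal_density b)"
proof -
  have half: "(\<integral>\<^sup>+x. ennreal (x * std_normal_density x) * indicator {b..} x \<partial>lborel) = ennreal (std_normal_density b)"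
  proof -
    have "(\<integral>\<^sup>+x. ennreal (x * std_normal_density x) * indicator {b..} x \<partial>lborel) = ennreal (0 - (- std_normal_density b))"
    proof (rule nn_integral_FTC_atLeast)
      show "((\<lambda>x. - std_normal_density x) \<longlongrightarrow> 0) at_top"
        unfolding std_normal_density_def by real_asymp
      show "((\<lambda>x. - std_normal_density x) has_real_derivative x * std_normal_density x) (at x)" for x
      proof -
        have "((\<lambda>x. exp (- x\<^sup>2 / 2)) has_real_derivative - x * exp (- x\<^sup>2 / 2)) (at x)"
          by (auto intro!: derivative_eq_intros)
        from DERIV_cmult[OF this, of "- (1 / sqrt (2 * pi))"] show ?thesis
          by (simp add: std_normal_density_def mult.left_commute)
      qed
    qed (use b in auto)
    then show ?thesis by simp
  qed
  have "(\<integral>\<^sup>+x. ennreal (\<bar>x\<bar> * indicator {b..} \<bar>x\<bar>) \<partial>std_normal_distribution)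
     = (\<integral>\<^sup>+x. ennreal (std_normal_density x) * ennreal (\<bar>x\<bar> * indicator {b..} \<bar>x\<bar>) \<partial>lborel)"
    by (subst nn_integral_std_normal) auto
  also have "\<dots> = (\<integral>\<^sup>+x. ennreal (x * std_normal_density x) * indicator {b..} x
      + ennreal ((- x) * std_normal_density (- x)) * indicator {b..} (- x) \<partial>lborel)"
  proof (intro nn_integral_cong_AE, rule AE_I[where N="{0}"])
    show "{x \<in> space lborel. \<not> ennreal (std_normal_density x) * ennreal (\<bar>x\<bar> * indicator {b..} \<bar>x\<bar>) =
        ennreal (x * std_normal_density x) * indicator {b..} x
      + ennreal ((- x) * std_normal_density (- x)) * indicator {b..} (- x)} \<subseteq> {0}"
      using b by (auto simp: ennreal_mult'[symmetric] std_normal_density_def abs_if mult.commute split: split_indicator if_splits)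
  qed auto
  also have "\<dots> = ennreal (std_normal_density b) + (\<integral>\<^sup>+x. ennreal ((- x) * std_normal_density (- x)) * indicator {b..} (- x) \<partial>lborel)"
    by (subst nn_integral_add) (auto simp: half)
  also have "(\<integral>\<^sup>+x. ennreal ((- x) * std_normal_density (- x)) * indicator {b..} (- x) \<partial>lborel)
     = (\<integral>\<^sup>+x. ennreal (x * std_normal_density x) * indicator {b..} x \<partial>lborel)"
    by (subst nn_integral_real_affine[where c="-1" and t=0 and f="\<lambda>x. ennreal (x * std_normal_density x) * indicator {b..} x"]) auto
  finally show ?thesis
    by (simp add: half ennreal_plus[symmetric] del: ennreal_plus)
qed

lemma measure_std_normal_interval_ge:
  assumes "0 \<le> u" "u \<le> v"
  shows "(v - u) * std_normal_density v \<le> measure std_normal_distribution {u<..<v}"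
proof -
  interpret prob_space std_normal_distribution by (rule prob_space_std_normal)
  have "ennreal ((v - u) * std_normal_density v) = (\<integral>\<^sup>+x. ennreal (std_normal_density v) * indicator {u<..<v} x \<partial>lborel)"
    using assms by (subst nn_integral_cmult) (auto simp: ennreal_mult'[symmetric] mult.commute)
  also have "\<dots> \<le> (\<integral>\<^sup>+x. ennreal (std_normal_density x) * indicator {u<..<v} x \<partial>lborel)"
    using assms by (intro nn_integral_mono)
      (auto simp: std_normal_density_def power_mono intro!: ennreal_leI divide_right_mono split: split_indicator)
  also have "\<dots> = emeasure std_normal_distribution {u<..<v}" by (simp add: emeasure_density)
  finally show ?thesis by (simp add: emeasure_eq_measure)
qed

lemma nn_integral_std_normal_uminus:
  assumes [measurable]: "f \<in> borel_measurable borel"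
  shows "(\<integral>\<^sup>+x. f (- x) \<partial>std_normal_distribution) = (\<integral>\<^sup>+x. f x \<partial>std_normal_distribution)"
  using nn_integral_std_normal_rotate[OF assms, of "-1" 0]
  by (simp add: prob_space.emeasure_space_1[OF prob_space_std_normal, simplified])

definition upper_tail :: real where
  "upper_tail = measure std_normal_distribution {1..}"

lemma upper_tail_pos: "0 < upper_tail"
proof -
  interpret prob_space std_normal_distribution by (rule prob_space_std_normal)
  have "0 < std_normal_density 2" by (rule normal_density_pos) simp
  also have "\<dots> \<le> measure std_normal_distribution {1<..<2}"
    using measure_std_normal_interval_ge[of 1 2] by simp
  also have "\<dots> \<le> upper_tail" unfolding upper_tail_def by (rule finite_measure_mono) auto
  finally show ?thesis .
qed

lemma lower_tail: "measure std_normal_distribution {..-1} = upper_tail"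
proof -
  interpret prob_space std_normal_distribution by (rule prob_space_std_normal)
  have "(\<lambda>x::real. indicator {1..} (- x) :: ennreal) = indicator {..-1}" by (auto simp: indicator_def)
  then show ?thesis
    using nn_integral_std_normal_uminus[of "indicator {1..}"] by (simp add: upper_tail_def measure_def)
qed

lemma integral_std_normal_id: "(\<integral>x. x \<partial>std_normal_distribution) = 0"
  using integral_std_normal_moment_odd[of 0] by (subst integral_density) auto

text \<open>
  The margins \<open>z\<close> for which \<open>\<mu> z\<close> lies within a distance of order \<open>r\<close> from the kink of the hinge, on
  the side from which moving from \<open>\<mu>\<close> to \<open>s\<close> pushes \<open>s z\<close> across the kink: scaling down
  (\<open>s \<le> \<mu>\<close>) moves points beyond \<open>1/\<mu>\<close> back, scaling up moves points before \<open>1/\<mu>\<close> forward.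
\<close>

definition kink_window :: "real \<Rightarrow> real \<Rightarrow> real \<Rightarrow> real set" where
  "kink_window \<mu> s r = (if s \<le> \<mu> then {1 / \<mu><..<1 / \<mu> + r / 2} else {1 / \<mu> - r / 2<..<1 / \<mu>})"

text \<open>
  The values of the orthogonal Gaussian component that push in the same direction by at least one
  standard deviation.
\<close>

definition kink_tail :: "real \<Rightarrow> real \<Rightarrow> real set" where
  "kink_tail \<mu> s = (if s \<le> \<mu> then {..-1} else {1..})"

lemma hinge_subgradient: "- (if u0 < 1 then u - u0 else 0) \<le> hinge u - hinge u0"
  by (auto simp: hinge_def)

text \<open>
  Outside the window this is the subgradient inequality. Inside, the distances covered towards the far
  side of the kink are at least \<open>\<bar>s/\<mu> - 1\<bar> \<ge> \<bar>s - \<mu>\<bar>\<close> from rescaling and \<open>\<rho>\<close> from the orthogonal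
  component, together at least \<open>r\<close>; at most \<open>r/2\<close> of this is lost because \<open>z\<close> need not be
  \<open>1/\<mu>\<close> itself.
\<close>

lemma hinge_excess_pointwise:
  assumes \<mu>: "0 < \<mu>" "\<mu> \<le> 1" and s: "0 \<le> s" "s \<le> 1" and \<rho>: "0 \<le> \<rho>" and r: "0 < r" "r \<le> \<bar>s - \<mu>\<bar> + \<rho>"
  shows "hinge (s * z + \<rho> * \<gamma>) - hinge (\<mu> * z) \<ge>
    - (if \<mu> * z < 1 then (s - \<mu>) * z + \<rho> * \<gamma> else 0)
    + r / 2 * (indicator (kink_window \<mu> s r) z * indicator (kink_tail \<mu> s) \<gamma>)"
proof (cases "z \<in> kink_window \<mu> s r \<and> \<gamma> \<in> kink_tail \<mu> s")
  case False
  then show ?thesis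
    using hinge_subgradient[of "\<mu> * z" "s * z + \<rho> * \<gamma>"]
    by (auto simp: indicator_def algebra_simps split: if_splits)
next
  case True
  have d: "\<bar>s - \<mu>\<bar> \<le> \<bar>s / \<mu> - 1\<bar>"
  proof -
    have "\<bar>s - \<mu>\<bar> = \<mu> * \<bar>s / \<mu> - 1\<bar>" using \<mu> by (simp add: abs_mult_pos' field_simps abs_if)
    also have "\<dots> \<le> 1 * \<bar>s / \<mu> - 1\<bar>" using \<mu> by (intro mult_right_mono) auto
    finally show ?thesis by simp
  qed
  show ?thesis
  proof (cases "s \<le> \<mu>")
    case le: True
    have z: "1 / \<mu> < z" "z < 1 / \<mu> + r / 2" and \<gamma>: "\<gamma> \<le> -1"
      using True le by (auto simp: kink_window_def kink_tail_def)
    have "s * z \<le> s * (1 / \<mu> + r / 2)" using z s by (intro mult_left_mono) auto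
    moreover have "s * r \<le> r" using s r by (simp add: mult_left_le_one_le)
    ultimately have "s * z \<le> s / \<mu> + r / 2" by (simp add: algebra_simps)
    moreover have "\<rho> * \<gamma> \<le> \<rho> * (-1)" using \<gamma> \<rho> by (intro mult_left_mono) auto
    moreover have "s / \<mu> \<le> 1" using le \<mu> by simp
    ultimately have "r / 2 \<le> 1 - (s * z + \<rho> * \<gamma>)" using d r(2) le by linarith
    then have "r / 2 \<le> hinge (s * z + \<rho> * \<gamma>)" unfolding hinge_def by (rule max.coboundedI2)
    moreover have "1 < \<mu> * z" using z \<mu> by (simp add: field_simps)
    moreover from this have "hinge (\<mu> * z) = 0" by (simp add: hinge_def)
    ultimately show ?thesis using True by simp
  next
    case gt: False
    have z: "1 / \<mu> - r / 2 < z" "z < 1 / \<mu>" and \<gamma>: "1 \<le> \<gamma>"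
      using True gt by (auto simp: kink_window_def kink_tail_def)
    have "s * (1 / \<mu> - r / 2) \<le> s * z" using z s by (intro mult_left_mono) auto
    moreover have "s * r \<le> r" using s r by (simp add: mult_left_le_one_le)
    ultimately have "s / \<mu> - r / 2 \<le> s * z" by (simp add: algebra_simps)
    moreover have "\<rho> * 1 \<le> \<rho> * \<gamma>" using \<gamma> \<rho> by (intro mult_left_mono) auto
    moreover have "1 \<le> s / \<mu>" using gt \<mu> by simp
    ultimately have "r / 2 \<le> (s * z + \<rho> * \<gamma>) - 1" using d r(2) gt by linarith
    moreover have "\<mu> * z < 1" using z \<mu> by (simp add: field_simps)
    ultimately show ?thesis using True r by (simp add: hinge_def algebra_simps)
  qed
qed

text \<open>
  The previous inequality averaged over the orthogonal component: its linear term vanishes, and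
  the symmetry of the normal distribution absorbs the sign \<open>y\<close> of the response.
\<close>

lemma hinge_excess_conditional:
  assumes \<mu>: "0 < \<mu>" "\<mu> \<le> 1" and s: "0 \<le> s" "s \<le> 1" and \<rho>: "0 \<le> \<rho>" and r: "0 < r" "r \<le> \<bar>s - \<mu>\<bar> + \<rho>"
    and y: "y = 1 \<or> y = -1"
  shows "(\<integral>\<gamma>. hinge (s * z + y * (\<rho> * \<gamma>)) - hinge (\<mu> * z) \<partial>std_normal_distribution) \<ge>
    - (if \<mu> * z < 1 then (s - \<mu>) * z else 0) + r / 2 * upper_tail * indicator (kink_window \<mu> s r) z"
proof -
  interpret prob_space std_normal_distribution by (rule prob_space_std_normal)
  let ?i = "if \<mu> * z < 1 then 1 else (0::real)"
  let ?J = "(\<lambda>\<gamma>. y * \<gamma>) -` kink_tail \<mu> s"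
  have J: "?J = {..-1} \<or> ?J = {1..}" using y by (auto simp: kink_tail_def)
  then have J_meas: "measure std_normal_distribution ?J = upper_tail"
    by (elim disjE) (simp_all add: lower_tail upper_tail_def)
  have [measurable]: "?J \<in> sets borel" using J by auto
  let ?lb = "\<lambda>\<gamma>. - ?i * ((s - \<mu>) * z + \<rho> * (y * \<gamma>)) + r / 2 * indicator (kink_window \<mu> s r) z * indicator ?J \<gamma>"
  have "integrable std_normal_distribution (\<lambda>\<gamma>. hinge (s * z + y * (\<rho> * \<gamma>)) - hinge (\<mu> * z))"
  proof (rule Bochner_Integration.integrable_bound)
    show "integrable std_normal_distribution (\<lambda>\<gamma>. 1 + \<bar>s * z\<bar> + \<rho> * \<bar>\<gamma>\<bar> + \<bar>hinge (\<mu> * z)\<bar>)"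
      using integrable_std_normal_id by auto
    show "(\<lambda>\<gamma>. hinge (s * z + y * (\<rho> * \<gamma>)) - hinge (\<mu> * z)) \<in> borel_measurable std_normal_distribution"
      unfolding hinge_def by measurable
    have "\<bar>y * (\<rho> * \<gamma>)\<bar> = \<rho> * \<bar>\<gamma>\<bar>" for \<gamma> using y \<rho> by (auto simp: abs_mult)
    then have "\<bar>hinge (s * z + y * (\<rho> * \<gamma>))\<bar> \<le> 1 + \<bar>s * z\<bar> + \<rho> * \<bar>\<gamma>\<bar>" for \<gamma>
      using abs_triangle_ineq[of "s * z" "y * (\<rho> * \<gamma>)"] by (simp add: hinge_def max_def) (smt (verit))
    then have "\<bar>hinge (s * z + y * (\<rho> * \<gamma>)) - hinge (\<mu> * z)\<bar> \<le> 1 + \<bar>s * z\<bar> + \<rho> * \<bar>\<gamma>\<bar> + \<bar>hinge (\<mu> * z)\<bar>" for \<gamma>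
      using abs_triangle_ineq4[of "hinge (s * z + y * (\<rho> * \<gamma>))" "hinge (\<mu> * z)"] by (smt (verit))
    then show "AE \<gamma> in std_normal_distribution. norm (hinge (s * z + y * (\<rho> * \<gamma>)) - hinge (\<mu> * z)) \<le> norm (1 + \<bar>s * z\<bar> + \<rho> * \<bar>\<gamma>\<bar> + \<bar>hinge (\<mu> * z)\<bar>)"
      by (intro AE_I2) (simp, smt (verit))
  qed
  moreover have indJ: "integrable std_normal_distribution (indicator ?J :: real \<Rightarrow> real)"
    by (intro integrable_real_indicator) (auto simp: emeasure_eq_measure)
  then have "integrable std_normal_distribution ?lb"
    using integrable_std_normal_id by (intro Bochner_Integration.integrable_add integrable_mult_right) auto
  ultimately have "(\<integral>\<gamma>. ?lb \<gamma> \<partial>std_normal_distribution) \<le> (\<integral>\<gamma>. hinge (s * z + y * (\<rho> * \<gamma>)) - hinge (\<mu> * z) \<partial>std_normal_distribution)"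
  proof (intro integral_mono)
    fix \<gamma>
    show "?lb \<gamma> \<le> hinge (s * z + y * (\<rho> * \<gamma>)) - hinge (\<mu> * z)"
      using hinge_excess_pointwise[OF \<mu> s \<rho> r, of z "y * \<gamma>"]
      by (auto simp: mult.left_commute indicator_def split: if_splits)
  qed
  also have "(\<integral>\<gamma>. ?lb \<gamma> \<partial>std_normal_distribution) = - ?i * ((s - \<mu>) * z) + r / 2 * indicator (kink_window \<mu> s r) z * upper_tail"
  proof -
    have "integrable std_normal_distribution (\<lambda>\<gamma>. - ?i * ((s - \<mu>) * z + \<rho> * (y * \<gamma>)))"
      "integrable std_normal_distribution (\<lambda>\<gamma>. r / 2 * indicator (kink_window \<mu> s r) z * indicator ?J \<gamma> :: real)"
      using integrable_std_normal_id indJ by (intro integrable_mult_right Bochner_Integration.integrable_add; simp)+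
    then have "(\<integral>\<gamma>. ?lb \<gamma> \<partial>std_normal_distribution) = (\<integral>\<gamma>. - ?i * ((s - \<mu>) * z + \<rho> * (y * \<gamma>)) \<partial>std_normal_distribution)
       + (\<integral>\<gamma>. r / 2 * indicator (kink_window \<mu> s r) z * indicator ?J \<gamma> \<partial>std_normal_distribution)"
      by (rule Bochner_Integration.integral_add)
    also have "(\<integral>\<gamma>. - ?i * ((s - \<mu>) * z + \<rho> * (y * \<gamma>)) \<partial>std_normal_distribution) = - ?i * ((s - \<mu>) * z)"
      using integrable_std_normal_id by (simp add: integral_std_normal_id prob_space[simplified])
    also have "(\<integral>\<gamma>. r / 2 * indicator (kink_window \<mu> s r) z * indicator ?J \<gamma> \<partial>std_normal_distribution) = r / 2 * indicator (kink_window \<mu> s r) z * upper_tail"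
      by (simp add: J_meas)
    finally show ?thesis .
  qed
  finally show ?thesis by (simp add: ac_simps split: if_splits)
qed

text \<open>
  The factor \<open>exp (- 9/8)\<close> is \<open>exp (- 5/8)\<close>, a lower bound for the decrease of the normal density
  from \<open>1/\<mu>\<close> to \<open>1/\<mu> + r/2\<close>, times \<open>exp (- 1/2)\<close>, the ratio of the densities at \<open>1\<close> and \<open>0\<close>, which enters
  when \<open>\<mu> = 1\<close>.
\<close>

definition excess_const :: real where
  "excess_const = upper_tail * exp (- 9 / 8) / 16"

lemma excess_const_pos: "0 < excess_const"
  using upper_tail_pos by (simp add: excess_const_def)

locale quantized_gaussian =
  fixes F :: "real \<Rightarrow> real \<Rightarrow> real" and T :: "real measure"
  assumes quantizer: "quantizer F T"
begin

sublocale T: prob_space T using quantizer by (simp add: quantizer_def)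
sublocale N: prob_space std_normal_distribution by (rule prob_space_std_normal)
sublocale NT: pair_prob_space std_normal_distribution T ..

lemma sets_T [measurable_cong]: "sets T = sets borel"
  using quantizer by (simp add: quantizer_def)

lemma measurable_F [measurable (raw)]:
  assumes "f \<in> borel_measurable M" "g \<in> borel_measurable M"
  shows "(\<lambda>x. F (f x) (g x)) \<in> borel_measurable M"
proof -
  have "case_prod F \<in> borel_measurable (borel \<Otimes>\<^sub>M borel)" using quantizer by (simp add: quantizer_def)
  from measurable_compose[OF measurable_Pair[OF assms] this] show ?thesis by simp
qed

lemma F_cases: "F v \<tau> = 1 \<or> F v \<tau> = -1"
  using quantizer by (auto simp: quantizer_def)

lemma abs_F [simp]: "\<bar>F v \<tau>\<bar> = 1"
  using F_cases[of v \<tau>] by auto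

text \<open>
  The signed margin \<open>f(g) g\<close> of a sample at the target direction, on the space of \<open>(g, \<tau>)\<close>.
\<close>

definition margin :: "real \<times> real \<Rightarrow> real" where "margin q = F (fst q) (snd q) * fst q"

lemma abs_margin [simp]: "\<bar>margin q\<bar> = \<bar>fst q\<bar>"
  by (simp add: margin_def abs_mult)

abbreviation \<nu> where "\<nu> \<equiv> std_normal_distribution \<Otimes>\<^sub>M T"

lemma measurable_margin [measurable]: "margin \<in> borel_measurable \<nu>"
  unfolding margin_def by measurable

lemma nn_integral_\<nu>_fst:
  assumes [measurable]: "f \<in> borel_measurable borel"
  shows "(\<integral>\<^sup>+q. f (fst q) \<partial>\<nu>) = (\<integral>\<^sup>+g. f g \<partial>std_normal_distribution)"
  by (subst T.nn_integral_fst[symmetric]) (auto simp: T.emeasure_space_1)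

lemma integrable_margin: "integrable \<nu> margin"
proof -
  have "(\<integral>\<^sup>+q. ennreal (norm (margin q)) \<partial>\<nu>) = (\<integral>\<^sup>+x. ennreal (\<bar>x\<bar> * indicator {0..} \<bar>x\<bar>) \<partial>std_normal_distribution)"
    using nn_integral_\<nu>_fst[of "\<lambda>x. ennreal \<bar>x\<bar>"] by simp
  also have "\<dots> < \<infinity>" by (subst std_normal_abs_tail_expectation) auto
  finally show ?thesis by (intro integrableI_bounded) auto
qed

lemma correlation_eq: "correlation F T = (\<integral>q. margin q \<partial>\<nu>)"
  by (simp add: correlation_def gauss_noise_def margin_def case_prod_unfold)

lemma hinge_risk_eq: "hinge_risk F T s = (\<integral>q. hinge (s * margin q) \<partial>\<nu>)"
  by (simp add: hinge_risk_def gauss_noise_def margin_def case_prod_unfold mult.assoc)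

lemma measurable_hinge [measurable]: "hinge \<in> borel_measurable borel"
  unfolding hinge_def by measurable

lemma hinge_lipschitz: "\<bar>hinge u - hinge v\<bar> \<le> \<bar>u - v\<bar>"
  by (auto simp: hinge_def)

lemma integrable_hinge_margin: "integrable \<nu> (\<lambda>q. hinge (s * margin q))"
proof (rule Bochner_Integration.integrable_bound)
  show "integrable \<nu> (\<lambda>q. 1 + \<bar>s * margin q\<bar>)" using integrable_margin by auto
  show "AE q in \<nu>. norm (hinge (s * margin q)) \<le> norm (1 + \<bar>s * margin q\<bar>)" by (auto simp: hinge_def)
qed measurable

text \<open>
  The margin has the same modulus as \<open>g\<close>, for which \<open>E[\<bar>g\<bar> 1{\<bar>g\<bar> \<ge> b}] = 2 \<phi>(b)\<close> since \<open>- \<phi>\<close> is a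
  primitive of \<open>x \<phi>(x)\<close>.
\<close>

lemma expectation_margin_tail_le:
  assumes b: "0 \<le> b" and f: "\<And>q. f q \<le> \<bar>margin q\<bar> * indicator {b..} \<bar>margin q\<bar>" and int: "integrable \<nu> f"
  shows "(\<integral>q. f q \<partial>\<nu>) \<le> 2 * std_normal_density b"
proof -
  let ?g = "\<lambda>q. \<bar>margin q\<bar> * indicator {b..} \<bar>margin q\<bar> :: real"
  have g_int: "integrable \<nu> ?g"
  proof (rule Bochner_Integration.integrable_bound[OF integrable_margin])
    show "AE q in \<nu>. norm (?g q) \<le> norm (margin q)" by (auto split: split_indicator)
  qed measurable
  have "(\<integral>q. f q \<partial>\<nu>) \<le> (\<integral>q. ?g q \<partial>\<nu>)" using int g_int f by (intro integral_mono) auto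
  also have "\<dots> = 2 * std_normal_density b"
  proof -
    have "ennreal (\<integral>q. ?g q \<partial>\<nu>) = (\<integral>\<^sup>+q. ennreal (?g q) \<partial>\<nu>)"
      using g_int by (intro nn_integral_eq_integral[symmetric]) auto
    also have "\<dots> = ennreal (2 * std_normal_density b)"
      using nn_integral_\<nu>_fst[of "\<lambda>x. ennreal (\<bar>x\<bar> * indicator {b..} \<bar>x\<bar>)"] std_normal_abs_tail_expectation[OF b] by simp
    finally show ?thesis by (subst (asm) ennreal_inj) (auto intro!: Bochner_Integration.integral_nonneg)
  qed
  finally show ?thesis .
qed

lemma correlation_le: "correlation F T \<le> 2 * std_normal_density 0"
  unfolding correlation_eq by (rule expectation_margin_tail_le) (auto simp: integrable_margin simp del: abs_margin)

lemma AE_margin_neq: "0 < c \<Longrightarrow> AE q in \<nu>. margin q \<noteq> c"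
proof -
  assume c: "0 < c"
  have S: "{q \<in> space \<nu>. \<bar>fst q\<bar> = c} \<in> sets \<nu>" by measurable
  have "emeasure \<nu> {q \<in> space \<nu>. \<bar>fst q\<bar> = c} = (\<integral>\<^sup>+q. indicator {-c, c} (fst q) \<partial>\<nu>)"
    using c by (subst nn_integral_indicator[OF S, symmetric]) (auto intro!: nn_integral_cong simp: indicator_def abs_eq_iff)
  also have "\<dots> = emeasure std_normal_distribution {-c, c}"
    using nn_integral_\<nu>_fst[of "indicator {-c, c}"] by simp
  also have "\<dots> = 0"
    by (subst emeasure_density)
      (auto intro!: nn_integral_0_iff_AE[THEN iffD2] AE_I[where N="{-c,c}"] simp: emeasure_lborel_countable indicator_def)
  finally have 0: "emeasure \<nu> {q \<in> space \<nu>. \<bar>fst q\<bar> = c} = 0" .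
  have "AE q in \<nu>. \<bar>fst q\<bar> \<noteq> c"
    by (rule AE_I[OF _ 0 S]) auto
  then show ?thesis
  proof eventually_elim
    case (elim q)
    show ?case
    proof
      assume "margin q = c"
      then have "\<bar>fst q\<bar> = c" using abs_margin[of q] c by linarith
      then show False using elim by simp
    qed
  qed
qed

lemma integrable_truncated_margin: "integrable \<nu> (\<lambda>q. if \<mu> * margin q < 1 then margin q else 0)"
  by (rule Bochner_Integration.integrable_bound[OF integrable_margin]) auto

text \<open>
  The difference quotients of the risk at \<open>\<mu>\<close> towards \<open>s\<close> are nonnegative by minimality; dominated
  convergence gives their limit, as the hinge is differentiable off its kink and the
  margin avoids the value \<open>1/\<mu>\<close> almost surely.
\<close>

lemma hinge_risk_first_order:
  assumes min: "is_arg_min (hinge_risk F T) (\<lambda>s. s \<in> {0..1}) \<mu>" and \<mu>: "0 < \<mu>" and s: "s \<in> {0..1}"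
  shows "(s - \<mu>) * (\<integral>q. (if \<mu> * margin q < 1 then margin q else 0) \<partial>\<nu>) \<le> 0"
proof -
  have \<mu>1: "\<mu> \<in> {0..1}" and opt: "\<And>s. s \<in> {0..1} \<Longrightarrow> hinge_risk F T \<mu> \<le> hinge_risk F T s"
    using min by (auto simp: is_arg_min_def not_less)
  define \<epsilon> :: "nat \<Rightarrow> real" where "\<epsilon> k = 1 / (real k + 1)" for k
  have \<epsilon>: "0 < \<epsilon> k" "\<epsilon> k \<le> 1" for k by (auto simp: \<epsilon>_def)
  have \<epsilon>0: "\<epsilon> \<longlonglongrightarrow> 0" unfolding \<epsilon>_def by real_asymp
  define p where "p k = \<mu> + \<epsilon> k * (s - \<mu>)" for k
  have p: "p k \<in> {0..1}" for k
  proof -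
    have "p k = (1 - \<epsilon> k) * \<mu> + \<epsilon> k * s" by (simp add: p_def algebra_simps)
    then show ?thesis using \<epsilon>[of k] \<mu>1 s
      by (auto intro!: add_nonneg_nonneg convex_bound_le)
  qed
  let ?D = "\<lambda>k q. (hinge (p k * margin q) - hinge (\<mu> * margin q)) / \<epsilon> k"
  let ?L = "\<lambda>q. if \<mu> * margin q < 1 then - ((s - \<mu>) * margin q) else 0"
  have "(\<lambda>k. \<integral>q. ?D k q \<partial>\<nu>) \<longlonglongrightarrow> (\<integral>q. ?L q \<partial>\<nu>)"
  proof (rule integral_dominated_convergence[where w = "\<lambda>q. \<bar>(s - \<mu>) * margin q\<bar>"])
    show "integrable \<nu> (\<lambda>q. \<bar>(s - \<mu>) * margin q\<bar>)" using integrable_margin by auto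
    show "AE q in \<nu>. norm (?D k q) \<le> \<bar>(s - \<mu>) * margin q\<bar>" for k
    proof (rule AE_I2)
      fix q
      have "\<bar>hinge (p k * margin q) - hinge (\<mu> * margin q)\<bar> \<le> \<bar>p k * margin q - \<mu> * margin q\<bar>" by (rule hinge_lipschitz)
      also have "p k * margin q - \<mu> * margin q = \<epsilon> k * ((s - \<mu>) * margin q)" by (simp add: p_def algebra_simps)
      also have "\<bar>\<epsilon> k * ((s - \<mu>) * margin q)\<bar> = \<bar>(s - \<mu>) * margin q\<bar> * \<epsilon> k" using \<epsilon>(1)[of k] by (simp only: abs_mult) simp
      finally show "norm (?D k q) \<le> \<bar>(s - \<mu>) * margin q\<bar>"
        using \<epsilon>(1)[of k] pos_divide_le_eq[of "\<epsilon> k" "\<bar>hinge (p k * margin q) - hinge (\<mu> * margin q)\<bar>" "\<bar>(s - \<mu>) * margin q\<bar>"]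
        by (simp only: real_norm_def abs_divide) simp
    qed
    have conv: "(\<lambda>k. p k * margin q) \<longlonglongrightarrow> \<mu> * margin q" for q
    proof -
      have "(\<lambda>k. (\<mu> + \<epsilon> k * (s - \<mu>)) * margin q) \<longlonglongrightarrow> (\<mu> + 0 * (s - \<mu>)) * margin q"
        by (intro tendsto_intros \<epsilon>0)
      then show ?thesis by (simp add: p_def)
    qed
    show "AE q in \<nu>. (\<lambda>k. ?D k q) \<longlonglongrightarrow> ?L q"
      using AE_margin_neq[of "1 / \<mu>"] \<mu>
    proof (auto elim!: eventually_mono)
      fix q assume "\<mu> * margin q < 1"
      then have "eventually (\<lambda>k. p k * margin q < 1) sequentially" using order_tendstoD(2)[OF conv] by blast
      then have "eventually (\<lambda>k. ?D k q = - ((s - \<mu>) * margin q)) sequentially"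
      proof eventually_elim
        case (elim k)
        then have "hinge (p k * margin q) - hinge (\<mu> * margin q) = - (\<epsilon> k * ((s - \<mu>) * margin q))"
          using \<open>\<mu> * margin q < 1\<close> by (simp add: hinge_def p_def algebra_simps)
        then show ?case using \<epsilon>[of k] by simp
      qed
      then show "(\<lambda>k. ?D k q) \<longlonglongrightarrow> - ((s - \<mu>) * margin q)" by (rule tendsto_eventually)
    next
      fix q assume "margin q \<noteq> 1 / \<mu>" "\<not> \<mu> * margin q < 1"
      then have "1 < \<mu> * margin q" using \<mu> by (simp add: field_simps)
      then have "eventually (\<lambda>k. 1 < p k * margin q) sequentially" using order_tendstoD(1)[OF conv] by blast
      then have "eventually (\<lambda>k. ?D k q = 0) sequentially"
        by eventually_elim (use \<open>1 < \<mu> * margin q\<close> in \<open>simp add: hinge_def\<close>)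
      then show "(\<lambda>k. ?D k q) \<longlonglongrightarrow> 0" by (rule tendsto_eventually)
    qed
  qed measurable
  moreover have "0 \<le> (\<integral>q. ?D k q \<partial>\<nu>)" for k
    using opt[OF p[of k]] \<epsilon>[of k] integrable_hinge_margin by (simp add: hinge_risk_eq)
  ultimately have "0 \<le> (\<integral>q. ?L q \<partial>\<nu>)" by (intro LIMSEQ_le_const) auto
  also have "(\<integral>q. ?L q \<partial>\<nu>) = (\<integral>q. - (s - \<mu>) * (if \<mu> * margin q < 1 then margin q else 0) \<partial>\<nu>)"
    by (intro Bochner_Integration.integral_cong) (auto simp: left_diff_distrib)
  also have "\<dots> = - (s - \<mu>) * (\<integral>q. (if \<mu> * margin q < 1 then margin q else 0) \<partial>\<nu>)"
    by (rule integral_mult_right_zero)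
  finally show ?thesis by (simp add: algebra_simps)
qed

text \<open>
  If \<open>\<mu> < 1\<close>, first-order optimality towards \<open>s = 1\<close> says that the margins below \<open>1/\<mu>\<close> contribute
  at most zero to \<open>\<lambda>\<close>; so \<open>\<lambda>\<close> is at most the tail expectation beyond \<open>1/\<mu>\<close>.
\<close>

lemma correlation_le_density:
  assumes min: "is_arg_min (hinge_risk F T) (\<lambda>s. s \<in> {0..1}) \<mu>" and \<mu>: "0 < \<mu>" "\<mu> < 1"
  shows "correlation F T \<le> 2 * std_normal_density (1 / \<mu>)"
proof -
  let ?A = "\<lambda>q. if \<mu> * margin q < 1 then margin q else 0" and ?B = "\<lambda>q. if \<mu> * margin q < 1 then 0 else margin q"
  have B: "?B = (\<lambda>q. margin q - ?A q)" by auto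
  have intB: "integrable \<nu> ?B" unfolding B using integrable_margin integrable_truncated_margin by auto
  have "(\<integral>q. ?A q \<partial>\<nu>) \<le> 0"
    using hinge_risk_first_order[OF min \<mu>(1), of 1] \<mu>(2) by (simp add: mult_le_0_iff)
  then have "correlation F T \<le> (\<integral>q. ?B q \<partial>\<nu>)"
    unfolding correlation_eq B using integrable_margin integrable_truncated_margin by (subst Bochner_Integration.integral_diff) auto
  also have "\<dots> \<le> 2 * std_normal_density (1 / \<mu>)"
  proof (rule expectation_margin_tail_le)
    show "?B q \<le> \<bar>margin q\<bar> * indicator {1 / \<mu>..} \<bar>margin q\<bar>" for q
      using \<mu> by (auto simp: field_simps abs_if split: split_indicator)
  qed (use \<mu> intB in auto)
  finally show ?thesis .
qed

lemma density_ge_correlation: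
  assumes min: "is_arg_min (hinge_risk F T) (\<lambda>s. s \<in> {0..1}) \<mu>" and \<mu>: "0 < \<mu>"
    and pos: "0 < correlation F T"
  shows "correlation F T * exp (- 1 / 2) / 2 \<le> std_normal_density (1 / \<mu>)"
proof (cases "\<mu> < 1")
  case True
  have "correlation F T * exp (- 1 / 2) \<le> correlation F T * 1"
    using pos by (intro mult_left_mono) auto
  then show ?thesis using correlation_le_density[OF min \<mu> True] by simp
next
  case False
  then have "\<mu> = 1" using min by (auto simp: is_arg_min_def)
  have "correlation F T * exp (- 1 / 2) \<le> 2 * std_normal_density 0 * exp (- 1 / 2)"
    using correlation_le by (intro mult_right_mono) auto
  also have "\<dots> = 2 * std_normal_density 1" by (simp add: std_normal_density_def)
  finally show ?thesis using \<open>\<mu> = 1\<close> by simp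
qed

text \<open>
  For \<open>\<mu> < 1\<close> this inverts \<open>\<lambda> \<le> 2 \<phi>(1/\<mu>)\<close>. For \<open>\<mu> = 1\<close> it only expresses that \<open>\<lambda>\<close>, being at
  most \<open>sqrt (2/pi)\<close>, is bounded away from one.
\<close>

lemma inverse_\<mu>_le:
  assumes min: "is_arg_min (hinge_risk F T) (\<lambda>s. s \<in> {0..1}) \<mu>" and \<mu>: "0 < \<mu>"
    and pos: "0 < correlation F T"
  shows "1 / \<mu> \<le> 3 * sqrt (ln (1 / correlation F T))"
proof -
  let ?l = "correlation F T"
  have "(1 / \<mu>)\<^sup>2 \<le> 9 * ln (1 / ?l)"
  proof (cases "\<mu> < 1")
    case True
    have "?l \<le> 2 * std_normal_density (1 / \<mu>)" by (rule correlation_le_density[OF min \<mu> True])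
    also have "\<dots> \<le> exp (- (1 / \<mu>)\<^sup>2 / 2)"
    proof -
      have "2 \<le> sqrt (2 * pi)" by (rule real_le_rsqrt) (use pi_gt3 in simp)
      then show ?thesis by (simp add: std_normal_density_def field_simps)
    qed
    finally have "ln ?l \<le> - (1 / \<mu>)\<^sup>2 / 2" using pos by (metis exp_gt_zero ln_exp ln_le_cancel_iff)
    then have "(1 / \<mu>)\<^sup>2 \<le> 2 * ln (1 / ?l)" using pos by (simp add: ln_div)
    moreover have "0 \<le> ln (1 / ?l)" using \<open>(1 / \<mu>)\<^sup>2 \<le> 2 * ln (1 / ?l)\<close> zero_le_power2[of "1 / \<mu>"] by linarith
    ultimately show ?thesis by linarith
  next
    case False
    then have "\<mu> = 1" using min by (auto simp: is_arg_min_def)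
    have "?l\<^sup>2 \<le> (2 * std_normal_density 0)\<^sup>2" using correlation_le pos by (intro power_mono) auto
    also have "\<dots> = 2 / pi" by (simp add: std_normal_density_def power_divide)
    also have "\<dots> \<le> 2 / 3" using pi_gt3 by (simp add: field_simps)
    finally have l2: "?l\<^sup>2 \<le> 2 / 3" .
    have "ln (2/3::real) \<le> 2 / 3 - 1" by (rule ln_le_minus_one) simp
    moreover have "ln (?l\<^sup>2) \<le> ln (2 / 3)" using l2 pos by simp
    ultimately have "2 * ln ?l \<le> - 1 / 3" using pos by (simp add: ln_realpow)
    then have "1 \<le> 9 * ln (1 / ?l)" using pos by (simp add: ln_div)
    then show ?thesis using \<open>\<mu> = 1\<close> by simp
  qed
  then have "1 / \<mu> \<le> sqrt (9 * ln (1 / ?l))" by (rule real_le_rsqrt)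
  then show ?thesis by (simp add: real_sqrt_mult)
qed

text \<open>
  On positive values the margin equals \<open>\<bar>g\<bar>\<close> exactly when \<open>f(g)\<close> has the sign of \<open>g\<close>, and by (C2)
  this has conditional probability at least one half given \<open>\<bar>g\<bar>\<close>.
\<close>

lemma prob_margin_ge_half:
  assumes cond: "cond_sign_nonneg F T" and S: "S \<in> sets borel" "S \<subseteq> {0<..}"
  shows "measure \<nu> {q \<in> space \<nu>. margin q \<in> S} \<ge> 1 / 2 * measure std_normal_distribution S"
proof -
  let ?\<sigma> = "\<lambda>q. F (fst q) (snd q) * sign1 (fst q)"
  let ?A = "{q \<in> space \<nu>. \<bar>fst q\<bar> \<in> S}"
  let ?V = "vimage_algebra (space \<nu>) (\<lambda>q. \<bar>fst q\<bar>) borel"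
  note S(1)[measurable]
  have [measurable]: "sign1 \<in> borel_measurable borel" unfolding sign1_def by measurable
  have sub: "subalgebra \<nu> ?V"
  proof -
    have [measurable]: "(\<lambda>q. \<bar>fst q\<bar>) \<in> borel_measurable \<nu>" by measurable
    have "(\<lambda>q. \<bar>fst q\<bar>) -` A \<inter> space \<nu> \<in> sets \<nu>" if "A \<in> sets borel" for A
      using that by (rule measurable_sets[rotated]) measurable
    then show ?thesis unfolding subalgebra_def by (auto simp: sets_vimage_algebra2)
  qed
  interpret finite_measure_subalgebra \<nu> ?V
    by standard (rule sub)
  have AV: "?A \<in> sets ?V"
    using S by (auto simp: sets_vimage_algebra2 vimage_def intro!: exI[of _ S])
  have int: "integrable \<nu> ?\<sigma>"
    by (rule NT.integrable_const_bound[where B=1]) (auto simp: abs_mult sign1_def)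
  have "AE q in \<nu>. 0 \<le> real_cond_exp \<nu> ?V ?\<sigma> q"
    using cond[unfolded cond_sign_nonneg_def gauss_noise_def case_prod_beta'] .
  then have "0 \<le> (\<integral>q\<in>?A. real_cond_exp \<nu> ?V ?\<sigma> q \<partial>\<nu>)"
    unfolding set_lebesgue_integral_def by (intro integral_nonneg_AE) (auto elim!: eventually_mono simp: indicator_def)
  also have "\<dots> = (\<integral>q\<in>?A. ?\<sigma> q \<partial>\<nu>)" using real_cond_exp_intA[OF int AV] by simp
  finally have nonneg: "0 \<le> (\<integral>q. indicator ?A q * ?\<sigma> q \<partial>\<nu>)" by (simp add: set_lebesgue_integral_def)
  have Am [measurable]: "?A \<in> sets \<nu>" by measurable
  have "{q \<in> space \<nu>. margin q \<in> S} \<inter> space \<nu> = {q \<in> space \<nu>. margin q \<in> S}" by auto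
  then have "measure \<nu> {q \<in> space \<nu>. margin q \<in> S} = (\<integral>q. indicator {q \<in> space \<nu>. margin q \<in> S} q \<partial>\<nu>)"
    by simp
  also have "\<dots> = (\<integral>q. 1 / 2 * indicator ?A q + 1 / 2 * (indicator ?A q * ?\<sigma> q) \<partial>\<nu>)"
  proof (intro Bochner_Integration.integral_cong refl)
    fix q assume "q \<in> space \<nu>"
    moreover have "0 < x" if "x \<in> S" for x using S(2) that by auto
    ultimately show "indicator {q \<in> space \<nu>. margin q \<in> S} q = 1 / 2 * indicator ?A q + 1 / 2 * (indicator ?A q * ?\<sigma> q)"
      using F_cases[of "fst q" "snd q"]
      by (cases "0 \<le> fst q") (fastforce simp: margin_def sign1_def indicator_def)+
  qed
  also have "\<dots> = 1 / 2 * measure \<nu> ?A + 1 / 2 * (\<integral>q. indicator ?A q * ?\<sigma> q \<partial>\<nu>)"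
  proof -
    have "integrable \<nu> (indicator ?A :: _ \<Rightarrow> real)"
      by (intro integrable_real_indicator Am) (auto simp: NT.emeasure_eq_measure)
    moreover have "integrable \<nu> (\<lambda>q. indicator ?A q * ?\<sigma> q)"
      using integrable_mult_indicator[OF Am int] by simp
    moreover have "?A \<inter> space \<nu> = ?A" by auto
    ultimately show ?thesis
      by (subst Bochner_Integration.integral_add) (auto intro!: integrable_mult_right integrable_divide)
  qed
  also have "\<dots> \<ge> 1 / 2 * measure \<nu> ?A" using nonneg by simp
  moreover have "measure std_normal_distribution S \<le> measure \<nu> ?A"
  proof -
    have "emeasure std_normal_distribution S = (\<integral>\<^sup>+q. indicator S (fst q) \<partial>\<nu>)"
      using nn_integral_\<nu>_fst[of "indicator S"] by simp
    also have "\<dots> \<le> (\<integral>\<^sup>+q. indicator ?A q \<partial>\<nu>)"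
      using S(2) by (intro nn_integral_mono) (auto simp: indicator_def)
    also have "\<dots> = emeasure \<nu> ?A" by (rule nn_integral_indicator) measurable
    finally show ?thesis by (simp add: N.emeasure_eq_measure NT.emeasure_eq_measure)
  qed
  ultimately show ?thesis by linarith
qed

lemma std_normal_density_window:
  assumes b: "1 \<le> b" and r: "0 < r" "r * b \<le> 1"
  shows "std_normal_density b * exp (- 5 / 8) \<le> std_normal_density (b + r / 2)"
proof -
  have "r * 1 \<le> r * b" using r b by (intro mult_left_mono) auto
  then have "r \<le> 1" using r(2) by linarith
  then have "r * r \<le> 1 * 1" using r by (intro mult_mono) auto
  then have "(b + r / 2)\<^sup>2 \<le> b\<^sup>2 + 5 / 4" using r(2) by (simp add: power2_eq_square algebra_simps)
  then have "exp (- b\<^sup>2 / 2) * exp (- 5 / 8) \<le> exp (- (b + r / 2)\<^sup>2 / 2)"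
    by (simp add: exp_add[symmetric])
  then show ?thesis by (simp add: std_normal_density_def divide_right_mono)
qed

lemma prob_kink_window:
  assumes cond: "cond_sign_nonneg F T" and min: "is_arg_min (hinge_risk F T) (\<lambda>s. s \<in> {0..1}) \<mu>"
    and \<mu>: "0 < \<mu>" and pos: "0 < correlation F T" and r: "0 < r" "r \<le> \<mu>"
  shows "r * correlation F T * exp (- 9 / 8) / 8 \<le> measure \<nu> {q \<in> space \<nu>. margin q \<in> kink_window \<mu> s r}"
proof -
  have \<mu>1: "\<mu> \<le> 1" using min by (auto simp: is_arg_min_def)
  let ?b = "1 / \<mu>"
  have b: "1 \<le> ?b" and rb: "r * ?b \<le> 1" using \<mu> \<mu>1 r by auto
  have rb2: "r / 2 < ?b" using b r \<mu>1 by linarith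
  let ?\<phi> = "std_normal_density ?b * exp (- 5 / 8)"
  have "r / 2 * ?\<phi> \<le> measure std_normal_distribution (kink_window \<mu> s r)"
  proof (cases "s \<le> \<mu>")
    case True
    have "r / 2 * ?\<phi> \<le> (?b + r / 2 - ?b) * std_normal_density (?b + r / 2)"
      using std_normal_density_window[OF b r(1) rb] r by simp
    also have "\<dots> \<le> measure std_normal_distribution {?b<..<?b + r / 2}"
      using b r by (intro measure_std_normal_interval_ge) auto
    finally show ?thesis using True by (simp add: kink_window_def)
  next
    case False
    have "?\<phi> \<le> std_normal_density ?b * 1" by (intro mult_left_mono) auto
    then have "r / 2 * ?\<phi> \<le> (?b - (?b - r / 2)) * std_normal_density ?b" using r by simp
    also have "\<dots> \<le> measure std_normal_distribution {?b - r / 2<..<?b}"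
      using b r rb2 by (intro measure_std_normal_interval_ge) linarith+
    finally show ?thesis using False by (simp add: kink_window_def)
  qed
  moreover have "correlation F T * exp (- 9 / 8) / 2 \<le> ?\<phi>"
  proof -
    have "correlation F T * exp (- 9 / 8) / 2 = correlation F T * exp (- 1 / 2) / 2 * exp (- 5 / 8)"
      by (simp add: mult.assoc exp_add[symmetric])
    also have "\<dots> \<le> ?\<phi>" using density_ge_correlation[OF min \<mu> pos] by (intro mult_right_mono) auto
    finally show ?thesis .
  qed
  then have "r / 2 * (correlation F T * exp (- 9 / 8) / 2) \<le> r / 2 * ?\<phi>" using r by (intro mult_left_mono) auto
  moreover have "kink_window \<mu> s r \<in> sets borel" by (simp add: kink_window_def)
  moreover have "kink_window \<mu> s r \<subseteq> {0<..}"
  proof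
    fix z assume "z \<in> kink_window \<mu> s r"
    then have "?b - r / 2 < z" using r by (auto simp: kink_window_def split: if_splits)
    then show "z \<in> {0<..}" using rb2 by simp
  qed
  ultimately have
    "1 / 2 * measure std_normal_distribution (kink_window \<mu> s r) \<le> measure \<nu> {q \<in> space \<nu>. margin q \<in> kink_window \<mu> s r}"
    and "r / 2 * (correlation F T * exp (- 9 / 8) / 2) \<le> measure std_normal_distribution (kink_window \<mu> s r)"
    using prob_margin_ge_half[OF cond, of "kink_window \<mu> s r"] by auto
  then show ?thesis by (simp add: field_simps)
qed

text \<open>
  The increase of the loss on one sample \<open>(a, \<tau>)\<close> when \<open>\<mu> x\<^sub>0\<close> is replaced by \<open>\<mu> x\<^sub>0 + h\<close>.
\<close>

definition excess_loss :: "nat \<Rightarrow> (nat \<Rightarrow> real) \<Rightarrow> real \<Rightarrow> (nat \<Rightarrow> real) \<Rightarrow> (nat \<Rightarrow> real) \<times> real \<Rightarrow> real" where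
  "excess_loss n x0 \<mu> h \<omega> =
     hinge (F (vec_inner n (fst \<omega>) x0) (snd \<omega>) * (\<mu> * vec_inner n (fst \<omega>) x0 + vec_inner n (fst \<omega>) h))
     - hinge (F (vec_inner n (fst \<omega>) x0) (snd \<omega>) * (\<mu> * vec_inner n (fst \<omega>) x0))"

text \<open>
  The response depends on \<open>a\<close> only through \<open>\<langle>a,x\<^sub>0\<rangle>\<close>, so this law is all that the expected loss at
  \<open>s x\<^sub>0 + v\<close> depends on.
\<close>

lemma distr_signal_and_orthogonal_part:
  assumes u: "vec_norm n x0 = 1" and uv: "vec_inner n x0 v = 0"
  shows "distr (std_gauss n \<Otimes>\<^sub>M T) (\<nu> \<Otimes>\<^sub>M std_normal_distribution)
           (\<lambda>\<omega>. ((vec_inner n (fst \<omega>) x0, snd \<omega>), vec_inner n (fst \<omega>) v))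
       = distr (\<nu> \<Otimes>\<^sub>M std_normal_distribution) (\<nu> \<Otimes>\<^sub>M std_normal_distribution) (\<lambda>(q, g). (q, vec_norm n v * g))"
    (is "?L = ?R")
proof (rule measure_eqI)
  interpret G: prob_space "std_gauss n" by (rule prob_space_std_gauss)
  interpret GT: pair_sigma_finite "std_gauss n" T ..
  have [measurable]: "(\<lambda>x. vec_norm n v * snd x) \<in> borel_measurable (\<nu> \<Otimes>\<^sub>M std_normal_distribution)" by measurable
  fix A assume A': "A \<in> sets ?L"
  then have A [measurable]: "A \<in> sets (\<nu> \<Otimes>\<^sub>M std_normal_distribution)" by simp
  have "emeasure ?L A = (\<integral>\<^sup>+\<omega>. indicator A ((vec_inner n (fst \<omega>) x0, snd \<omega>), vec_inner n (fst \<omega>) v) \<partial>(std_gauss n \<Otimes>\<^sub>M T))"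
    using A' A by (simp add: nn_integral_distr nn_integral_indicator[symmetric] del: nn_integral_indicator)
  also have "\<dots> = (\<integral>\<^sup>+\<tau>. \<integral>\<^sup>+a. indicator A ((vec_inner n a x0, \<tau>), vec_inner n a v) \<partial>std_gauss n \<partial>T)"
    by (subst GT.nn_integral_snd[symmetric]) auto
  also have "\<dots> = (\<integral>\<^sup>+\<tau>. \<integral>\<^sup>+g. \<integral>\<^sup>+g'. indicator A ((g, \<tau>), vec_norm n v * g') \<partial>std_normal_distribution \<partial>std_normal_distribution \<partial>T)"
  proof (intro nn_integral_cong)
    fix \<tau> assume "\<tau> \<in> space T"
    then have "(\<lambda>p. ((fst p, \<tau>), snd p)) \<in> measurable (borel \<Otimes>\<^sub>M borel) (\<nu> \<Otimes>\<^sub>M std_normal_distribution)" by measurable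
    then have "(\<lambda>p. indicator A ((fst p, \<tau>), snd p) :: ennreal) \<in> borel_measurable (borel \<Otimes>\<^sub>M borel)"
      by (rule measurable_compose) measurable
    then show "(\<integral>\<^sup>+a. indicator A ((vec_inner n a x0, \<tau>), vec_inner n a v) \<partial>std_gauss n)
      = (\<integral>\<^sup>+g. \<integral>\<^sup>+g'. indicator A ((g, \<tau>), vec_norm n v * g') \<partial>std_normal_distribution \<partial>std_normal_distribution)"
      by (intro nn_integral_std_gauss_orthogonal_pair[where k="\<lambda>g g'. indicator A ((g, \<tau>), g')"] u uv)
        (simp add: case_prod_beta')
  qed
  also have "\<dots> = (\<integral>\<^sup>+q. \<integral>\<^sup>+g'. indicator A (q, vec_norm n v * g') \<partial>std_normal_distribution \<partial>\<nu>)"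
    by (subst NT.nn_integral_snd[symmetric]) auto
  also have "\<dots> = (\<integral>\<^sup>+p. indicator A (case p of (q, g) \<Rightarrow> (q, vec_norm n v * g)) \<partial>(\<nu> \<Otimes>\<^sub>M std_normal_distribution))"
    by (subst N.nn_integral_fst[symmetric]) auto
  also have "\<dots> = emeasure ?R A"
    using A by (simp add: nn_integral_distr nn_integral_indicator[symmetric] del: nn_integral_indicator)
  finally show "emeasure ?L A = emeasure ?R A" .
qed simp

lemma excess_loss_lipschitz:
  "\<bar>excess_loss n x0 \<mu> h \<omega> - excess_loss n x0 \<mu> k \<omega>\<bar> \<le> \<bar>vec_inner n (fst \<omega>) h - vec_inner n (fst \<omega>) k\<bar>"
proof -
  let ?y = "F (vec_inner n (fst \<omega>) x0) (snd \<omega>)" and ?u = "\<mu> * vec_inner n (fst \<omega>) x0"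
  have "\<bar>excess_loss n x0 \<mu> h \<omega> - excess_loss n x0 \<mu> k \<omega>\<bar> \<le> \<bar>?y * (?u + vec_inner n (fst \<omega>) h) - ?y * (?u + vec_inner n (fst \<omega>) k)\<bar>"
    unfolding excess_loss_def using hinge_lipschitz by simp
  also have "\<dots> = \<bar>vec_inner n (fst \<omega>) h - vec_inner n (fst \<omega>) k\<bar>"
    by (simp add: right_diff_distrib[symmetric] abs_mult)
  finally show ?thesis .
qed

lemma excess_loss_bound: "\<bar>excess_loss n x0 \<mu> h \<omega>\<bar> \<le> \<bar>vec_inner n (fst \<omega>) h\<bar>"
  using excess_loss_lipschitz[of n x0 \<mu> h \<omega> "\<lambda>_. 0"] by (simp add: excess_loss_def vec_inner_def)

lemma measurable_excess_loss: "excess_loss n x0 \<mu> h \<in> borel_measurable (std_gauss n \<Otimes>\<^sub>M T)"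
  unfolding excess_loss_def by measurable

text \<open>
  Integrating the conditional inequality over the margin: the linear term is nonnegative by first-order
  optimality, applied to \<open>s = \<langle>x,x\<^sub>0\<rangle>\<close>, which lies in \<open>[0,1]\<close> because \<open>r < \<mu>\<close> and \<open>\<parallel>x\<parallel> \<le> 1\<close>. The gain
  \<open>r/2\<close> is collected with probability of order \<open>r \<lambda>\<close>.
\<close>

lemma excess_risk_ge:
  assumes cond: "cond_sign_nonneg F T" and min: "is_arg_min (hinge_risk F T) (\<lambda>s. s \<in> {0..1}) \<mu>"
    and pos: "0 < correlation F T" and r: "0 < r" "r < \<mu>"
    and x0: "vec_norm n x0 = 1" and x: "vec_norm n x \<le> 1"
    and h: "vec_norm n (vec_diff n x (vec_scale n \<mu> x0)) = r"
  shows "excess_const * correlation F T * r\<^sup>2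
    \<le> (\<integral>\<omega>. excess_loss n x0 \<mu> (vec_diff n x (vec_scale n \<mu> x0)) \<omega> \<partial>(std_gauss n \<Otimes>\<^sub>M T))"
proof -
  have \<mu>: "0 < \<mu>" "\<mu> \<le> 1" using min r by (auto simp: is_arg_min_def)
  let ?h = "vec_diff n x (vec_scale n \<mu> x0)"
  define s where "s = vec_inner n x x0"
  define v where "v = vec_diff n x (vec_scale n s x0)"
  define \<rho> where "\<rho> = vec_norm n v"
  have x0x0: "vec_inner n x0 x0 = 1" using x0 by (simp add: vec_inner_self)
  have orth: "vec_inner n x0 v = 0"
    by (simp add: v_def vec_inner_linear x0x0 s_def vec_inner_commute)
  have split: "vec_inner n a ?h = (s - \<mu>) * vec_inner n a x0 + vec_inner n a v" for a
    by (simp add: v_def vec_inner_linear algebra_simps)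
  have \<rho>: "0 \<le> \<rho>" by (simp add: \<rho>_def L2_set_nonneg)
  have "r\<^sup>2 = vec_inner n ?h ?h" by (simp add: vec_inner_self h)
  also have "\<dots> = (s - \<mu>) * vec_inner n ?h x0 + vec_inner n ?h v" by (rule split)
  also have "\<dots> = (s - \<mu>) * vec_inner n x0 ?h + vec_inner n v ?h" by (simp add: vec_inner_commute)
  also have "\<dots> = (s - \<mu>)\<^sup>2 + \<rho>\<^sup>2"
    unfolding split x0x0 orth vec_inner_commute[of n v x0] by (simp add: vec_inner_self \<rho>_def power2_eq_square)
  finally have r2: "r\<^sup>2 = (s - \<mu>)\<^sup>2 + \<rho>\<^sup>2" .
  have "r\<^sup>2 \<le> (\<bar>s - \<mu>\<bar> + \<rho>)\<^sup>2" unfolding r2 using \<rho> by (simp add: power2_sum)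
  then have r_le: "r \<le> \<bar>s - \<mu>\<bar> + \<rho>" by (rule power2_le_imp_le) (use \<rho> in simp)
  have "\<bar>s - \<mu>\<bar>\<^sup>2 \<le> r\<^sup>2" unfolding r2 by simp
  then have "\<bar>s - \<mu>\<bar> \<le> r" by (rule power2_le_imp_le) (use r in simp)
  then have s0: "0 \<le> s" using r by linarith
  have s1: "s \<le> 1" using abs_vec_inner_le[of n x x0] x x0 by (simp add: s_def)
  let ?K = "\<lambda>(q, g). hinge (F (fst q) (snd q) * (\<mu> * fst q + ((s - \<mu>) * fst q + g))) - hinge (F (fst q) (snd q) * (\<mu> * fst q))"
  have [measurable]: "?K \<in> borel_measurable (\<nu> \<Otimes>\<^sub>M std_normal_distribution)" by measurable
  have m1: "(\<lambda>\<omega>. ((vec_inner n (fst \<omega>) x0, snd \<omega>), vec_inner n (fst \<omega>) v)) \<in> measurable (std_gauss n \<Otimes>\<^sub>M T) (\<nu> \<Otimes>\<^sub>M std_normal_distribution)" by measurable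
  have m2: "(\<lambda>(q, g). (q, vec_norm n v * g)) \<in> measurable (\<nu> \<Otimes>\<^sub>M std_normal_distribution) (\<nu> \<Otimes>\<^sub>M std_normal_distribution)" by measurable
  let ?k = "\<lambda>q g. hinge (s * margin q + F (fst q) (snd q) * (\<rho> * g)) - hinge (\<mu> * margin q)"
  have K: "?K (q, \<rho> * g) = ?k q g" for q g by (simp add: margin_def algebra_simps)
  have "(\<integral>\<omega>. excess_loss n x0 \<mu> ?h \<omega> \<partial>(std_gauss n \<Otimes>\<^sub>M T))
      = (\<integral>\<omega>. ?K ((vec_inner n (fst \<omega>) x0, snd \<omega>), vec_inner n (fst \<omega>) v) \<partial>(std_gauss n \<Otimes>\<^sub>M T))"
    unfolding excess_loss_def split by simp
  also have "\<dots> = (\<integral>p. ?K p \<partial>distr (std_gauss n \<Otimes>\<^sub>M T) (\<nu> \<Otimes>\<^sub>M std_normal_distribution) (\<lambda>\<omega>. ((vec_inner n (fst \<omega>) x0, snd \<omega>), vec_inner n (fst \<omega>) v)))"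
    by (rule integral_distr[symmetric, OF m1]) measurable
  also have "\<dots> = (\<integral>p. ?K (case p of (q, g) \<Rightarrow> (q, vec_norm n v * g)) \<partial>(\<nu> \<Otimes>\<^sub>M std_normal_distribution))"
    unfolding distr_signal_and_orthogonal_part[OF x0 orth] by (rule integral_distr[OF m2]) measurable
  also have "\<dots> = (\<integral>p. ?k (fst p) (snd p) \<partial>(\<nu> \<Otimes>\<^sub>M std_normal_distribution))"
    using K by (simp add: case_prod_beta \<rho>_def)
  finally have mean_eq: "(\<integral>\<omega>. excess_loss n x0 \<mu> ?h \<omega> \<partial>(std_gauss n \<Otimes>\<^sub>M T)) = (\<integral>p. ?k (fst p) (snd p) \<partial>(\<nu> \<Otimes>\<^sub>M std_normal_distribution))" .
  interpret \<nu>N: pair_prob_space \<nu> std_normal_distribution ..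
  have int: "integrable (\<nu> \<Otimes>\<^sub>M std_normal_distribution) (\<lambda>p. ?k (fst p) (snd p))"
  proof (rule Bochner_Integration.integrable_bound)
    have "integrable (\<nu> \<Otimes>\<^sub>M std_normal_distribution) (\<lambda>p. margin (fst p))"
      using integrable_margin unfolding integrable_iff_bounded
      by (auto simp: N.nn_integral_fst[symmetric] N.emeasure_space_1[simplified])
    moreover have "integrable (\<nu> \<Otimes>\<^sub>M std_normal_distribution) (\<lambda>p. snd p)"
      using integrable_std_normal_id unfolding integrable_iff_bounded
      by (auto simp: \<nu>N.nn_integral_snd[symmetric] NT.emeasure_space_1)
    ultimately show "integrable (\<nu> \<Otimes>\<^sub>M std_normal_distribution) (\<lambda>p. \<bar>(s - \<mu>) * margin (fst p)\<bar> + \<rho> * \<bar>snd p\<bar>)" by auto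
    show "AE p in \<nu> \<Otimes>\<^sub>M std_normal_distribution. norm (?k (fst p) (snd p)) \<le> norm (\<bar>(s - \<mu>) * margin (fst p)\<bar> + \<rho> * \<bar>snd p\<bar>)"
    proof (rule AE_I2)
      fix p :: "(real \<times> real) \<times> real"
      obtain q g where p: "p = (q, g)" by (cases p)
      have "\<bar>?k q g\<bar> \<le> \<bar>s * margin q + F (fst q) (snd q) * (\<rho> * g) - \<mu> * margin q\<bar>" by (rule hinge_lipschitz)
      also have "\<dots> = \<bar>(s - \<mu>) * margin q + F (fst q) (snd q) * (\<rho> * g)\<bar>" by (simp add: algebra_simps)
      also have "\<dots> \<le> \<bar>(s - \<mu>) * margin q\<bar> + \<rho> * \<bar>g\<bar>"
        using abs_triangle_ineq[of "(s - \<mu>) * margin q" "F (fst q) (snd q) * (\<rho> * g)"] \<rho> by (simp add: abs_mult)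
      finally show "norm (?k (fst p) (snd p)) \<le> norm (\<bar>(s - \<mu>) * margin (fst p)\<bar> + \<rho> * \<bar>snd p\<bar>)" using \<rho> by (simp add: p)
    qed
  qed measurable
  let ?I = "kink_window \<mu> s r"
  have [measurable]: "?I \<in> sets borel" by (simp add: kink_window_def)
  let ?W = "{q \<in> space \<nu>. margin q \<in> ?I}"
  let ?A = "\<lambda>q. if \<mu> * margin q < 1 then margin q else 0"
  have W [measurable]: "?W \<in> sets \<nu>" by measurable
  have Wsp: "?W \<inter> space \<nu> = ?W" by auto
  have indW: "integrable \<nu> (indicator ?W :: _ \<Rightarrow> real)"
    by (intro integrable_real_indicator W) (auto simp: NT.emeasure_eq_measure)
  let ?lb = "\<lambda>q. - (s - \<mu>) * ?A q + r / 2 * upper_tail * indicator ?W q"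
  have "r / 2 * upper_tail * (r * correlation F T * exp (- 9 / 8) / 8) \<le> r / 2 * upper_tail * measure \<nu> ?W"
    using r upper_tail_pos by (intro mult_left_mono prob_kink_window[OF cond min \<mu>(1) pos]) auto
  then have "excess_const * correlation F T * r\<^sup>2 \<le> r / 2 * upper_tail * measure \<nu> ?W"
    by (simp add: excess_const_def power2_eq_square ac_simps)
  also have "\<dots> \<le> - (s - \<mu>) * (\<integral>q. ?A q \<partial>\<nu>) + r / 2 * upper_tail * measure \<nu> ?W"
    using hinge_risk_first_order[OF min \<mu>(1), of s] s0 s1 by (simp add: left_diff_distrib)
  also have "\<dots> = (\<integral>q. ?lb q \<partial>\<nu>)"
    using integrable_truncated_margin[of \<mu>] indW
    by (subst Bochner_Integration.integral_add)
      (auto intro!: integrable_mult_right integrable_divide simp: Wsp)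
  also have "\<dots> \<le> (\<integral>q. \<integral>g. ?k q g \<partial>std_normal_distribution \<partial>\<nu>)"
  proof (rule integral_mono)
    show "integrable \<nu> ?lb"
      using integrable_truncated_margin[of \<mu>] indW by (intro Bochner_Integration.integrable_add integrable_mult_right) auto
    show "integrable \<nu> (\<lambda>q. \<integral>g. ?k q g \<partial>std_normal_distribution)"
      using \<nu>N.integrable_fst'[OF int] by simp
    fix q assume "q \<in> space \<nu>"
    then show "?lb q \<le> (\<integral>g. ?k q g \<partial>std_normal_distribution)"
      using hinge_excess_conditional[OF \<mu> s0 s1 \<rho> r(1) r_le F_cases, of "margin q" "fst q" "snd q"]
      by (auto simp: indicator_def left_diff_distrib split: if_splits)
  qed
  also have "\<dots> = (\<integral>p. ?k (fst p) (snd p) \<partial>(\<nu> \<Otimes>\<^sub>M std_normal_distribution))"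
    using \<nu>N.integral_fst'[OF int] by simp
  finally show ?thesis unfolding mean_eq .
qed

end

section \<open>Uniform deviation over the sphere\<close>

lemma continuous_on_vec_inner: "continuous_on UNIV (\<lambda>h. vec_inner n a h)"
  unfolding vec_inner_def
  by (intro continuous_on_sum continuous_on_mult continuous_on_const continuous_on_product_coordinates)

lemma SUP_dense_subset:
  fixes f :: "'a::topological_space \<Rightarrow> real"
  assumes f: "continuous_on UNIV f" and D: "D \<subseteq> L" "L \<subseteq> closure D" and ne: "L \<noteq> {}" and bdd: "bdd_above (f ` L)"
  shows "(SUP x\<in>L. f x) = (SUP x\<in>D. f x)"
proof (rule antisym)
  have "D \<noteq> {}" using D ne by auto
  have bddD: "bdd_above (f ` D)" using bdd D(1) by (meson bdd_above_mono image_mono)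
  have "closed {x. f x \<le> (SUP x\<in>D. f x)}"
    using f by (intro closed_Collect_le continuous_on_const)
  moreover have "D \<subseteq> {x. f x \<le> (SUP x\<in>D. f x)}" using bddD by (auto intro: cSUP_upper)
  ultimately have "L \<subseteq> {x. f x \<le> (SUP x\<in>D. f x)}" using D(2) closure_minimal by blast
  then show "(SUP x\<in>L. f x) \<le> (SUP x\<in>D. f x)" using ne by (intro cSUP_least) auto
  show "(SUP x\<in>D. f x) \<le> (SUP x\<in>L. f x)"
    using \<open>D \<noteq> {}\<close> bdd D(1) by (intro cSUP_subset_mono) auto
qed

text \<open>
  The integrals are compared pointwise; the point is that the supremum is integrable. It is
  measurable as a supremum over a countable dense subset and dominated by a multiple of the
  norm of \<open>a\<close>.
\<close>

lemma expectation_Max_le_gaussian_width: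
  assumes L: "\<And>h. h \<in> L \<Longrightarrow> vec_norm n h \<le> t" and H: "finite H" "H \<noteq> {}" "H \<subseteq> L"
  shows "(\<integral>a. Max (vec_inner n a ` H) \<partial>std_gauss n) \<le> gaussian_width n L"
proof -
  interpret prob_space "std_gauss n" by (rule prob_space_std_gauss)
  obtain h0 where h0: "h0 \<in> L" using H by auto
  then have t: "0 \<le> t" using L[OF h0] L2_set_nonneg[of h0 "{..<n}"] by linarith
  let ?S = "\<lambda>a. SUP h\<in>L. vec_inner n a h"
  have le: "vec_inner n a h \<le> vec_norm n a * t" "- (vec_norm n a * t) \<le> vec_inner n a h" if "h \<in> L" for a h
    using abs_vec_inner_le[of n a h] mult_left_mono[OF L[OF that] L2_set_nonneg[of a "{..<n}"]] by linarith+
  have bdd: "bdd_above (vec_inner n a ` L)" for a using le by (auto intro!: bdd_aboveI)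
  obtain D where D: "countable D" "D \<subseteq> L" "L \<subseteq> closure D" using separable by blast
  have "(\<lambda>a. SUP h\<in>D. vec_inner n a h) \<in> borel_measurable (std_gauss n)"
  proof (rule borel_measurable_cSUP[OF D(1)])
    show "bdd_above ((\<lambda>h. vec_inner n a h) ` D)" for a
      using bdd D(2) by (meson bdd_above_mono image_mono)
  qed measurable
  moreover have "?S = (\<lambda>a. SUP h\<in>D. vec_inner n a h)"
    using h0 by (intro ext SUP_dense_subset[OF continuous_on_vec_inner D(2,3) _ bdd]) auto
  ultimately have meas: "?S \<in> borel_measurable (std_gauss n)" by simp
  have abs: "\<bar>?S a\<bar> \<le> (\<Sum>i<n. \<bar>a i\<bar>) * t" for a
  proof -
    have "?S a \<le> vec_norm n a * t" using h0 le by (intro cSUP_least) auto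
    moreover have "- (vec_norm n a * t) \<le> ?S a" using le(2)[OF h0] cSUP_upper[OF h0 bdd] by (rule order.trans)
    moreover have "vec_norm n a * t \<le> (\<Sum>i<n. \<bar>a i\<bar>) * t" using t by (intro mult_right_mono L2_set_le_sum_abs)
    ultimately show ?thesis by linarith
  qed
  have int: "integrable (std_gauss n) ?S"
  proof (rule Bochner_Integration.integrable_bound[OF _ meas])
    show "integrable (std_gauss n) (\<lambda>a. (\<Sum>i<n. \<bar>a i\<bar>) * t)"
      using integrable_std_gauss_coord by (intro integrable_mult_left Bochner_Integration.integrable_sum integrable_abs) auto
    show "AE a in std_gauss n. norm (?S a) \<le> norm ((\<Sum>i<n. \<bar>a i\<bar>) * t)"
      using abs by (intro AE_I2) (smt (verit) real_norm_def)
  qed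
  have Max: "Max (vec_inner n a ` H) \<le> ?S a" "vec_inner n a h \<le> Max (vec_inner n a ` H)" if "h \<in> H" for a h
    using H that bdd by (auto intro!: cSUP_upper)
  obtain h where h: "h \<in> H" using H by auto
  have "integrable (std_gauss n) (\<lambda>a. Max (vec_inner n a ` H))"
  proof (rule Bochner_Integration.integrable_bound)
    show "integrable (std_gauss n) (\<lambda>a. \<bar>?S a\<bar> + \<bar>vec_inner n a h\<bar>)" using int by auto
    show "AE a in std_gauss n. norm (Max (vec_inner n a ` H)) \<le> norm (\<bar>?S a\<bar> + \<bar>vec_inner n a h\<bar>)"
      using Max[OF h] by (intro AE_I2) (smt (verit) real_norm_def)
    show "(\<lambda>a. Max (vec_inner n a ` H)) \<in> borel_measurable (std_gauss n)"
      by (rule borel_measurable_Max[OF H(1)]) measurable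
  qed
  then show ?thesis
    unfolding gaussian_width_def using int Max(1)[OF h] by (intro integral_mono) auto
qed

text \<open>
  The tail bound holds with the same constants for every finite subset of \<open>S\<close>, hence for the union of
  an increasing sequence of finite sets exhausting a countable dense subset. There the means are
  replaced by their common lower bound \<open>e\<close>, so that the estimate is a closed condition on \<open>h\<close> that
  extends to \<open>S\<close> by continuity of \<open>\<xi>\<close> alone.
\<close>

lemma uniform_deviation:
  fixes S :: "(nat \<Rightarrow> real) set"
  assumes T: "prob_space T"
    and meas: "\<And>h. \<xi> h \<in> borel_measurable (std_gauss n \<Otimes>\<^sub>M T)"
    and lip: "\<And>h k \<omega>. \<bar>\<xi> h \<omega> - \<xi> k \<omega>\<bar> \<le> \<bar>vec_inner n (fst \<omega>) h - vec_inner n (fst \<omega>) k\<bar>"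
    and bound: "\<And>h \<omega>. \<bar>\<xi> h \<omega>\<bar> \<le> \<bar>vec_inner n (fst \<omega>) h\<bar>"
    and cont: "\<And>\<omega>. continuous_on UNIV (\<lambda>h. \<xi> h \<omega>)"
    and r: "0 < r" "\<And>h. h \<in> S \<Longrightarrow> vec_norm n h \<le> r"
    and mean: "\<And>h. h \<in> S \<Longrightarrow> e \<le> (\<integral>\<omega>. \<xi> h \<omega> \<partial>(std_gauss n \<Otimes>\<^sub>M T))"
    and width: "\<And>H. finite H \<Longrightarrow> H \<noteq> {} \<Longrightarrow> H \<subseteq> S \<Longrightarrow> (\<integral>a. Max (vec_inner n a ` H) \<partial>std_gauss n) \<le> w"
    and \<beta>: "0 < \<beta>" and w: "4 * w \<le> sqrt m * \<beta>" and \<eta>: "exp (- (m * \<beta>\<^sup>2 / (64 * r\<^sup>2))) \<le> \<eta>"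
  shows "\<exists>E\<in>sets (samples n m T). 1 - \<eta> \<le> measure (samples n m T) E \<and>
     (\<forall>\<omega>\<in>E. \<forall>h\<in>S. m * (e - \<beta>) \<le> (\<Sum>i<m. \<xi> h (\<omega> i)))"
proof (cases "S = {}")
  interpret pair_prob_space "std_gauss n" T
    by (intro pair_prob_space.intro pair_sigma_finite.intro prob_space_imp_sigma_finite prob_space_std_gauss T)
  have "prob_space (samples n m T)"
    unfolding samples_def by (intro prob_space_PiM) (rule prob_space_axioms)
  then interpret Sm: prob_space "samples n m T" .
  {
    case True
    have "0 \<le> \<eta>" using \<eta> exp_gt_zero less_le_trans order.strict_implies_order by blast
    then show ?thesis using True Sm.prob_space by (intro bexI[of _ "space (samples n m T)"]) auto
  next
    case False
    obtain D where D: "countable D" "D \<subseteq> S" "S \<subseteq> closure D" using separable by blast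
    have Dne: "D \<noteq> {}" using D(3) False by auto
    define H where "H k = from_nat_into D ` {..k}" for k :: nat
    have Hk: "finite (H k)" "H k \<noteq> {}" "H k \<subseteq> S" for k
      using from_nat_into[OF Dne] D(2) by (auto simp: H_def)
    have "(\<Union>k. H k) = from_nat_into D ` (\<Union>k. {..k})" unfolding H_def by (rule image_UN[symmetric])
    also have "(\<Union>k. {..k}) = (UNIV :: nat set)" by auto
    finally have HD: "(\<Union>k. H k) = D" using range_from_nat_into[OF Dne D(1)] by simp
    let ?mean = "\<lambda>h. \<integral>\<omega>. \<xi> h \<omega> \<partial>(std_gauss n \<Otimes>\<^sub>M T)"
    define B where "B k = {\<omega> \<in> space (samples n m T). \<exists>h\<in>H k. m * \<beta> \<le> (\<Sum>i<m. ?mean h - \<xi> h (\<omega> i))}" for k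
    have comp: "(\<lambda>\<omega>. \<xi> h (\<omega> i)) \<in> borel_measurable (samples n m T)" if "i < m" for h i
      unfolding samples_def using that meas by (intro measurable_compose[OF _ meas[of h]] measurable_component_singleton) auto
    have sum_meas [measurable]: "(\<lambda>\<omega>. \<Sum>i<m. ?mean h - \<xi> h (\<omega> i)) \<in> borel_measurable (samples n m T)" for h
      using comp by (intro borel_measurable_sum borel_measurable_diff) auto
    have B_sets: "B k \<in> sets (samples n m T)" for k
      unfolding B_def using Hk(1)[of k] by measurable
    have B_prob: "Sm.prob (B k) \<le> \<eta>" for k
    proof -
      interpret linear_dominated_process n T \<xi> "H k"
        by (standard; fact T Hk meas lip bound)
      have "4 * (\<integral>a. Max (vec_inner n a ` H k) \<partial>std_gauss n) \<le> sqrt m * \<beta>"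
        using width[OF Hk(1)[of k] Hk(2)[of k] Hk(3)[of k]] w by linarith
      from process_tail_bound[OF r(1) _ \<beta> this] r(2) Hk(3)[of k]
      show ?thesis unfolding B_def mean_def using \<eta> by (meson order.trans subsetD)
    qed
    have "H j \<subseteq> H k" if "j \<le> k" for j k using that by (auto simp: H_def)
    then have "incseq B" unfolding incseq_def B_def by blast
    then have "(\<lambda>k. Sm.prob (B k)) \<longlonglongrightarrow> Sm.prob (\<Union>k. B k)"
      using B_sets by (intro Sm.finite_Lim_measure_incseq) auto
    then have B: "Sm.prob (\<Union>k. B k) \<le> \<eta>"
      using B_prob by (intro LIMSEQ_le_const2) auto
    let ?E = "space (samples n m T) - (\<Union>k. B k)"
    have UB: "(\<Union>k. B k) \<in> sets (samples n m T)" using B_sets by auto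
    show ?thesis
    proof (intro bexI[of _ ?E] conjI ballI)
      show "?E \<in> sets (samples n m T)" using UB by auto
      show "1 - \<eta> \<le> Sm.prob ?E" using Sm.prob_compl[OF UB] B by simp
      fix \<omega> h assume \<omega>: "\<omega> \<in> ?E" and h: "h \<in> S"
      let ?C = "{h. m * (e - \<beta>) \<le> (\<Sum>i<m. \<xi> h (\<omega> i))}"
      have "closed ?C" using cont by (intro closed_Collect_le continuous_on_const continuous_on_sum) auto
      moreover have "D \<subseteq> ?C"
      proof
        fix k assume k: "k \<in> D"
        then have "\<not> m * \<beta> \<le> (\<Sum>i<m. ?mean k - \<xi> k (\<omega> i))" using \<omega> HD unfolding B_def by blast
        moreover have "m * e \<le> m * ?mean k" using mean[of k] D(2) k by (intro mult_left_mono) auto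
        ultimately show "k \<in> ?C" by (simp add: sum_subtractf algebra_simps)
      qed
      ultimately have "closure D \<subseteq> ?C" by (simp add: closure_minimal)
      then show "m * (e - \<beta>) \<le> (\<Sum>i<m. \<xi> h (\<omega> i))" using D(3) h by auto
    qed
  }
qed

section \<open>From the excess risk to the minimizer\<close>

lemma vec_norm_diff: "vec_norm n (vec_diff n x y) = L2_set (\<lambda>i. x i - y i) {..<n}"
  by (rule L2_set_cong) (auto simp: vec_diff_def)

lemma vec_norm_scale: "vec_norm n (vec_scale n c x) = \<bar>c\<bar> * vec_norm n x"
proof -
  have "vec_norm n (vec_scale n c x) = L2_set (\<lambda>i. c * x i) {..<n}"
    by (rule L2_set_cong) (auto simp: vec_scale_def)
  also have "\<dots> = L2_set (\<lambda>i. \<bar>c\<bar> * x i) {..<n}" by (simp add: L2_set_def power_mult_distrib)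
  finally show ?thesis by (simp add: L2_set_right_distrib)
qed

lemma vec_norm_triangle: "vec_norm n (vec_diff n x z) \<le> vec_norm n (vec_diff n x y) + vec_norm n (vec_diff n y z)"
  unfolding vec_norm_diff using L2_set_triangle_ineq[of "\<lambda>i. x i - y i" "\<lambda>i. y i - z i" "{..<n}"] by simp

lemma vec_norm_diff_commute: "vec_norm n (vec_diff n x y) = vec_norm n (vec_diff n y x)"
  unfolding vec_norm_diff by (simp add: L2_set_def power2_commute)

text \<open>
  Compare both sides with \<open>x / \<mu>\<close>: it is within \<open>r / \<mu>\<close> of \<open>x\<^sub>0\<close>, and normalizing it changes
  its length by \<open>\<bar>\<parallel>x\<parallel> - \<mu>\<bar> / \<mu> \<le> r / \<mu>\<close>.
\<close>

lemma normalized_distance_le: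
  assumes \<mu>: "0 < \<mu>" and x0: "vec_norm n x0 = 1"
    and close: "vec_norm n (vec_diff n x (vec_scale n \<mu> x0)) \<le> r" and r: "r < \<mu>"
  shows "vec_norm n (vec_diff n x0 (vec_scale n (1 / vec_norm n x) x)) \<le> 2 * r / \<mu>"
proof -
  let ?N = "vec_norm n x"
  let ?z = "vec_scale n (1 / \<mu>) x"
  have zero: "vec_norm n (vec_diff n a (vec_zero n)) = vec_norm n a" for a
    unfolding vec_norm_diff by (rule L2_set_cong) (auto simp: vec_zero_def)
  have tri: "\<mu> \<le> r + ?N" "?N \<le> r + \<mu>"
    using vec_norm_triangle[of n "vec_scale n \<mu> x0" "vec_zero n" x] vec_norm_triangle[of n x "vec_zero n" "vec_scale n \<mu> x0"]
      close vec_norm_diff_commute[of n x] \<mu> by (simp_all add: zero vec_norm_scale x0)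
  have N: "0 < ?N" using tri(1) r by linarith
  have "vec_norm n (vec_diff n x0 ?z) = vec_norm n (vec_scale n (1 / \<mu>) (vec_diff n x (vec_scale n \<mu> x0)))"
    unfolding vec_norm_diff_commute[of n x0] using \<mu>
    by (intro L2_set_cong) (auto simp: vec_diff_def vec_scale_def field_simps)
  also have "\<dots> \<le> 1 / \<mu> * r" unfolding vec_norm_scale using \<mu> close by (simp add: divide_right_mono)
  finally have a: "vec_norm n (vec_diff n x0 ?z) \<le> r / \<mu>" by simp
  have "vec_norm n (vec_diff n ?z (vec_scale n (1 / ?N) x)) = vec_norm n (vec_scale n (1 / \<mu> - 1 / ?N) x)"
    by (intro L2_set_cong) (auto simp: vec_diff_def vec_scale_def left_diff_distrib)
  also have "\<dots> = \<bar>?N - \<mu>\<bar> / \<mu>"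
  proof -
    have "1 / \<mu> - 1 / ?N = (?N - \<mu>) / (\<mu> * ?N)" using \<mu> N by (simp add: field_simps)
    then show ?thesis unfolding vec_norm_scale using \<mu> N by (simp add: abs_mult)
  qed
  also have "\<dots> \<le> r / \<mu>" using tri \<mu> by (intro divide_right_mono) (auto simp: abs_le_iff)
  finally have b: "vec_norm n (vec_diff n ?z (vec_scale n (1 / ?N) x)) \<le> r / \<mu>" .
  \<comment> \<open>The normalized vector is reached from \<open>x\<^sub>0\<close> via \<open>x / \<mu>\<close>.\<close>
  show ?thesis using vec_norm_triangle[of n x0 "vec_scale n (1 / ?N) x" ?z] a b by simp
qed

lemma hinge_convex:
  assumes "0 \<le> \<kappa>" "\<kappa> \<le> 1"
  shows "hinge ((1 - \<kappa>) * u + \<kappa> * v) \<le> (1 - \<kappa>) * hinge u + \<kappa> * hinge v"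
proof -
  have "0 \<le> (1 - \<kappa>) * hinge u + \<kappa> * hinge v" using assms by (simp add: hinge_def)
  moreover have "(1 - \<kappa>) * (1 - u) + \<kappa> * (1 - v) \<le> (1 - \<kappa>) * hinge u + \<kappa> * hinge v"
    using assms by (intro add_mono mult_left_mono) (auto simp: hinge_def)
  moreover have "1 - ((1 - \<kappa>) * u + \<kappa> * v) = (1 - \<kappa>) * (1 - u) + \<kappa> * (1 - v)" by (simp add: algebra_simps)
  ultimately show ?thesis unfolding hinge_def[of "(1 - \<kappa>) * u + \<kappa> * v"] by (metis max.boundedI)
qed

lemma empirical_hinge_convex:
  assumes \<kappa>: "0 \<le> \<kappa>" "\<kappa> \<le> 1"
  shows "empirical_hinge n m a y (vec_add n (vec_scale n (1 - \<kappa>) u) (vec_scale n \<kappa> v))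
    \<le> (1 - \<kappa>) * empirical_hinge n m a y u + \<kappa> * empirical_hinge n m a y v"
proof -
  have "(\<Sum>i<m. hinge (y i * vec_inner n (a i) (vec_add n (vec_scale n (1 - \<kappa>) u) (vec_scale n \<kappa> v))))
     \<le> (\<Sum>i<m. (1 - \<kappa>) * hinge (y i * vec_inner n (a i) u) + \<kappa> * hinge (y i * vec_inner n (a i) v))"
  proof (rule sum_mono)
    fix i
    have "y i * vec_inner n (a i) (vec_add n (vec_scale n (1 - \<kappa>) u) (vec_scale n \<kappa> v))
        = (1 - \<kappa>) * (y i * vec_inner n (a i) u) + \<kappa> * (y i * vec_inner n (a i) v)"
      unfolding vec_inner_linear by (simp add: algebra_simps)
    then show "hinge (y i * vec_inner n (a i) (vec_add n (vec_scale n (1 - \<kappa>) u) (vec_scale n \<kappa> v)))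
      \<le> (1 - \<kappa>) * hinge (y i * vec_inner n (a i) u) + \<kappa> * hinge (y i * vec_inner n (a i) v)"
      using hinge_convex[OF \<kappa>] by simp
  qed
  also have "\<dots> = (1 - \<kappa>) * (\<Sum>i<m. hinge (y i * vec_inner n (a i) u)) + \<kappa> * (\<Sum>i<m. hinge (y i * vec_inner n (a i) v))"
    by (simp add: sum.distrib sum_distrib_left)
  finally have "1 / real m * (\<Sum>i<m. hinge (y i * vec_inner n (a i) (vec_add n (vec_scale n (1 - \<kappa>) u) (vec_scale n \<kappa> v))))
     \<le> 1 / real m * ((1 - \<kappa>) * (\<Sum>i<m. hinge (y i * vec_inner n (a i) u)) + \<kappa> * (\<Sum>i<m. hinge (y i * vec_inner n (a i) v)))"
    by (intro mult_left_mono) auto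
  then show ?thesis unfolding empirical_hinge_def by (simp add: distrib_left mult.left_commute)
qed

text \<open>
  Otherwise the segment from \<open>z\<close> to the minimizer leaves the ball at a point of \<open>K\<close> where,
  by convexity, the empirical risk is at most its value at \<open>z\<close>.
\<close>

lemma minimizer_in_ball:
  assumes K: "vec_convex n K" and z: "z \<in> K" and min: "is_arg_min (empirical_hinge n m a y) (\<lambda>x. x \<in> K) xhat" and r: "0 < r"
    and sphere: "\<And>x. x \<in> K \<Longrightarrow> vec_norm n (vec_diff n x z) = r \<Longrightarrow> empirical_hinge n m a y z < empirical_hinge n m a y x"
  shows "vec_norm n (vec_diff n xhat z) \<le> r"
proof (rule ccontr)
  assume "\<not> ?thesis"
  then have far: "r < vec_norm n (vec_diff n xhat z)" (is "_ < ?d") by simp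
  let ?L = "empirical_hinge n m a y"
  define \<kappa> where "\<kappa> = r / ?d"
  have \<kappa>: "0 \<le> \<kappa>" "\<kappa> \<le> 1" using r far by (auto simp: \<kappa>_def)
  define x where "x = vec_add n (vec_scale n (1 - \<kappa>) z) (vec_scale n \<kappa> xhat)"
  have xhat: "xhat \<in> K" and opt: "?L xhat \<le> ?L z" using min z by (auto simp: is_arg_min_def not_less)
  have x: "x \<in> K" using K z xhat \<kappa> unfolding vec_convex_def x_def by auto
  have "vec_norm n (vec_diff n x z) = vec_norm n (vec_scale n \<kappa> (vec_diff n xhat z))"
    by (intro L2_set_cong) (auto simp: x_def vec_add_def vec_diff_def vec_scale_def algebra_simps)
  also have "\<dots> = r" using \<kappa> r far by (simp add: vec_norm_scale) (simp add: \<kappa>_def)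
  finally have "?L z < ?L x" by (rule sphere[OF x])
  also have "?L x \<le> (1 - \<kappa>) * ?L z + \<kappa> * ?L xhat" unfolding x_def by (rule empirical_hinge_convex[OF \<kappa>])
  also have "\<dots> \<le> (1 - \<kappa>) * ?L z + \<kappa> * ?L z" using opt \<kappa> by (intro add_left_mono mult_left_mono)
  also have "\<dots> = ?L z" by (simp add: algebra_simps)
  finally show False by simp
qed

context quantized_gaussian
begin

lemma empirical_hinge_diff:
  "empirical_hinge n m (\<lambda>i. fst (\<omega> i)) (response n F x0 \<omega>) x
     - empirical_hinge n m (\<lambda>i. fst (\<omega> i)) (response n F x0 \<omega>) (vec_scale n \<mu> x0)
   = 1 / real m * (\<Sum>i<m. excess_loss n x0 \<mu> (vec_diff n x (vec_scale n \<mu> x0)) (\<omega> i))"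
  unfolding empirical_hinge_def response_def excess_loss_def
  by (simp add: vec_inner_linear sum_subtractf right_diff_distrib)

lemma continuous_on_excess_loss: "continuous_on UNIV (\<lambda>h. excess_loss n x0 \<mu> h \<omega>)"
  unfolding excess_loss_def hinge_def by (intro continuous_intros continuous_on_vec_inner)

text \<open>
  The radius is \<open>r = t/2\<close> and the deviation \<open>\<beta>\<close> is half of the lower bound \<open>c \<lambda> r\<^sup>2\<close> for the excess
  risk, \<open>c\<close> being \<^const>\<open>excess_const\<close>. The constant \<open>1024 / c\<^sup>2\<close> is the one
  for which the two requirements \<open>4 w \<le> sqrt m \<beta>\<close> and \<open>m \<beta>\<^sup>2 / (64 r\<^sup>2) \<ge> ln (1/\<eta>)\<close> follow from the
  respective terms of the maximum in the sample size condition.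
\<close>

lemma recovery_event:
  assumes K: "K \<subseteq> vec_ball n 1" "vec_convex n K" "vec_zero n \<in> K" and x0: "x0 \<in> K" "vec_norm n x0 = 1"
    and pos: "0 < correlation F T" and cond: "cond_sign_nonneg F T"
    and min: "is_arg_min (hinge_risk F T) (\<lambda>s. s \<in> {0..1}) \<mu>"
    and t: "0 < t" "t < \<mu>" and \<eta>: "0 < \<eta>" "\<eta> < 1 / 2"
    and m: "1024 / excess_const\<^sup>2 * (1 / (correlation F T)\<^sup>2) * (1 / t\<^sup>2) *
              max (eff_dim n t ((\<lambda>x. vec_diff n x (vec_scale n \<mu> x0)) ` K)) (ln (1 / \<eta>)) \<le> real m"
  shows "\<exists>E\<in>sets (samples n m T). 1 - \<eta> \<le> measure (samples n m T) E \<and>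
     (\<forall>\<omega>\<in>E. \<forall>xhat. is_arg_min (empirical_hinge n m (\<lambda>i. fst (\<omega> i)) (response n F x0 \<omega>)) (\<lambda>x. x \<in> K) xhat \<longrightarrow>
        vec_norm n (vec_diff n x0 (vec_scale n (1 / vec_norm n xhat) xhat)) \<le> t / \<mu>)"
proof -
  let ?z = "vec_scale n \<mu> x0"
  let ?h = "\<lambda>x. vec_diff n x ?z"
  let ?l = "correlation F T" and ?c = excess_const
  define S where "S = {h \<in> ?h ` K. vec_norm n h = t / 2}"
  define w where "w = gaussian_width n (?h ` K \<inter> vec_ball n t)"
  define \<beta> where "\<beta> = ?c * ?l * t\<^sup>2 / 8"
  have c: "0 < ?c" by (rule excess_const_pos)
  have \<beta>: "0 < \<beta>" using c pos t by (simp add: \<beta>_def)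
  have \<mu>: "0 < \<mu>" "\<mu> \<le> 1" using min t by (auto simp: is_arg_min_def)
  have z: "?z \<in> K"
  proof -
    have "vec_add n (vec_scale n \<mu> x0) (vec_scale n (1 - \<mu>) (vec_zero n)) \<in> K"
      using K(2,3) x0(1) \<mu> unfolding vec_convex_def by auto
    moreover have "vec_add n (vec_scale n \<mu> x0) (vec_scale n (1 - \<mu>) (vec_zero n)) = ?z"
      by (auto simp: vec_add_def vec_scale_def vec_zero_def fun_eq_iff)
    ultimately show ?thesis by simp
  qed
  let ?q = "1024 / ?c\<^sup>2 * (1 / ?l\<^sup>2) * (1 / t\<^sup>2)"
  have q: "0 < ?q" using c pos t by simp
  have m_w: "?q * (w\<^sup>2 / t\<^sup>2) \<le> m"
    using mult_left_mono[OF max.cobounded1, of ?q] m q unfolding eff_dim_def w_def by (meson order.strict_implies_order order.trans)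
  have m_\<eta>: "?q * ln (1 / \<eta>) \<le> m"
    using mult_left_mono[OF max.cobounded2, of ?q] m q by (meson order.strict_implies_order order.trans)
  have m0: "0 < real m"
  proof -
    have "0 < ln (1 / \<eta>)" using \<eta> by (intro ln_gt_zero) (auto simp: field_simps)
    then have "0 < ?q * ln (1 / \<eta>)" using q by (rule mult_pos_pos[rotated])
    then show ?thesis using m_\<eta> by linarith
  qed
  have w: "4 * w \<le> sqrt m * \<beta>"
  proof (rule power2_le_imp_le)
    have "16 * w\<^sup>2 = (?q * (w\<^sup>2 / t\<^sup>2)) * \<beta>\<^sup>2"
      using c pos t by (simp add: \<beta>_def field_simps power2_eq_square)
    also have "\<dots> \<le> m * \<beta>\<^sup>2" using m_w by (intro mult_right_mono) auto
    finally show "(4 * w)\<^sup>2 \<le> (sqrt m * \<beta>)\<^sup>2" by (simp add: power_mult_distrib)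
  qed (use \<beta> in simp)
  have tail: "exp (- (m * \<beta>\<^sup>2 / (64 * (t / 2)\<^sup>2))) \<le> \<eta>"
  proof -
    have "ln (1 / \<eta>) = (?q * ln (1 / \<eta>)) * (\<beta>\<^sup>2 / (64 * (t / 2)\<^sup>2))"
      using c pos t by (simp add: \<beta>_def field_simps power2_eq_square)
    also have "\<dots> \<le> m * (\<beta>\<^sup>2 / (64 * (t / 2)\<^sup>2))" using m_\<eta> by (intro mult_right_mono) auto
    finally have "- (m * \<beta>\<^sup>2 / (64 * (t / 2)\<^sup>2)) \<le> ln \<eta>" using \<eta> by (simp add: ln_div)
    then show ?thesis using \<eta> by (metis exp_le_cancel_iff exp_ln)
  qed
  have "\<exists>E\<in>sets (samples n m T). 1 - \<eta> \<le> measure (samples n m T) E \<and>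
     (\<forall>\<omega>\<in>E. \<forall>h\<in>S. m * (2 * \<beta> - \<beta>) \<le> (\<Sum>i<m. excess_loss n x0 \<mu> h (\<omega> i)))"
  proof (rule uniform_deviation[where r = "t / 2" and w = w])
    show "prob_space T" by (rule T.prob_space_axioms)
    show "vec_norm n h \<le> t / 2" if "h \<in> S" for h using that by (simp add: S_def)
    show "2 * \<beta> \<le> (\<integral>\<omega>. excess_loss n x0 \<mu> h \<omega> \<partial>(std_gauss n \<Otimes>\<^sub>M T))" if "h \<in> S" for h
    proof -
      obtain x where x: "x \<in> K" "h = ?h x" "vec_norm n (?h x) = t / 2" using \<open>h \<in> S\<close> by (auto simp: S_def)
      have "vec_norm n x \<le> 1" using x(1) K(1) by (auto simp: vec_ball_def)
      from excess_risk_ge[OF cond min pos _ _ x0(2) this x(3)] t show ?thesis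
        by (simp add: x(2) \<beta>_def power_divide)
    qed
    show "(\<integral>a. Max (vec_inner n a ` H) \<partial>std_gauss n) \<le> w" if "finite H" "H \<noteq> {}" "H \<subseteq> S" for H
      unfolding w_def
    proof (rule expectation_Max_le_gaussian_width[OF _ that(1,2), where t = t])
      show "H \<subseteq> ?h ` K \<inter> vec_ball n t" using that(3) t by (auto simp: S_def vec_ball_def)
    qed (simp add: vec_ball_def)
  qed (use t \<beta> w tail measurable_excess_loss excess_loss_lipschitz excess_loss_bound continuous_on_excess_loss in auto)
  then obtain E where E: "E \<in> sets (samples n m T)" "1 - \<eta> \<le> measure (samples n m T) E"
    and dev: "\<And>\<omega> h. \<omega> \<in> E \<Longrightarrow> h \<in> S \<Longrightarrow> m * \<beta> \<le> (\<Sum>i<m. excess_loss n x0 \<mu> h (\<omega> i))"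
    by auto
  show ?thesis
  proof (intro bexI[OF _ E(1)] conjI E(2) ballI allI impI)
    fix \<omega> xhat assume \<omega>: "\<omega> \<in> E"
    let ?L = "empirical_hinge n m (\<lambda>i. fst (\<omega> i)) (response n F x0 \<omega>)"
    assume xhat: "is_arg_min ?L (\<lambda>x. x \<in> K) xhat"
    have "vec_norm n (vec_diff n xhat ?z) \<le> t / 2"
    proof (rule minimizer_in_ball[OF K(2) z xhat])
      fix x assume x: "x \<in> K" "vec_norm n (vec_diff n x ?z) = t / 2"
      have "0 < m * \<beta>" using m0 \<beta> by simp
      also have "\<dots> \<le> (\<Sum>i<m. excess_loss n x0 \<mu> (?h x) (\<omega> i))" using dev[OF \<omega>, of "?h x"] x by (auto simp: S_def)
      finally have "0 < ?L x - ?L ?z" unfolding empirical_hinge_diff using m0 by simp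
      then show "?L ?z < ?L x" by simp
    qed (use t in simp)
    from normalized_distance_le[OF \<mu>(1) x0(2) this] t
    show "vec_norm n (vec_diff n x0 (vec_scale n (1 / vec_norm n xhat) xhat)) \<le> t / \<mu>" by simp
  qed
qed

end

theorem theorem2p10:
  shows "\<exists>C>0::real. \<exists>C'>0::real.
    \<forall>(n::nat) (m::nat) (F::real \<Rightarrow> real \<Rightarrow> real) (T::real measure)
      (K::(nat \<Rightarrow> real) set) (x0::nat \<Rightarrow> real) (\<mu>::real) (t::real) (\<eta>::real).
      quantizer F T \<longrightarrow>
      K \<subseteq> vec_ball n 1 \<longrightarrow> vec_convex n K \<longrightarrow> vec_zero n \<in> K \<longrightarrow>
      x0 \<in> K \<longrightarrow> vec_norm n x0 = 1 \<longrightarrow>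
      correlation F T > 0 \<longrightarrow>
      cond_sign_nonneg F T \<longrightarrow>
      is_arg_min (hinge_risk F T) (\<lambda>s. s \<in> {0..1}) \<mu> \<longrightarrow>
      0 < t \<longrightarrow> t < \<mu> \<longrightarrow> 0 < \<eta> \<longrightarrow> \<eta> < 1 / 2 \<longrightarrow>
      (\<exists>E \<in> sets (samples n m T).
         measure (samples n m T) E \<ge> 1 - \<eta> \<and>
         (\<forall>\<omega>\<in>E.
            real m \<ge> C * (1 / (correlation F T)\<^sup>2) * (1 / t\<^sup>2) *
              max (eff_dim n t ((\<lambda>x. vec_diff n x (vec_scale n \<mu> x0)) ` K)) (ln (1 / \<eta>)) \<longrightarrow>
            (\<forall>xhat. is_arg_min
                 (empirical_hinge n m (\<lambda>i. fst (\<omega> i)) (response n F x0 \<omega>))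
                 (\<lambda>x. x \<in> K) xhat \<longrightarrow>
               vec_norm n (vec_diff n x0 (vec_scale n (1 / vec_norm n xhat) xhat)) \<le> t / \<mu> \<and>
               t / \<mu> \<le> C' * t * sqrt (ln (1 / correlation F T)))))"
proof (rule exI[of _ "1024 / excess_const\<^sup>2"], intro exI[of _ "3::real"] conjI allI impI)
  show "0 < 1024 / excess_const\<^sup>2" using excess_const_pos by simp
  fix n m :: nat and F :: "real \<Rightarrow> real \<Rightarrow> real" and T :: "real measure"
    and K :: "(nat \<Rightarrow> real) set" and x0 :: "nat \<Rightarrow> real" and \<mu> t \<eta> :: real
  assume q: "quantizer F T" and K: "K \<subseteq> vec_ball n 1" "vec_convex n K" "vec_zero n \<in> K"
    and x0: "x0 \<in> K" "vec_norm n x0 = 1" and pos: "correlation F T > 0" and cond: "cond_sign_nonneg F T"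
    and min: "is_arg_min (hinge_risk F T) (\<lambda>s. s \<in> {0..1}) \<mu>"
    and t: "0 < t" "t < \<mu>" and \<eta>: "0 < \<eta>" "\<eta> < 1 / 2"
  interpret quantized_gaussian F T by standard (rule q)
  let ?enough = "real m \<ge> 1024 / excess_const\<^sup>2 * (1 / (correlation F T)\<^sup>2) * (1 / t\<^sup>2) *
              max (eff_dim n t ((\<lambda>x. vec_diff n x (vec_scale n \<mu> x0)) ` K)) (ln (1 / \<eta>))"
  let ?good = "\<lambda>\<omega>. \<forall>xhat. is_arg_min
                 (empirical_hinge n m (\<lambda>i. fst (\<omega> i)) (response n F x0 \<omega>))
                 (\<lambda>x. x \<in> K) xhat \<longrightarrow>
               vec_norm n (vec_diff n x0 (vec_scale n (1 / vec_norm n xhat) xhat)) \<le> t / \<mu>"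
  have "t * (1 / \<mu>) \<le> t * (3 * sqrt (ln (1 / correlation F T)))"
    using inverse_\<mu>_le[OF min _ pos] t by (intro mult_left_mono) auto
  then have second: "t / \<mu> \<le> 3 * t * sqrt (ln (1 / correlation F T))" by (simp add: ac_simps)
  have "\<exists>E\<in>sets (samples n m T). 1 - \<eta> \<le> measure (samples n m T) E \<and> (\<forall>\<omega>\<in>E. ?enough \<longrightarrow> ?good \<omega>)"
  proof (cases ?enough)
    case True
    then show ?thesis using recovery_event[OF K x0 pos cond min t \<eta> True] by blast
  next
    case False
    interpret G: prob_space "std_gauss n" by (rule prob_space_std_gauss)
    interpret GT: pair_prob_space "std_gauss n" T ..
    have "prob_space (samples n m T)"
      unfolding samples_def by (intro prob_space_PiM) (rule GT.prob_space_axioms)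
    then have "measure (samples n m T) (space (samples n m T)) = 1" by (rule prob_space.prob_space)
    \<comment> \<open>With too few samples nothing is claimed, so the event may be the whole space.\<close>
    then show ?thesis using False \<eta> by (intro bexI[of _ "space (samples n m T)"]) auto
  qed
  then show "\<exists>E \<in> sets (samples n m T).
         measure (samples n m T) E \<ge> 1 - \<eta> \<and>
         (\<forall>\<omega>\<in>E. ?enough \<longrightarrow>
            (\<forall>xhat. is_arg_min
                 (empirical_hinge n m (\<lambda>i. fst (\<omega> i)) (response n F x0 \<omega>))
                 (\<lambda>x. x \<in> K) xhat \<longrightarrow>
               vec_norm n (vec_diff n x0 (vec_scale n (1 / vec_norm n xhat) xhat)) \<le> t / \<mu> \<and>
               t / \<mu> \<le> 3 * t * sqrt (ln (1 / correlation F T))))"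
    using second by blast
qed simp

end
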